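(* For any $[\phi]\in\operatorname{Out}(\Gamma)$ and for any open simplex $\Delta$ in $\mathcal O(\Gamma)$, the function $\lambda=\lambda_\phi$ is quasi-convex on Euclidean segments of $\Delta$. Moreover, if $A,B\in\Delta$ are the endpoints of such a segment and $\lambda(A)>\lambda(B)$, then $\lambda$ is strictly monotone near $A$ on the segment $\overline{AB}$.
   Context: **Setting.** $\Gamma=\bigsqcup_{i=1}^k\Gamma_i$ is a finite disjoint union of connected finite graphs of groups with trivial edge groups and non-trivial fundamental groups $H_i=\pi_1(\Gamma_i)$ (as graphs of groups), each $H_i$ being equipped with the free splitting given by the vertex groups of $\Gamma_i$. $\mathcal O(\Gamma_i)$ is the set of equivariant isometry classes of minimal metric simplicial $H_i$-trees (simplicial isometric actions) with trivial edge stabilisers such that: for each non-trivial vertex group $V$ of $\Gamma_i$ there is exactly one orbit of vertices with stabiliser conjugate to $V$ (non-free vertices); every other vertex has trivial stabiliser (free vertices); no free vertex has valence two. (If $H_i$ is itself a vertex group, this is a single point.) $\mathcal O(\Gamma)=\prod_i\mathcal O(\Gamma_i)$. The open simplex $\Delta_X$ of $X\in\mathcal O(\Gamma)$ is the set of points equivariantly homeomorphic to $X$, parametrised by the positive lengths of the orbits of edges (so $\Delta_X$ is an open positive cone in a Euclidean space); Euclidean segments are taken in these coordinates. **Automorphisms and displacement.** $\operatorname{Aut}(\Gamma)$ is the group of tuples $\phi=(\sigma,\phi_1,\dots,\phi_k)$ with $\sigma$ a permutation of $\{1,\dots,k\}$ and $\phi_i:H_i\to H_{\sigma(i)}$ an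 isomorphism mapping each vertex group to a conjugate of a vertex group; $\operatorname{Inn}(\Gamma)$ consists of those with $\sigma=\mathrm{id}$ and all $\phi_i$ inner; $\operatorname{Out}(\Gamma)=\operatorname{Aut}(\Gamma)/\operatorname{Inn}(\Gamma)$. $\phi X=(\phi_1X_{\sigma(1)},\dots,\phi_kX_{\sigma(k)})$, where $\phi_iX_{\sigma(i)}$ is $X_{\sigma(i)}$ with $H_i$ acting through $\phi_i$. $\Lambda(X,Y)$ is the minimum of $\operatorname{Lip}(f)$ over tuples $f$ of Lipschitz $H_i$-equivariant maps $f_i:X_i\to Y_i$, and $\lambda_\phi(X)=\Lambda(X,\phi X)$. **Quasi-convexity.** A function $f:[a_0,b_0]\to\mathbb R$ is quasi-convex if for all $[a,b]\subseteq[a_0,b_0]$ and all $t\in[a,b]$, $f(t)\le\max\{f(a),f(b)\}$. *)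

theory Defs
  imports
    "HOL-Algebra.Group_Action"
    "HOL-Algebra.Coset"
    "HOL-Combinatorics.Permutations"
    "HOL-Analysis.Abstract_Metric_Spaces"
begin

section \<open>Graphs of groups with trivial edge groups and their fundamental groups\<close>

text \<open>Graphs are taken in the sense of Serre: every geometric edge occurs as a pair of
  oppositely oriented edges, exchanged by \<open>erev\<close>. As all edge groups are trivial, no edge
  group data has to be recorded. The base vertex only serves to define the fundamental group.\<close>

record ('x, 'e, 'g) gog =
  gverts :: "'x set"
  gedges :: "'e set"
  esrc :: "'e \<Rightarrow> 'x"
  etgt :: "'e \<Rightarrow> 'x"
  erev :: "'e \<Rightarrow> 'e"
  vgroup :: "'x \<Rightarrow> 'g monoid"
  gbase :: "'x"

datatype ('x, 'e, 'g) letter = VLetter 'x 'g | ELetter 'e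

fun gpath :: "('x, 'e, 'g) gog \<Rightarrow> 'x \<Rightarrow> ('x, 'e, 'g) letter list \<Rightarrow> 'x \<Rightarrow> bool" where
  "gpath G u [] v \<longleftrightarrow> u = v \<and> u \<in> gverts G"
| "gpath G u (VLetter x g # p) v \<longleftrightarrow>
     x = u \<and> u \<in> gverts G \<and> g \<in> carrier (vgroup G u) \<and> gpath G u p v"
| "gpath G u (ELetter e # p) v \<longleftrightarrow> e \<in> gedges G \<and> esrc G e = u \<and> gpath G (etgt G e) p v"

definition graph_of_groups :: "('x, 'e, 'g) gog \<Rightarrow> bool" where
  "graph_of_groups G \<longleftrightarrow>
     finite (gverts G) \<and> finite (gedges G) \<and> gbase G \<in> gverts G \<and>
     (\<forall>e\<in>gedges G. esrc G e \<in> gverts G \<and> etgt G e \<in> gverts G \<and>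
        erev G e \<in> gedges G \<and> erev G e \<noteq> e \<and> erev G (erev G e) = e \<and>
        esrc G (erev G e) = etgt G e \<and> etgt G (erev G e) = esrc G e) \<and>
     (\<forall>v\<in>gverts G. group (vgroup G v)) \<and>
     (\<forall>u\<in>gverts G. \<forall>v\<in>gverts G. \<exists>p. gpath G u p v)"

inductive elem_step ::
  "('x, 'e, 'g) gog \<Rightarrow> ('x, 'e, 'g) letter list \<Rightarrow> ('x, 'e, 'g) letter list \<Rightarrow> bool"
  for G where
  mult_step: "elem_step G (p @ [VLetter v g, VLetter v h] @ q)
                          (p @ [VLetter v (g \<otimes>\<^bsub>vgroup G v\<^esub> h)] @ q)"
| one_step: "elem_step G (p @ [VLetter v \<one>\<^bsub>vgroup G v\<^esub>] @ q) (p @ q)"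
| backtrack_step: "elem_step G (p @ [ELetter e, ELetter (erev G e)] @ q) (p @ q)"

definition loop_class ::
  "('x, 'e, 'g) gog \<Rightarrow> ('x, 'e, 'g) letter list \<Rightarrow> ('x, 'e, 'g) letter list set" where
  "loop_class G p = {q. gpath G (gbase G) q (gbase G) \<and>
     equivclp (\<lambda>a b. gpath G (gbase G) a (gbase G) \<and> gpath G (gbase G) b (gbase G) \<and>
                     elem_step G a b) p q}"

definition pi1 :: "('x, 'e, 'g) gog \<Rightarrow> ('x, 'e, 'g) letter list set monoid" where
  "pi1 G = \<lparr>carrier = {loop_class G p | p. gpath G (gbase G) p (gbase G)},
            monoid.mult = (\<lambda>A B. \<Union>a\<in>A. \<Union>b\<in>B. loop_class G (a @ b)),
            monoid.one = loop_class G []\<rparr>"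

fun inv_letter :: "('x, 'e, 'g) gog \<Rightarrow> ('x, 'e, 'g) letter \<Rightarrow> ('x, 'e, 'g) letter" where
  "inv_letter G (VLetter v g) = VLetter v (inv\<^bsub>vgroup G v\<^esub> g)"
| "inv_letter G (ELetter e) = ELetter (erev G e)"

definition inv_path ::
  "('x, 'e, 'g) gog \<Rightarrow> ('x, 'e, 'g) letter list \<Rightarrow> ('x, 'e, 'g) letter list" where
  "inv_path G p = rev (map (inv_letter G) p)"

text \<open>A vertex group is a subgroup of the fundamental group only up to conjugacy. Letting \<open>p\<close>
  range over all paths from the base vertex to \<open>v\<close> yields the whole conjugacy class.\<close>

definition vertex_subgroups ::
  "('x, 'e, 'g) gog \<Rightarrow> 'x \<Rightarrow> ('x, 'e, 'g) letter list set set set" where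
  "vertex_subgroups G v =
     {{loop_class G (p @ [VLetter v g] @ inv_path G p) | g. g \<in> carrier (vgroup G v)} | p.
        gpath G (gbase G) p v}"

definition nontrivial_verts :: "('x, 'e, 'g) gog \<Rightarrow> 'x set" where
  "nontrivial_verts G = {v \<in> gverts G. carrier (vgroup G v) \<noteq> {\<one>\<^bsub>vgroup G v\<^esub>}}"

text \<open>The disjoint union of the \<open>\<Gamma>\<^sub>i\<close> is given as the nonempty list of its components,
  so that the indices are \<open>0, \<dots>, k - 1\<close>.\<close>

definition gog_union :: "('x, 'e, 'g) gog list \<Rightarrow> bool" where
  "gog_union \<Gamma> \<longleftrightarrow> \<Gamma> \<noteq> [] \<and>
     (\<forall>G\<in>set \<Gamma>. graph_of_groups G \<and> carrier (pi1 G) \<noteq> {\<one>\<^bsub>pi1 G\<^esub>})"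


section \<open>Metric simplicial trees with a group action\<close>

record ('h, 'v) gtree =
  verts :: "'v set"
  edges :: "'v set set"
  len :: "'v set \<Rightarrow> real"
  act :: "'h \<Rightarrow> 'v \<Rightarrow> 'v"

definition simple_path :: "'v set set \<Rightarrow> 'v \<Rightarrow> 'v list \<Rightarrow> 'v \<Rightarrow> bool" where
  "simple_path E u xs v \<longleftrightarrow> xs \<noteq> [] \<and> hd xs = u \<and> last xs = v \<and> distinct xs \<and>
     successively (\<lambda>x y. {x, y} \<in> E) xs"

definition simplicial_tree :: "'v set \<Rightarrow> 'v set set \<Rightarrow> bool" where
  "simplicial_tree V E \<longleftrightarrow> V \<noteq> {} \<and>
     (\<forall>e\<in>E. \<exists>u\<in>V. \<exists>v\<in>V. u \<noteq> v \<and> e = {u, v}) \<and>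
     (\<forall>u\<in>V. \<forall>v\<in>V. \<exists>!xs. simple_path E u xs v)"

definition geodesic :: "('h, 'v) gtree \<Rightarrow> 'v \<Rightarrow> 'v \<Rightarrow> 'v list" where
  "geodesic T u v = (THE xs. simple_path (edges T) u xs v)"

definition vdist :: "('h, 'v) gtree \<Rightarrow> 'v \<Rightarrow> 'v \<Rightarrow> real" where
  "vdist T u v =
     (let xs = geodesic T u v in \<Sum>(x, y)\<leftarrow>zip xs (tl xs). len T {x, y})"

definition edge_act :: "('h, 'v) gtree \<Rightarrow> 'h \<Rightarrow> 'v set \<Rightarrow> 'v set" where
  "edge_act T g e = act T g ` e"

definition metric_gtree :: "'h monoid \<Rightarrow> ('h, 'v) gtree \<Rightarrow> bool" where
  "metric_gtree H T \<longleftrightarrow>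
     simplicial_tree (verts T) (edges T) \<and>
     (\<forall>e\<in>edges T. 0 < len T e) \<and>
     group_action H (verts T) (act T) \<and>
     (\<forall>g\<in>carrier H. \<forall>e\<in>edges T. edge_act T g e \<in> edges T \<and> len T (edge_act T g e) = len T e)"

definition minimal_gtree :: "'h monoid \<Rightarrow> ('h, 'v) gtree \<Rightarrow> bool" where
  "minimal_gtree H T \<longleftrightarrow>
     (\<forall>W\<subseteq>verts T. W \<noteq> {} \<and>
        (\<forall>u\<in>W. \<forall>v\<in>W. set (geodesic T u v) \<subseteq> W) \<and>
        (\<forall>g\<in>carrier H. \<forall>u\<in>W. act T g u \<in> W) \<longrightarrow> W = verts T)"

text \<open>Points of the geometric realisation are given by their barycentric coordinates.\<close>

definition supp :: "('v \<Rightarrow> real) \<Rightarrow> 'v set" where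
  "supp p = {v. p v \<noteq> 0}"

definition points :: "('h, 'v) gtree \<Rightarrow> ('v \<Rightarrow> real) set" where
  "points T = {p. (\<forall>v. 0 \<le> p v) \<and> (supp p \<in> edges T \<or> (\<exists>v\<in>verts T. supp p = {v})) \<and>
                  (\<Sum>v\<in>supp p. p v) = 1}"

text \<open>The path metric. Two points of a common closed edge \<open>{u, v}\<close> satisfy
  \<open>\<bar>p u - q u\<bar> = \<bar>p v - q v\<bar>\<close>. In all other cases the geodesic leaves the edge of \<open>p\<close> through
  an end \<open>u\<close> and enters the edge of \<open>q\<close> through an end \<open>w\<close>; if \<open>p\<close> is itself a vertex then
  \<open>1 - p u = 0\<close> and the term \<open>len T (supp p)\<close> plays no role.\<close>

definition pdist :: "('h, 'v) gtree \<Rightarrow> ('v \<Rightarrow> real) \<Rightarrow> ('v \<Rightarrow> real) \<Rightarrow> real" where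
  "pdist T p q =
     (if p \<notin> points T \<or> q \<notin> points T then 0
      else if \<exists>e\<in>edges T. supp p \<union> supp q \<subseteq> e
      then len T (supp p \<union> supp q) * (\<Sum>v\<in>supp p \<union> supp q. \<bar>p v - q v\<bar>) / 2
      else Min {(1 - p u) * len T (supp p) + vdist T u w + (1 - q w) * len T (supp q) | u w.
                  u \<in> supp p \<and> w \<in> supp q})"

definition point_act ::
  "'h monoid \<Rightarrow> ('h, 'v) gtree \<Rightarrow> 'h \<Rightarrow> ('v \<Rightarrow> real) \<Rightarrow> 'v \<Rightarrow> real" where
  "point_act H T g p = (\<lambda>v. if v \<in> verts T then p (act T (inv\<^bsub>H\<^esub> g) v) else 0)"

definition equivariant ::
  "'h monoid \<Rightarrow> ('h, 'v) gtree \<Rightarrow> ('h, 'v) gtree \<Rightarrow> (('v \<Rightarrow> real) \<Rightarrow> 'v \<Rightarrow> real) \<Rightarrow> bool" where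
  "equivariant H S T f \<longleftrightarrow> f \<in> points S \<rightarrow> points T \<and>
     (\<forall>g\<in>carrier H. \<forall>p\<in>points S. f (point_act H S g p) = point_act H T g (f p))"

definition equiv_isometric :: "'h monoid \<Rightarrow> ('h, 'v) gtree \<Rightarrow> ('h, 'v) gtree \<Rightarrow> bool" where
  "equiv_isometric H S T \<longleftrightarrow>
     (\<exists>f. equivariant H S T f \<and> bij_betw f (points S) (points T) \<and>
          (\<forall>p\<in>points S. \<forall>q\<in>points S. pdist T (f p) (f q) = pdist S p q))"

definition tree_topology :: "('h, 'v) gtree \<Rightarrow> ('v \<Rightarrow> real) topology" where
  "tree_topology T = Metric_space.mtopology (points T) (pdist T)"

definition equiv_homeomorphic :: "'h monoid \<Rightarrow> ('h, 'v) gtree \<Rightarrow> ('h, 'v) gtree \<Rightarrow> bool" where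
  "equiv_homeomorphic H S T \<longleftrightarrow>
     (\<exists>f. equivariant H S T f \<and> homeomorphic_map (tree_topology S) (tree_topology T) f)"


section \<open>Outer space\<close>

text \<open>The edge stabilisers below are setwise, so their triviality excludes inversions.
  An infinite valence has cardinality \<open>0\<close>, which is harmless here.\<close>

definition outer_tree ::
  "('x, 'e, 'g) gog \<Rightarrow> (('x, 'e, 'g) letter list set, 'v) gtree \<Rightarrow> bool" where
  "outer_tree G T \<longleftrightarrow>
     metric_gtree (pi1 G) T \<and> minimal_gtree (pi1 G) T \<and>
     (\<forall>e\<in>edges T. stabilizer (pi1 G) (edge_act T) e = {\<one>\<^bsub>pi1 G\<^esub>}) \<and>
     (\<forall>v\<in>nontrivial_verts G. \<exists>x\<in>verts T.
        {y \<in> verts T. stabilizer (pi1 G) (act T) y \<in> vertex_subgroups G v} =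
        orbit (pi1 G) (act T) x) \<and>
     (\<forall>y\<in>verts T. (\<exists>v\<in>nontrivial_verts G.
                      stabilizer (pi1 G) (act T) y \<in> vertex_subgroups G v) \<or>
                   stabilizer (pi1 G) (act T) y = {\<one>\<^bsub>pi1 G\<^esub>}) \<and>
     (\<forall>y\<in>verts T. stabilizer (pi1 G) (act T) y = {\<one>\<^bsub>pi1 G\<^esub>} \<longrightarrow>
                   card {e \<in> edges T. y \<in> e} \<noteq> 2)"

definition tree_class ::
  "('x, 'e, 'g) gog \<Rightarrow> (('x, 'e, 'g) letter list set, 'v) gtree \<Rightarrow>
   (('x, 'e, 'g) letter list set, 'v) gtree set" where
  "tree_class G T = {S. outer_tree G S \<and> equiv_isometric (pi1 G) T S}"

definition outer_space_conn ::
  "('x, 'e, 'g) gog \<Rightarrow> (('x, 'e, 'g) letter list set, 'v) gtree set set" where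
  "outer_space_conn G = {tree_class G T | T. outer_tree G T}"

type_synonym ('x, 'e, 'g, 'v) tree_tuple =
  "nat \<Rightarrow> (('x, 'e, 'g) letter list set, 'v) gtree"

type_synonym ('x, 'e, 'g, 'v) outer_point =
  "nat \<Rightarrow> (('x, 'e, 'g) letter list set, 'v) gtree set"

definition outer_space :: "('x, 'e, 'g) gog list \<Rightarrow> ('x, 'e, 'g, 'v) outer_point set" where
  "outer_space \<Gamma> = (\<Pi>\<^sub>E i\<in>{..<length \<Gamma>}. outer_space_conn (\<Gamma> ! i))"

definition outer_class ::
  "('x, 'e, 'g) gog list \<Rightarrow> ('x, 'e, 'g, 'v) tree_tuple \<Rightarrow> ('x, 'e, 'g, 'v) outer_point" where
  "outer_class \<Gamma> T = (\<lambda>i\<in>{..<length \<Gamma>}. tree_class (\<Gamma> ! i) (T i))"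

definition open_simplex ::
  "('x, 'e, 'g) gog list \<Rightarrow> ('x, 'e, 'g, 'v) outer_point \<Rightarrow> ('x, 'e, 'g, 'v) outer_point set" where
  "open_simplex \<Gamma> X =
     {Y \<in> outer_space \<Gamma>. \<forall>i<length \<Gamma>. \<exists>S\<in>X i. \<exists>T\<in>Y i. equiv_homeomorphic (pi1 (\<Gamma> ! i)) S T}"

definition open_simplices ::
  "('x, 'e, 'g) gog list \<Rightarrow> ('x, 'e, 'g, 'v) outer_point set set" where
  "open_simplices \<Gamma> = open_simplex \<Gamma> ` outer_space \<Gamma>"

text \<open>Euclidean coordinates on the open simplex of (the class of) \<open>T\<close>: a positive length for
  every orbit of edges of every component.\<close>

definition edge_orbit :: "'h monoid \<Rightarrow> ('h, 'v) gtree \<Rightarrow> 'v set \<Rightarrow> 'v set set" where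
  "edge_orbit H T e = orbit H (edge_act T) e"

definition length_cone ::
  "('x, 'e, 'g) gog list \<Rightarrow> ('x, 'e, 'g, 'v) tree_tuple \<Rightarrow> (nat \<Rightarrow> 'v set set \<Rightarrow> real) set" where
  "length_cone \<Gamma> T =
     {c. \<forall>i<length \<Gamma>. \<forall>e\<in>edges (T i). 0 < c i (edge_orbit (pi1 (\<Gamma> ! i)) (T i) e)}"

definition with_lengths ::
  "('x, 'e, 'g) gog list \<Rightarrow> ('x, 'e, 'g, 'v) tree_tuple \<Rightarrow> (nat \<Rightarrow> 'v set set \<Rightarrow> real) \<Rightarrow>
   ('x, 'e, 'g, 'v) tree_tuple" where
  "with_lengths \<Gamma> T c =
     (\<lambda>i\<in>{..<length \<Gamma>}. (T i)\<lparr>len := \<lambda>e. c i (edge_orbit (pi1 (\<Gamma> ! i)) (T i) e)\<rparr>)"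

text \<open>\<open>\<gamma>\<close> restricted to \<open>{0..1}\<close> is the affine parametrisation of the Euclidean segment from
  \<open>A\<close> to \<open>B\<close> in the open simplex \<open>\<Delta>\<close>.\<close>

definition euclidean_segment ::
  "('x, 'e, 'g) gog list \<Rightarrow> ('x, 'e, 'g, 'v) outer_point set \<Rightarrow>
   ('x, 'e, 'g, 'v) outer_point \<Rightarrow> ('x, 'e, 'g, 'v) outer_point \<Rightarrow>
   (real \<Rightarrow> ('x, 'e, 'g, 'v) outer_point) \<Rightarrow> bool" where
  "euclidean_segment \<Gamma> \<Delta> A B \<gamma> \<longleftrightarrow>
     (\<exists>T. (\<forall>i<length \<Gamma>. outer_tree (\<Gamma> ! i) (T i)) \<and> \<Delta> = open_simplex \<Gamma> (outer_class \<Gamma> T) \<and>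
       (\<exists>a\<in>length_cone \<Gamma> T. \<exists>b\<in>length_cone \<Gamma> T.
          A = outer_class \<Gamma> (with_lengths \<Gamma> T a) \<and>
          B = outer_class \<Gamma> (with_lengths \<Gamma> T b) \<and>
          (\<forall>t\<in>{0..1}. \<gamma> t = outer_class \<Gamma>
             (with_lengths \<Gamma> T (\<lambda>i ob. (1 - t) * a i ob + t * b i ob)))))"


section \<open>Automorphisms\<close>

type_synonym ('x, 'e, 'g) gog_aut =
  "(nat \<Rightarrow> nat) \<times> (nat \<Rightarrow> ('x, 'e, 'g) letter list set \<Rightarrow> ('x, 'e, 'g) letter list set)"

text \<open>Only nontrivial vertex groups are constrained: the trivial ones are not part of the free
  splitting, and whether they occur at all depends on the chosen graph.\<close>

definition Aut :: "('x, 'e, 'g) gog list \<Rightarrow> ('x, 'e, 'g) gog_aut monoid" where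
  "Aut \<Gamma> =
     \<lparr>carrier = {(\<sigma>, \<phi>). \<sigma> permutes {..<length \<Gamma>} \<and> \<phi> \<in> extensional {..<length \<Gamma>} \<and>
        (\<forall>i<length \<Gamma>.
           \<phi> i \<in> iso (pi1 (\<Gamma> ! i)) (pi1 (\<Gamma> ! \<sigma> i)) \<inter> extensional (carrier (pi1 (\<Gamma> ! i))) \<and>
           (\<forall>v\<in>nontrivial_verts (\<Gamma> ! i). \<forall>K\<in>vertex_subgroups (\<Gamma> ! i) v.
              \<exists>w\<in>nontrivial_verts (\<Gamma> ! \<sigma> i). \<phi> i ` K \<in> vertex_subgroups (\<Gamma> ! \<sigma> i) w))},
      monoid.mult = (\<lambda>(\<sigma>, \<phi>) (\<tau>, \<psi>).
        (\<sigma> \<circ> \<tau>, \<lambda>i\<in>{..<length \<Gamma>}. compose (carrier (pi1 (\<Gamma> ! i))) (\<phi> (\<tau> i)) (\<psi> i))),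
      monoid.one = (id, \<lambda>i\<in>{..<length \<Gamma>}. \<lambda>g\<in>carrier (pi1 (\<Gamma> ! i)). g)\<rparr>"

definition Inn :: "('x, 'e, 'g) gog list \<Rightarrow> ('x, 'e, 'g) gog_aut set" where
  "Inn \<Gamma> =
     {(id, \<lambda>i\<in>{..<length \<Gamma>}. \<lambda>g\<in>carrier (pi1 (\<Gamma> ! i)).
             h i \<otimes>\<^bsub>pi1 (\<Gamma> ! i)\<^esub> g \<otimes>\<^bsub>pi1 (\<Gamma> ! i)\<^esub> inv\<^bsub>pi1 (\<Gamma> ! i)\<^esub> (h i)) | h.
        \<forall>i<length \<Gamma>. h i \<in> carrier (pi1 (\<Gamma> ! i))}"

definition Out :: "('x, 'e, 'g) gog list \<Rightarrow> ('x, 'e, 'g) gog_aut set monoid" where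
  "Out \<Gamma> = Aut \<Gamma> Mod Inn \<Gamma>"

definition aut_act ::
  "('x, 'e, 'g) gog list \<Rightarrow> ('x, 'e, 'g) gog_aut \<Rightarrow> ('x, 'e, 'g, 'v) tree_tuple \<Rightarrow>
   ('x, 'e, 'g, 'v) tree_tuple" where
  "aut_act \<Gamma> = (\<lambda>(\<sigma>, \<phi>) T.
     \<lambda>i\<in>{..<length \<Gamma>}. (T (\<sigma> i))\<lparr>act := \<lambda>g. act (T (\<sigma> i)) (\<phi> i g)\<rparr>)"


section \<open>Displacement\<close>

definition lip_bounds ::
  "('h, 'v) gtree \<Rightarrow> ('h, 'v) gtree \<Rightarrow> (('v \<Rightarrow> real) \<Rightarrow> 'v \<Rightarrow> real) \<Rightarrow> real set" where
  "lip_bounds S T f =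
     {C. 0 \<le> C \<and> (\<forall>p\<in>points S. \<forall>q\<in>points S. pdist T (f p) (f q) \<le> C * pdist S p q)}"

definition Lip ::
  "('x, 'e, 'g) gog list \<Rightarrow> ('x, 'e, 'g, 'v) tree_tuple \<Rightarrow> ('x, 'e, 'g, 'v) tree_tuple \<Rightarrow>
   (nat \<Rightarrow> ('v \<Rightarrow> real) \<Rightarrow> 'v \<Rightarrow> real) \<Rightarrow> real" where
  "Lip \<Gamma> S T f = (MAX i\<in>{..<length \<Gamma>}. Inf (lip_bounds (S i) (T i) (f i)))"

text \<open>The minimum of the Lipschitz constants, as an infimum so that the definition does not
  depend on its being attained.\<close>

definition stretch ::
  "('x, 'e, 'g) gog list \<Rightarrow> ('x, 'e, 'g, 'v) tree_tuple \<Rightarrow> ('x, 'e, 'g, 'v) tree_tuple \<Rightarrow>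
   real" where
  "stretch \<Gamma> S T = Inf {Lip \<Gamma> S T f | f. \<forall>i<length \<Gamma>.
     equivariant (pi1 (\<Gamma> ! i)) (S i) (T i) (f i) \<and> lip_bounds (S i) (T i) (f i) \<noteq> {}}"

text \<open>The displacement does not depend on the chosen representatives of the isometry classes.\<close>

definition displacement ::
  "('x, 'e, 'g) gog list \<Rightarrow> ('x, 'e, 'g) gog_aut \<Rightarrow> ('x, 'e, 'g, 'v) outer_point \<Rightarrow> real" where
  "displacement \<Gamma> \<phi> X =
     the_elem {stretch \<Gamma> T (aut_act \<Gamma> \<phi> T) | T. \<forall>i<length \<Gamma>. T i \<in> X i}"

definition quasi_convex :: "real \<Rightarrow> real \<Rightarrow> (real \<Rightarrow> real) \<Rightarrow> bool" where
  "quasi_convex a\<^sub>0 b\<^sub>0 f \<longleftrightarrow>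
     (\<forall>a b t. a\<^sub>0 \<le> a \<and> b \<le> b\<^sub>0 \<and> a \<le> t \<and> t \<le> b \<longrightarrow> f t \<le> max (f a) (f b))"

end

theory Submission
  imports Defs
begin

text \<open>
  The proof is direct and uses no candidate loops. The length functions \<open>a\<close> and \<open>b\<close> of the ends of
  a segment give two path metrics on one simplicial tree, and the length function
  \<open>c = (1 - t) a + t b\<close> gives the metric \<open>d\<^sub>c = (1 - t) d\<^sub>a + t d\<^sub>b\<close>. Given Lipschitz maps \<open>f\<close> and
  \<open>f'\<close> at the two ends, send \<open>p\<close> to the point \<open>z\<close> of the geodesic from \<open>f p\<close> to \<open>f' p\<close> with
  \<open>(1 - t) d\<^sub>a (f p, z) = t d\<^sub>b (z, f' p)\<close>. In a tree this barycentre is a non-expanding function of the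
  pair of points, from the weighted sum of the two metrics to \<open>d\<^sub>c\<close>. The interpolated map is therefore
  equivariant and stretches \<open>d\<^sub>c (p, q)\<close> to at most
  \<open>(1 - t) K d\<^sub>a (p, q) + t K' d\<^sub>b (p, q)\<close>, where \<open>K\<close> and \<open>K'\<close> are the given Lipschitz constants.
  This yields quasi-convexity. As the group acts with finitely many orbits of edges, \<open>d\<^sub>a\<close> and \<open>d\<^sub>b\<close>
  bound each other up to a factor, so for \<open>K' < K\<close> the new constant is strictly below \<open>K\<close>, and the
  displacement is continuous enough at \<open>A\<close> to give strict monotonicity near \<open>A\<close>.
\<close>

section \<open>Simple paths and rooted trees\<close>

text \<open>The case distinctions of \<open>pdist\<close> are awkward in estimates that involve
  three or more points. Rooting the tree at any vertex and recording masses embeds it in an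
  l1-space: the metric becomes linear in the edge lengths, and betweenness becomes a condition on
  coordinates that is the same for all length functions. The non-expansion of barycentres then rests
  on one property of trees: a point between \<open>x\<close> and \<open>y\<close> also lies between
  \<open>w\<close> and \<open>x\<close> or between \<open>w\<close> and \<open>y\<close>, for every
  \<open>w\<close>.

  A strict drop at the interior points of a segment does not yet make the displacement strictly
  monotone near \<open>A\<close>: just after \<open>A\<close> it might fall below its value at
  \<open>B\<close> and rise again. For \<open>s < t\<close> near \<open>A\<close> the value at
  \<open>t\<close> is bounded by means of those at \<open>s\<close> and at \<open>B\<close>, and the
  bound is strict only if the value at \<open>s\<close> exceeds the one at \<open>B\<close>. Lower
  semicontinuity at \<open>A\<close> guarantees this. Infima need not be attained, so all estimates
  concern constants that are realised by some maps.\<close>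

lemma simple_path_prefix:
  assumes "simple_path E u (ys @ v # zs) w"
  shows "simple_path E u (ys @ [v]) v"
proof -
  have "successively (\<lambda>x y. {x, y} \<in> E) ((ys @ [v]) @ zs)"
    using assms by (simp add: simple_path_def)
  then have "successively (\<lambda>x y. {x, y} \<in> E) (ys @ [v])"
    unfolding successively_append_iff by blast
  then show ?thesis using assms by (cases ys) (auto simp: simple_path_def)
qed

lemma simple_path_suffix:
  assumes "simple_path E u (ys @ v # zs) w"
  shows "simple_path E v (v # zs) w"
proof -
  have "successively (\<lambda>x y. {x, y} \<in> E) (v # zs)"
    using assms unfolding simple_path_def successively_append_iff by blast
  then show ?thesis using assms by (simp add: simple_path_def)
qed

lemma simple_path_snoc:
  assumes "simple_path E u xs v" and "{v, w} \<in> E" and "w \<notin> set xs"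
  shows "simple_path E u (xs @ [w]) w"
  using assms by (simp add: simple_path_def successively_append_iff)

lemma simple_path_refl: "simple_path E u [u] u"
  by (simp add: simple_path_def)

lemma simple_path_edge: "{u, v} \<in> E \<Longrightarrow> u \<noteq> v \<Longrightarrow> simple_path E u [u, v] v"
  by (simp add: simple_path_def)

lemma simple_path_mono:
  assumes "simple_path E u xs v" and "E \<subseteq> E'"
  shows "simple_path E' u xs v"
proof -
  have "successively (\<lambda>x y. {x, y} \<in> E') xs"
    by (rule successively_mono[of "\<lambda>x y. {x, y} \<in> E"]) (use assms in \<open>auto simp: simple_path_def\<close>)
  then show ?thesis using assms by (simp add: simple_path_def)
qed

lemma simple_path_map:
  assumes "simple_path E u xs v" and "inj_on h (set xs)" and "\<And>e. e \<in> E \<Longrightarrow> h ` e \<in> E'"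
  shows "simple_path E' (h u) (map h xs) (h v)"
proof -
  have "successively (\<lambda>x y. {h x, h y} \<in> E') xs"
    using assms(3)[of "{_, _}"] assms(1) successively_mono[of "\<lambda>x y. {x, y} \<in> E" xs]
    by (simp add: simple_path_def)
  then show ?thesis
    using assms(1,2)
    by (auto simp: simple_path_def hd_map last_map distinct_map successively_map)
qed

lemma simplicial_tree_edgeD:
  assumes "simplicial_tree V E" and "e \<in> E"
  shows "\<exists>u\<in>V. \<exists>v\<in>V. u \<noteq> v \<and> e = {u, v}"
  using assms by (simp add: simplicial_tree_def)

lemma simplicial_tree_ends:
  assumes "simplicial_tree V E" and "{u, v} \<in> E"
  shows "u \<in> V" and "v \<in> V" and "u \<noteq> v"
  using simplicial_tree_edgeD[OF assms] by (auto simp: doubleton_eq_iff)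

lemma simplicial_tree_unique:
  assumes "simplicial_tree V E" and "u \<in> V" and "v \<in> V"
    and "simple_path E u xs v" and "simple_path E u ys v"
  shows "xs = ys"
  using assms by (simp add: simplicial_tree_def) (metis (no_types))

lemma simple_path_verts:
  assumes "simplicial_tree V E" and "simple_path E u xs v" and "u \<in> V"
  shows "set xs \<subseteq> V"
proof -
  have "successively (\<lambda>x y. {x, y} \<in> E) xs \<Longrightarrow> xs \<noteq> [] \<Longrightarrow> hd xs \<in> V \<Longrightarrow> set xs \<subseteq> V"
    by (induction xs rule: induct_list012) (auto dest: simplicial_tree_ends[OF assms(1)])
  then show ?thesis using assms(2,3) by (simp add: simple_path_def)
qed

section \<open>Root paths, ancestors and the orientation of edges\<close>

locale rooted_tree =
  fixes V :: "'v set" and E :: "'v set set" and r :: 'v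
  assumes tree: "simplicial_tree V E" and root: "r \<in> V"
begin

definition rpath :: "'v \<Rightarrow> 'v list" where
  "rpath v = (THE xs. simple_path E r xs v)"

definition anc :: "'v \<Rightarrow> 'v set" where
  "anc v = set (rpath v)"

definition child :: "'v \<Rightarrow> 'v \<Rightarrow> bool" where
  "child u k \<longleftrightarrow> {u, k} \<in> E \<and> rpath k = rpath u @ [k]"

text \<open>The vertices other than the root correspond to the edges in this way, so edge lengths
  can be indexed by vertices.\<close>

definition par_edge :: "'v \<Rightarrow> 'v set" where
  "par_edge k = {last (butlast (rpath k)), k}"

lemma rpath: "v \<in> V \<Longrightarrow> simple_path E r (rpath v) v"
  unfolding rpath_def using tree root by (metis (no_types, lifting) simplicial_tree_def theI')

lemma rpath_eqI: "v \<in> V \<Longrightarrow> simple_path E r xs v \<Longrightarrow> rpath v = xs"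
  using rpath simplicial_tree_unique[OF tree root] by blast

lemma edgeD:
  assumes "{u, v} \<in> E"
  shows "u \<in> V" and "v \<in> V" and "u \<noteq> v"
  using simplicial_tree_ends[OF tree assms] .

lemma anc_refl: "v \<in> V \<Longrightarrow> v \<in> anc v"
  using rpath[of v] by (metis anc_def last_in_set simple_path_def)

lemma root_anc: "v \<in> V \<Longrightarrow> r \<in> anc v"
  using rpath[of v] by (metis anc_def hd_in_set simple_path_def)

lemma finite_anc: "finite (anc v)"
  by (simp add: anc_def)

lemma anc_subset: "v \<in> V \<Longrightarrow> anc v \<subseteq> V"
  using rpath[of v] simple_path_verts[OF tree _ root] by (simp add: anc_def)

text \<open>Prefixes of simple paths are simple, and simple paths are determined by their ends.
  Ancestry thus becomes the prefix order on root paths.\<close>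

lemma rpath_prefix:
  assumes "w \<in> V" and "rpath w = ys @ v # zs"
  shows "rpath v = ys @ [v]"
proof (rule rpath_eqI)
  show "v \<in> V" using anc_subset[OF assms(1)] assms(2) by (auto simp: anc_def)
  show "simple_path E r (ys @ [v]) v"
    using rpath[OF assms(1)] assms(2) simple_path_prefix by metis
qed

lemma anc_trans:
  assumes "w \<in> V" and "v \<in> anc w"
  shows "anc v \<subseteq> anc w"
proof -
  obtain ys zs where "rpath w = ys @ v # zs"
    using assms(2) by (auto simp: anc_def dest: split_list)
  with rpath_prefix[OF assms(1) this] show ?thesis by (auto simp: anc_def)
qed

text \<open>The root paths of both ancestors are prefixes of one list.\<close>

lemma anc_chain:
  assumes "w \<in> V" and "v \<in> anc w" and "v' \<in> anc w"
  shows "v \<in> anc v' \<or> v' \<in> anc v"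
proof -
  obtain ys zs where w: "rpath w = ys @ v # zs"
    using assms(2) by (auto simp: anc_def dest: split_list)
  have v: "rpath v = ys @ [v]" by (rule rpath_prefix[OF assms(1) w])
  show ?thesis
  proof (cases "v' \<in> set (ys @ [v])")
    case True
    then show ?thesis using v by (simp add: anc_def)
  next
    case False
    then have "v' \<in> set zs" using assms(3) w by (auto simp: anc_def)
    then obtain zs1 zs2 where "zs = zs1 @ v' # zs2" by (auto dest: split_list)
    then have "rpath v' = (ys @ v # zs1) @ [v']"
      using rpath_prefix[OF assms(1), of "ys @ v # zs1" v' zs2] w by simp
    then show ?thesis by (simp add: anc_def)
  qed
qed

lemma anc_antisym:
  assumes "w \<in> V" and "v \<in> anc w" and "w \<in> anc v"
  shows "v = w"
proof -
  have v: "v \<in> V" using assms anc_subset by auto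
  obtain ys zs where w: "rpath w = ys @ v # zs"
    using assms(2) by (auto simp: anc_def dest: split_list)
  then have rv: "rpath v = ys @ [v]" using rpath_prefix assms(1) by blast
  have "distinct (rpath w)" "last (rpath w) = w"
    using rpath[OF assms(1)] by (auto simp: simple_path_def)
  then show ?thesis using w rv assms(3) by (cases zs) (auto simp: anc_def split: if_splits)
qed

text \<open>If \<open>v\<close> is not on the root path of \<open>u\<close>, the edge extends that
  path. Otherwise the edge and the tail of the path from \<open>v\<close> on are simple paths with
  the same ends, so the tail is the edge.\<close>

lemma edge_child:
  assumes "{u, v} \<in> E"
  shows "child u v \<or> child v u"
proof (cases "v \<in> anc u")
  case False
  have "rpath v = rpath u @ [v]"
    using False edgeD[OF assms] rpath simple_path_snoc[OF _ assms]
    by (intro rpath_eqI) (auto simp: anc_def)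
  then show ?thesis using assms by (simp add: child_def)
next
  case True
  then obtain ys zs where u: "rpath u = ys @ v # zs"
    by (auto simp: anc_def dest: split_list)
  have "simple_path E v (v # zs) u"
    using simple_path_suffix rpath u edgeD(1)[OF assms] by metis
  moreover have "simple_path E v [v, u] u"
    using assms edgeD[OF assms] by (intro simple_path_edge) (auto simp: insert_commute)
  ultimately have "zs = [u]"
    using simplicial_tree_unique[OF tree] edgeD[OF assms] by blast
  then have "rpath u = rpath v @ [u]"
    using rpath_prefix[OF edgeD(1)[OF assms] u] u by simp
  then show ?thesis using assms by (simp add: child_def insert_commute)
qed

lemma childD:
  assumes "child u k"
  shows "{u, k} \<in> E" and "u \<in> V" and "k \<in> V" and "u \<noteq> k" and "anc k = insert k (anc u)"
    and "k \<notin> anc u" and "par_edge k = {u, k}"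
proof -
  show e: "{u, k} \<in> E" using assms by (simp add: child_def)
  show u: "u \<in> V" and k: "k \<in> V" and "u \<noteq> k" using edgeD[OF e] by auto
  show "anc k = insert k (anc u)" using assms by (simp add: child_def anc_def)
  show "k \<notin> anc u"
    using assms rpath[OF k] by (simp add: child_def anc_def simple_path_def)
  have "last (rpath u) = u" using rpath[OF u] by (simp add: simple_path_def)
  then show "par_edge k = {u, k}" using assms by (simp add: child_def par_edge_def)
qed

lemma edgeE:
  assumes "e \<in> E"
  obtains u k where "e = {u, k}" and "child u k"
  using edge_child simplicial_tree_edgeD[OF tree assms] assms by (metis insert_commute)

lemma par_edge_mem:
  assumes "k \<in> V" and "k \<noteq> r"
  shows "par_edge k \<in> E"
proof -
  have p: "simple_path E r (rpath k) k" by (rule rpath[OF assms(1)])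
  then obtain ys where ys: "rpath k = ys @ [k]"
    by (metis append_butlast_last_id simple_path_def)
  then obtain zs u where "ys = zs @ [u]"
    using p assms(2) by (cases ys rule: rev_cases) (auto simp: simple_path_def)
  then show ?thesis
    using p ys by (auto simp: simple_path_def par_edge_def successively_append_iff butlast_append)
qed

lemma child_unique: "child u k \<Longrightarrow> child u' k \<Longrightarrow> u = u'"
  using childD(7,4) by (metis doubleton_eq_iff)

end

section \<open>Coordinates on a tree and the path metric\<close>

context rooted_tree
begin

text \<open>The same set as \<open>points\<close>, phrased without a \<open>gtree\<close> so that
  the lengths can vary.\<close>

definition P :: "('v \<Rightarrow> real) set" where
  "P = {p. (\<forall>v. 0 \<le> p v) \<and> (supp p \<in> E \<or> (\<exists>v\<in>V. supp p = {v})) \<and> (\<Sum>v\<in>supp p. p v) = 1}"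

definition vpt :: "'v \<Rightarrow> 'v \<Rightarrow> real" where
  "vpt u = (\<lambda>w. if w = u then 1 else 0)"

text \<open>For \<open>child u k\<close> the edge is parametrised away from the root, and
  \<open>s\<close> is the mass at \<open>k\<close>.\<close>

definition seg :: "'v \<Rightarrow> 'v \<Rightarrow> real \<Rightarrow> 'v \<Rightarrow> real" where
  "seg u k s = (\<lambda>w. if w = k then s else if w = u then 1 - s else 0)"

text \<open>The mass of \<open>p\<close> on the descendants of \<open>v\<close>. For \<open>v \<noteq> r\<close> it says which fraction of the edge above
  \<open>v\<close> is traversed by the geodesic from \<open>r\<close> to \<open>p\<close>, so that \<open>W\<close> below is the \<open>\<ell>\<^sub>1\<close>-formula for the path
  metric. The value \<open>par_edge r\<close> is junk, but its coefficient in \<open>W\<close> vanishes as \<open>mass p r = 1\<close>.\<close>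

definition mass :: "('v \<Rightarrow> real) \<Rightarrow> 'v \<Rightarrow> real" where
  "mass p v = (\<Sum>w\<in>supp p. if v \<in> anc w then p w else 0)"

text \<open>Contains all vertices with nonzero mass, so that \<open>W\<close> is a finite
  sum.\<close>

definition supp_anc :: "('v \<Rightarrow> real) \<Rightarrow> 'v set" where
  "supp_anc p = (\<Union>w\<in>supp p. anc w)"

definition W :: "('v set \<Rightarrow> real) \<Rightarrow> ('v \<Rightarrow> real) \<Rightarrow> ('v \<Rightarrow> real) \<Rightarrow> real" where
  "W c p q = (\<Sum>v\<in>supp_anc p \<union> supp_anc q. c (par_edge v) * \<bar>mass p v - mass q v\<bar>)"

text \<open>Equality in the triangle inequality, required in each coordinate. No lengths occur, so
  one relation serves all metrics \<open>W c\<close> with positive \<open>c\<close>.\<close>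

definition btw :: "('v \<Rightarrow> real) \<Rightarrow> ('v \<Rightarrow> real) \<Rightarrow> ('v \<Rightarrow> real) \<Rightarrow> bool" where
  "btw p z q \<longleftrightarrow> (\<forall>v. \<bar>mass p v - mass q v\<bar> = \<bar>mass p v - mass z v\<bar> + \<bar>mass z v - mass q v\<bar>)"

lemma supp_vpt: "supp (vpt u) = {u}"
  by (auto simp: supp_def vpt_def)

lemma vpt_P: "u \<in> V \<Longrightarrow> vpt u \<in> P"
  by (simp add: P_def supp_vpt) (simp add: vpt_def)

lemma supp_seg: "supp (seg u k s) \<subseteq> {u, k}"
  by (auto simp: supp_def seg_def)

lemma seg_0: "u \<noteq> k \<Longrightarrow> seg u k 0 = vpt u"
  and seg_1: "seg u k 1 = vpt k"
  by (auto simp: seg_def vpt_def)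

lemma seg_P:
  assumes "child u k" and "0 \<le> s" and "s \<le> 1"
  shows "seg u k s \<in> P"
proof -
  note c = childD[OF assms(1)]
  have "s = 0 \<or> s = 1 \<or> 0 < s \<and> s < 1" using assms by linarith
  then consider "s = 0" | "s = 1" | "0 < s" "s < 1" by blast
  then show ?thesis
  proof cases
    case 3
    then have "supp (seg u k s) = {u, k}" using c(4) by (auto simp: supp_def seg_def)
    moreover have "(\<Sum>v\<in>{u, k}. seg u k s v) = 1" using c(4) by (simp add: seg_def)
    moreover have "\<forall>v. 0 \<le> seg u k s v" using 3 by (simp add: seg_def)
    ultimately show ?thesis using c(1) by (simp add: P_def)
  qed (use c in \<open>simp_all add: seg_0 seg_1 vpt_P\<close>)
qed

lemma P_nonneg: "p \<in> P \<Longrightarrow> 0 \<le> p v"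
  by (simp add: P_def)

lemma finite_supp:
  assumes "p \<in> P"
  shows "finite (supp p)"
proof -
  have "finite e" if "e \<in> E" for e
    using simplicial_tree_edgeD[OF tree that] by auto
  moreover have "supp p \<in> E \<or> (\<exists>v. supp p = {v})" using assms by (auto simp: P_def)
  ultimately show ?thesis by auto
qed

lemma P_supp_subset:
  assumes "p \<in> P"
  shows "supp p \<subseteq> V"
proof -
  have "e \<subseteq> V" if "e \<in> E" for e
    using simplicial_tree_edgeD[OF tree that] by auto
  then show ?thesis using assms by (auto simp: P_def)
qed

lemma P_edge:
  assumes "p \<in> P" and "child u k" and "supp p \<subseteq> {u, k}"
  obtains s where "0 \<le> s" and "s \<le> 1" and "p = seg u k s"
proof -
  have "(\<Sum>v\<in>supp p. p v) = (\<Sum>v\<in>{u, k}. p v)"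
    by (rule sum.mono_neutral_left) (use assms(3) in \<open>auto simp: supp_def\<close>)
  then have s: "p u + p k = 1" using assms(1) childD(4)[OF assms(2)] by (simp add: P_def)
  have "0 \<le> p u" "0 \<le> p k" using P_nonneg[OF assms(1)] by auto
  moreover have "p = seg u k (p k)"
    using s assms(3) by (auto simp: seg_def supp_def fun_eq_iff)
  ultimately show thesis using that[of "p k"] s by simp
qed

lemma P_cases:
  assumes "p \<in> P"
  obtains v where "v \<in> V" and "p = vpt v"
  | u k s where "child u k" and "0 < s" and "s < 1" and "p = seg u k s"
proof -
  consider v where "v \<in> V" "supp p = {v}" | "supp p \<in> E"
    using assms by (auto simp: P_def)
  then show thesis
  proof cases
    case 1
    then have "p v = 1" using assms by (simp add: P_def)
    moreover have "p w = 0" if "w \<noteq> v" for w using 1 that by (auto simp: supp_def)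
    ultimately have "p = vpt v" by (auto simp: vpt_def)
    then show thesis using 1 that by blast
  next
    case 2
    then obtain u k where e: "supp p = {u, k}" "child u k" by (metis edgeE)
    then obtain s where s: "0 \<le> s" "s \<le> 1" "p = seg u k s"
      using P_edge[OF assms] by blast
    have "u \<in> supp p" "k \<in> supp p" using e by auto
    then have "s \<noteq> 0" "s \<noteq> 1" using s childD(4)[OF e(2)] by (auto simp: supp_def seg_def)
    then have "0 < s" "s < 1" using s by auto
    then show thesis using e s that by blast
  qed
qed

section \<open>Masses and the l1-formula for the metric\<close>

lemma mass_superset:
  assumes "finite F" and "supp p \<subseteq> F"
  shows "mass p v = (\<Sum>w\<in>F. if v \<in> anc w then p w else 0)"
  unfolding mass_def by (rule sum.mono_neutral_left) (use assms in \<open>auto simp: supp_def\<close>)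

lemma mass_vpt: "mass (vpt u) v = (if v \<in> anc u then 1 else 0)"
  by (simp add: mass_def supp_vpt) (simp add: vpt_def)

lemma mass_seg:
  assumes "child u k"
  shows "mass (seg u k s) v = (if v = k then s else if v \<in> anc u then 1 else 0)"
proof -
  note c = childD[OF assms]
  show ?thesis
    using c by (simp add: mass_superset[of "{u, k}"] supp_seg) (simp add: seg_def)
qed

lemma mass_range:
  assumes "p \<in> P"
  shows "0 \<le> mass p v" and "mass p v \<le> 1"
  using assms by (cases rule: P_cases; simp add: mass_vpt mass_seg)+

lemma mass_root:
  assumes "p \<in> P"
  shows "mass p r = 1"
  using assms
proof (cases rule: P_cases)
  case (2 u k s)
  note c = childD[OF 2(1)]
  then have "r \<noteq> k" using root_anc[of u] by auto
  then show ?thesis using 2 root_anc c by (simp add: mass_seg)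
qed (simp add: mass_vpt root_anc)

lemma mass_outside: "v \<notin> supp_anc p \<Longrightarrow> mass p v = 0"
  by (auto simp: mass_def supp_anc_def intro!: sum.neutral)

lemma finite_supp_anc: "p \<in> P \<Longrightarrow> finite (supp_anc p)"
  by (simp add: supp_anc_def finite_supp finite_anc)

lemma supp_anc_subset: "p \<in> P \<Longrightarrow> supp_anc p \<subseteq> V"
  using anc_subset P_supp_subset by (fastforce simp: supp_anc_def)

text \<open>Brings several distances onto one index set, where they can be compared term by
  term.\<close>

lemma W_superset:
  assumes "finite F" and "supp_anc p \<subseteq> F" and "supp_anc q \<subseteq> F"
  shows "W c p q = (\<Sum>v\<in>F. c (par_edge v) * \<bar>mass p v - mass q v\<bar>)"
  unfolding W_def by (rule sum.mono_neutral_left) (use assms in \<open>auto simp: mass_outside\<close>)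

lemma W_term_nonneg:
  assumes "\<forall>e\<in>E. 0 \<le> c e" and "p \<in> P" and "q \<in> P" and "v \<in> V"
  shows "0 \<le> c (par_edge v) * \<bar>mass p v - mass q v\<bar>"
  by (cases "v = r") (use assms par_edge_mem in \<open>auto simp: mass_root\<close>)

lemma W_nonneg:
  assumes "\<forall>e\<in>E. 0 \<le> c e" and "p \<in> P" and "q \<in> P"
  shows "0 \<le> W c p q"
  unfolding W_def
proof (rule sum_nonneg)
  fix v assume "v \<in> supp_anc p \<union> supp_anc q"
  then have "v \<in> V" using supp_anc_subset assms(2,3) by blast
  then show "0 \<le> c (par_edge v) * \<bar>mass p v - mass q v\<bar>"
    using W_term_nonneg[of c p q v] assms by blast
qed

lemma W_sym: "W c p q = W c q p"
  by (simp add: W_def Un_commute abs_minus_commute)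

lemma W_refl: "W c p p = 0"
  by (simp add: W_def)

lemma W_linear: "W (\<lambda>e. x * c e + y * d e) p q = x * W c p q + y * W d p q"
  by (simp add: W_def sum_distrib_left sum.distrib algebra_simps)

lemma W_mono:
  assumes "\<forall>e\<in>E. c e \<le> d e" and "p \<in> P" and "q \<in> P"
  shows "W c p q \<le> W d p q"
  using W_nonneg[of "\<lambda>e. 1 * d e + (- 1) * c e" p q] assms unfolding W_linear by simp

lemma W_triangle:
  assumes "\<forall>e\<in>E. 0 \<le> c e" and "p \<in> P" and "z \<in> P" and "q \<in> P"
  shows "W c p q \<le> W c p z + W c z q"
proof -
  let ?F = "supp_anc p \<union> supp_anc z \<union> supp_anc q"
  have F: "finite ?F" using assms by (simp add: finite_supp_anc)
  have W: "W c x y = (\<Sum>v\<in>?F. c (par_edge v) * \<bar>mass x v - mass y v\<bar>)"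
    if "x \<in> {p, z, q}" "y \<in> {p, z, q}" for x y
    using that by (intro W_superset[OF F]) auto
  have "c (par_edge v) * \<bar>mass p v - mass q v\<bar>
      \<le> c (par_edge v) * \<bar>mass p v - mass z v\<bar> + c (par_edge v) * \<bar>mass z v - mass q v\<bar>"
    if "v \<in> ?F" for v
  proof (cases "v = r")
    case False
    have "v \<in> V" using that supp_anc_subset assms by blast
    then have "0 \<le> c (par_edge v)" using False par_edge_mem assms(1) by blast
    then show ?thesis unfolding distrib_left[symmetric] by (rule mult_left_mono[rotated]) simp
  qed (simp add: mass_root assms)
  then have "(\<Sum>v\<in>?F. c (par_edge v) * \<bar>mass p v - mass q v\<bar>)
      \<le> (\<Sum>v\<in>?F. c (par_edge v) * \<bar>mass p v - mass z v\<bar> + c (par_edge v) * \<bar>mass z v - mass q v\<bar>)"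
    by (rule sum_mono)
  then show ?thesis by (simp add: W sum.distrib)
qed

lemma btw_W:
  assumes "p \<in> P" and "z \<in> P" and "q \<in> P" and "btw p z q"
  shows "W c p q = W c p z + W c z q"
proof -
  let ?F = "supp_anc p \<union> supp_anc z \<union> supp_anc q"
  have F: "finite ?F" using assms by (simp add: finite_supp_anc)
  have W: "W c x y = (\<Sum>v\<in>?F. c (par_edge v) * \<bar>mass x v - mass y v\<bar>)"
    if "x \<in> {p, z, q}" "y \<in> {p, z, q}" for x y
    using that by (intro W_superset[OF F]) auto
  have "c (par_edge v) * \<bar>mass p v - mass q v\<bar>
      = c (par_edge v) * \<bar>mass p v - mass z v\<bar> + c (par_edge v) * \<bar>mass z v - mass q v\<bar>" for v
    using assms(4) by (simp add: btw_def distrib_left)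
  then show ?thesis by (simp add: W sum.distrib[symmetric])
qed

text \<open>The defect in the triangle inequality is a sum of nonnegative terms, one for each
  coordinate. With positive lengths it vanishes only if every coordinate is between.\<close>

lemma W_btw:
  assumes "\<forall>e\<in>E. 0 < c e" and "p \<in> P" and "z \<in> P" and "q \<in> P"
    and "W c p q = W c p z + W c z q"
  shows "btw p z q"
proof -
  let ?F = "supp_anc p \<union> supp_anc z \<union> supp_anc q"
  let ?d = "\<lambda>v. \<bar>mass p v - mass z v\<bar> + \<bar>mass z v - mass q v\<bar> - \<bar>mass p v - mass q v\<bar>"
  have F: "finite ?F" using assms by (simp add: finite_supp_anc)
  have W: "W c x y = (\<Sum>v\<in>?F. c (par_edge v) * \<bar>mass x v - mass y v\<bar>)"
    if "x \<in> {p, z, q}" "y \<in> {p, z, q}" for x y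
    using that by (intro W_superset[OF F]) auto
  have nonneg: "0 \<le> c (par_edge v) * ?d v" if "v \<in> ?F" for v
  proof (cases "v = r")
    case False
    have "v \<in> V" using that supp_anc_subset assms by blast
    then have "0 < c (par_edge v)" using False par_edge_mem assms(1) by blast
    then show ?thesis by simp
  qed (simp add: mass_root assms)
  have "(\<Sum>v\<in>?F. c (par_edge v) * ?d v) = 0"
    using assms(5) by (simp add: W algebra_simps sum.distrib sum_subtractf)
  then have zero: "\<forall>v\<in>?F. c (par_edge v) * ?d v = 0"
    using sum_nonneg_eq_0_iff[of ?F "\<lambda>v. c (par_edge v) * ?d v"] F nonneg by blast
  have "?d v = 0" for v
  proof (cases "v \<in> ?F \<and> v \<noteq> r")
    case True
    then have "v \<in> V" using supp_anc_subset assms by blast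
    then have "0 < c (par_edge v)" using True par_edge_mem assms(1) by blast
    moreover have "c (par_edge v) * ?d v = 0" using zero True by blast
    ultimately show ?thesis by simp
  next
    case False
    then show ?thesis using assms by (auto simp: mass_root mass_outside)
  qed
  then show ?thesis by (simp add: btw_def)
qed

section \<open>Betweenness and the branching of the tree\<close>

lemma btw_sym: "btw p z q \<Longrightarrow> btw q z p"
  unfolding btw_def by (metis abs_minus_commute add.commute)

lemma btw_left: "btw p p q"
  by (simp add: btw_def)

text \<open>The coordinates \<open>mass _ v\<close> and \<open>mass _ v'\<close> of two different vertices jointly trace out a
  path in the unit square. This makes betweenness tree-like in \<open>btw_tree\<close>.\<close>

lemma mass_nested:
  assumes "p \<in> P" and "v \<in> anc v'" and "v \<noteq> v'" and "v' \<in> V"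
  shows "mass p v = 1 \<or> mass p v' = 0"
  using assms(1)
proof (cases rule: P_cases)
  case (1 u)
  then show ?thesis using anc_trans[of u v'] assms(2) by (auto simp: mass_vpt)
next
  case (2 u k s)
  note c = childD[OF 2(1)]
  show ?thesis
  proof (cases "v = k")
    case True
    then have "v' \<notin> anc k" using anc_antisym[of k v'] assms c(3) by blast
    then show ?thesis using 2 c assms(3) True by (auto simp: mass_seg)
  next
    case False
    show ?thesis
    proof (cases "v' \<in> anc k")
      case True
      then have "v \<in> anc k" using anc_trans[OF c(3)] assms(2) by blast
      then show ?thesis using False 2 c by (auto simp: mass_seg)
    next
      case False
      then show ?thesis using 2 c by (auto simp: mass_seg)
    qed
  qed
qed

text \<open>All ancestors of the support of a point lie on one root path, where any two vertices are
  comparable.\<close>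

lemma mass_disjoint:
  assumes "p \<in> P" and "v \<notin> anc v'" and "v' \<notin> anc v"
  shows "mass p v = 0 \<or> mass p v' = 0"
  using assms(1)
proof (cases rule: P_cases)
  case (1 u)
  then show ?thesis using anc_chain[of u v v'] assms(2,3) by (auto simp: mass_vpt)
next
  case (2 u k s)
  note c = childD[OF 2(1)]
  have "v \<notin> anc k \<or> v' \<notin> anc k" using anc_chain[OF c(3)] assms by blast
  then show ?thesis using 2 c by (auto simp: mass_seg)
qed

text \<open>A point \<open>w\<close> cannot be beyond \<open>z\<close> both on the side of
  \<open>x\<close> and on the side of \<open>y\<close>. As \<open>btw\<close> quantifies over
  coordinates, the two alternatives might fail at different vertices \<open>v\<close> and
  \<open>v'\<close>, so pairs of coordinates have to be examined.\<close>

lemma btw_tree: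
  assumes P: "x \<in> P" "y \<in> P" "z \<in> P" "w \<in> P" and b: "btw x z y"
  shows "btw x z w \<or> btw w z y"
proof (rule ccontr)
  assume "\<not> ?thesis"
  then obtain v v' where
    v: "\<bar>mass x v - mass w v\<bar> \<noteq> \<bar>mass x v - mass z v\<bar> + \<bar>mass z v - mass w v\<bar>" and
    v': "\<bar>mass w v' - mass y v'\<bar> \<noteq> \<bar>mass w v' - mass z v'\<bar> + \<bar>mass z v' - mass y v'\<bar>"
    by (auto simp: btw_def)
  have bv: "\<bar>mass x u - mass y u\<bar> = \<bar>mass x u - mass z u\<bar> + \<bar>mass z u - mass y u\<bar>" for u
    using b by (simp add: btw_def)
  have V: "v \<in> V" if "\<bar>mass p v - mass q v\<bar> \<noteq> \<bar>mass p v - mass z v\<bar> + \<bar>mass z v - mass q v\<bar>"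
    "p \<in> P" "q \<in> P" for p q v
  proof (rule ccontr)
    assume "v \<notin> V"
    then have "mass p v = 0" "mass q v = 0" "mass z v = 0"
      using supp_anc_subset P that by (meson mass_outside subsetD)+
    then show False using that by simp
  qed
  have "v \<in> V" "v' \<in> V" using V[OF v] V[OF v'] P by auto
  note range = mass_range[OF P(1)] mass_range[OF P(2)] mass_range[OF P(3)] mass_range[OF P(4)]
  \<comment> \<open>For different vertices the pairs of values at the four points lie on an arc of
    two adjacent sides of the unit square. Both coordinates are monotone along this arc, so the
    position of \<open>w\<close> relative to \<open>z\<close> settles the same alternative for
    both.\<close>
  consider "v = v'" | "v \<in> anc v'" "v \<noteq> v'" | "v' \<in> anc v" "v \<noteq> v'" | "v \<notin> anc v'" "v' \<notin> anc v"
    by blast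
  then show False
  proof cases
    case 1
    then show ?thesis using v v' bv[of v] by (simp split: abs_split)
  next
    case 2
    have "\<And>p. p \<in> {x, y, z, w} \<Longrightarrow> mass p v = 1 \<or> mass p v' = 0"
      using mass_nested[OF _ 2 \<open>v' \<in> V\<close>] P by blast
    then show ?thesis using v v' bv[of v] bv[of v'] range[of v] range[of v']
      by (smt (verit) insertCI)
  next
    case 3
    have "\<And>p. p \<in> {x, y, z, w} \<Longrightarrow> mass p v' = 1 \<or> mass p v = 0"
      using mass_nested[OF _ 3(1) _ \<open>v \<in> V\<close>] 3(2) P by blast
    then show ?thesis using v v' bv[of v] bv[of v'] range[of v] range[of v']
      by (smt (verit) insertCI)
  next
    case 4
    have "\<And>p. p \<in> {x, y, z, w} \<Longrightarrow> mass p v = 0 \<or> mass p v' = 0"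
      using mass_disjoint[OF _ 4] P by blast
    then show ?thesis using v v' bv[of v] bv[of v'] range[of v] range[of v']
      by (smt (verit) insertCI)
  qed
qed

text \<open>A vertex has only masses 0 and 1, and its ancestors determine it. An interior point of
  an edge has exactly one fractional mass, which gives the child end of the edge and the position on
  it.\<close>

lemma mass_inj:
  assumes "p \<in> P" and "q \<in> P" and "\<And>v. mass p v = mass q v"
  shows "p = q"
  using assms(1)
proof (cases rule: P_cases)
  case p: (1 u)
  show ?thesis
    using assms(2)
  proof (cases rule: P_cases)
    case q: (1 w)
    have "u \<in> anc w" "w \<in> anc u"
      using assms(3)[of u] assms(3)[of w] p q anc_refl by (auto simp: mass_vpt split: if_splits)
    then show ?thesis using anc_antisym p q by blast
  next
    case q: (2 u' k s)
    then show ?thesis using assms(3)[of k] p by (simp add: mass_vpt mass_seg split: if_splits)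
  qed
next
  case p: (2 u k s)
  show ?thesis
    using assms(2)
  proof (cases rule: P_cases)
    case q: (1 w)
    then show ?thesis using assms(3)[of k] p by (simp add: mass_vpt mass_seg split: if_splits)
  next
    case q: (2 u' k' s')
    have "k = k' \<and> s = s'" using assms(3)[of k] p q by (simp add: mass_seg split: if_splits)
    then show ?thesis using p q child_unique by blast
  qed
qed

lemma btw_antisym:
  assumes "p \<in> P" and "q \<in> P" and "btw p q p"
  shows "p = q"
proof (rule mass_inj[OF assms(1,2)])
  fix v
  have "\<bar>mass p v - mass q v\<bar> + \<bar>mass q v - mass p v\<bar> = 0"
    using assms(3) by (simp add: btw_def)
  then show "mass p v = mass q v" by linarith
qed

lemma W_eq_0:
  assumes "\<forall>e\<in>E. 0 < c e" and "p \<in> P" and "q \<in> P" and "W c p q \<le> 0"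
  shows "p = q"
proof -
  have "0 \<le> W c p q" by (rule W_nonneg) (use assms less_imp_le in blast)+
  then have "W c p p = W c p q + W c q p" using assms(4) W_sym[of c q p] by (simp add: W_refl)
  then have "btw p q p" using assms(1,2,3) by (intro W_btw[of c]) auto
  then show ?thesis using btw_antisym assms by blast
qed

lemma W_seg:
  assumes "child u k" and "0 \<le> s" and "s \<le> 1" and "0 \<le> s'" and "s' \<le> 1"
  shows "W c (seg u k s) (seg u k s') = c {u, k} * \<bar>s - s'\<bar>"
proof -
  note c = childD[OF assms(1)]
  have sub: "supp_anc (seg u k x) \<subseteq> insert k (anc u)" for x
    using supp_seg[of u k x] c(5) by (fastforce simp: supp_anc_def)
  have "W c (seg u k s) (seg u k s')
      = (\<Sum>v\<in>insert k (anc u). c (par_edge v) * \<bar>mass (seg u k s) v - mass (seg u k s') v\<bar>)"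
    by (rule W_superset) (use sub finite_anc in auto)
  also have "\<dots> = (\<Sum>v\<in>{k}. c (par_edge v) * \<bar>mass (seg u k s) v - mass (seg u k s') v\<bar>)"
    by (rule sum.mono_neutral_right) (use assms(1) finite_anc in \<open>auto simp: mass_seg\<close>)
  finally show ?thesis using c assms(1) by (simp add: mass_seg)
qed

lemma W_vpt_edge:
  assumes "{u, w} \<in> E"
  shows "W c (vpt u) (vpt w) = c {u, w}"
proof -
  have "W c (vpt a) (vpt b) = c {a, b}" if "child a b" for a b
    using W_seg[OF that, of 0 1 c] childD(4)[OF that] by (simp add: seg_0 seg_1)
  then show ?thesis using edge_child[OF assms] W_sym by (metis insert_commute)
qed

section \<open>Identification of the l1-formula with the path metric\<close>

lemma anc_edge:
  assumes "{a, b} \<in> E" and "child u k" and "{a, b} \<noteq> {u, k}"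
  shows "k \<in> anc a \<longleftrightarrow> k \<in> anc b"
  using edge_child[OF assms(1)]
proof
  assume c: "child a b"
  then have "k \<noteq> b" using child_unique assms(2,3) by blast
  then show ?thesis using childD(5)[OF c] by simp
next
  assume c: "child b a"
  then have "k \<noteq> a" using child_unique assms(2,3) by blast
  then show ?thesis using childD(5)[OF c] by simp
qed

text \<open>The edge \<open>{u, k}\<close> is the only way in or out of the descendants of
  \<open>k\<close>, and a path missing one of its ends does not cross it.\<close>

lemma anc_path:
  assumes "successively (\<lambda>x y. {x, y} \<in> E) xs" and "xs \<noteq> []" and "child u k"
    and "\<not> {u, k} \<subseteq> set xs"
  shows "k \<in> anc (hd xs) \<longleftrightarrow> k \<in> anc (last xs)"
  using assms(1,2,4)
proof (induction xs rule: induct_list012)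
  case (3 a b zs)
  have "k \<in> anc a \<longleftrightarrow> k \<in> anc b"
    using 3 by (intro anc_edge[OF _ assms(3)]) auto
  also have "\<dots> \<longleftrightarrow> k \<in> anc (last (b # zs))"
    using 3 by auto
  finally show ?case by simp
qed simp_all

text \<open>Along the first edge only the mass at its child end \<open>k\<close> changes. The rest
  of the path avoids \<open>u\<close>, hence never crosses this edge again, and the mass at
  \<open>k\<close> keeps its value.\<close>

lemma btw_path:
  assumes "simple_path E u (u # u' # xs) w"
  shows "btw (vpt u) (vpt u') (vpt w)"
proof -
  have e: "{u, u'} \<in> E" and p: "successively (\<lambda>x y. {x, y} \<in> E) (u' # xs)"
    and u: "u \<notin> set (u' # xs)" and w: "last (u' # xs) = w"
    using assms by (auto simp: simple_path_def)
  obtain a k where k: "child a k" "{u, u'} = {a, k}" using edgeE[OF e] by metis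
  have "k \<in> anc u' \<longleftrightarrow> k \<in> anc w"
    using anc_path[OF p _ k(1)] u k(2) w by (metis insertCI list.sel(1) list.distinct(1) subsetD)
  then have "mass (vpt u') k = mass (vpt w) k" by (simp add: mass_vpt)
  moreover have "mass (vpt u) v = mass (vpt u') v" if "v \<noteq> k" for v
    using childD(5)[OF k(1)] k(2) that by (auto simp: doubleton_eq_iff mass_vpt)
  ultimately show ?thesis unfolding btw_def by (metis abs_zero add.right_neutral add_0 diff_self)
qed

lemma simple_path_Cons:
  assumes "simple_path E u (x # y # xs) w"
  shows "x = u" and "simple_path E y (y # xs) w" and "{x, y} \<in> E"
  using assms by (auto simp: simple_path_def)

lemma W_path:
  assumes "simple_path E u xs w" and "u \<in> V"
  shows "(\<Sum>(x, y)\<leftarrow>zip xs (tl xs). c {x, y}) = W c (vpt u) (vpt w)"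
  using assms
proof (induction xs arbitrary: u rule: induct_list012)
  case (2 x)
  then show ?case by (auto simp: simple_path_def W_refl)
next
  case (3 x y zs)
  note p = simple_path_Cons[OF 3(3)]
  have V: "x \<in> V" "y \<in> V" using edgeD[OF p(3)] by auto
  have w: "w \<in> V"
    using simple_path_verts[OF tree p(2) V(2)] p(2) by (metis last_in_set simple_path_def subsetD)
  have "btw (vpt x) (vpt y) (vpt w)" using btw_path[of x y zs w] 3(3) p(1) by simp
  then have "W c (vpt u) (vpt w) = W c (vpt x) (vpt y) + W c (vpt y) (vpt w)"
    using btw_W[OF vpt_P[OF V(1)] vpt_P[OF V(2)] vpt_P[OF w]] p(1) by simp
  then show ?case using 3(2)[OF p(2) V(2)] W_vpt_edge[OF p(3)] by simp
qed (simp add: simple_path_def)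

text \<open>The mass of \<open>q\<close> at the child end tells on which side of the edge
  \<open>q\<close> lies: 0 means leaving through the parent end, 1 through the child end.\<close>

lemma btw_leave:
  assumes "p \<in> P" and "q \<in> P"
    and "\<And>u k. child u k \<Longrightarrow> supp p = {u, k} \<Longrightarrow> mass q k = 0 \<or> mass q k = 1"
  shows "\<exists>u\<in>supp p. btw p (vpt u) q"
  using assms(1)
proof (cases rule: P_cases)
  case (1 v)
  then show ?thesis by (simp add: supp_vpt btw_left)
next
  case (2 u k s)
  note c = childD[OF 2(1)]
  have s: "supp p = {u, k}" using 2 c(4) by (auto simp: supp_def seg_def)
  show ?thesis
  proof (cases "mass q k = 0")
    case True
    then have "btw p (vpt u) q" using 2 c by (auto simp: btw_def mass_seg mass_vpt)
    then show ?thesis using s by blast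
  next
    case False
    then have "mass q k = 1" using assms(3) 2(1) s by blast
    then have "btw p (vpt k) q" using 2 c by (auto simp: btw_def mass_seg mass_vpt)
    then show ?thesis using s by blast
  qed
qed

text \<open>These \<open>u\<close> and \<open>w\<close> attain the minimum in the last case of
  \<open>pdist\<close>.\<close>

lemma P_decomp:
  assumes "p \<in> P" and "q \<in> P" and "\<not> (\<exists>e\<in>E. supp p \<union> supp q \<subseteq> e)"
  shows "\<exists>u\<in>supp p. \<exists>w\<in>supp q. btw p (vpt u) q \<and> btw (vpt u) (vpt w) q"
proof -
  have "\<exists>u\<in>supp p. btw p (vpt u) q"
  proof (rule btw_leave[OF assms(1,2)])
    fix u k assume k: "child u k" "supp p = {u, k}"
    show "mass q k = 0 \<or> mass q k = 1"
      using assms(2)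
    proof (cases rule: P_cases)
      case (2 u' k' s)
      \<comment> \<open>Only at \<open>k'\<close> is the mass of \<open>q\<close> fractional, and
        equal child ends would put both points on one edge.\<close>
      have "k \<noteq> k'"
      proof
        assume "k = k'"
        then have "supp q \<subseteq> {u, k}" using child_unique 2 k(1) supp_seg by blast
        then show False using assms(3) k(2) childD(1)[OF k(1)] by auto
      qed
      then show ?thesis using 2 by (simp add: mass_seg)
    qed (simp add: mass_vpt)
  qed
  then obtain u where u: "u \<in> supp p" "btw p (vpt u) q" by blast
  then have "u \<in> V" using P_supp_subset assms(1) by blast
  then have "\<exists>w\<in>supp q. btw q (vpt w) (vpt u)"
    using assms(2) vpt_P by (intro btw_leave) (auto simp: mass_vpt)
  then show ?thesis using u btw_sym by blast
qed

lemma W_vertex: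
  assumes "p \<in> P" and "u \<in> supp p"
  shows "W c p (vpt u) = (1 - p u) * c (supp p)"
  using assms(1)
proof (cases rule: P_cases)
  case (1 v)
  then show ?thesis using assms(2) by (simp add: supp_vpt W_refl) (simp add: vpt_def)
next
  case (2 a k s)
  note k = childD[OF 2(1)]
  have s: "supp p = {a, k}" using 2 k(4) by (auto simp: supp_def seg_def)
  then have "u = a \<or> u = k" using assms(2) by blast
  then show ?thesis
  proof
    assume "u = a"
    then show ?thesis
      using W_seg[OF 2(1), of s 0 c] 2 k(4) s by (simp add: seg_0) (simp add: seg_def)
  next
    assume "u = k"
    then show ?thesis
      using W_seg[OF 2(1), of s 1 c] 2 k(4) s by (simp add: seg_1) (simp add: seg_def)
  qed
qed

lemma vdist_eq_W:
  assumes "edges T = E" and "u \<in> V" and "w \<in> V"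
  shows "vdist T u w = W (len T) (vpt u) (vpt w)"
proof -
  have "simple_path E u (geodesic T u w) w"
    unfolding geodesic_def assms(1) using tree assms(2,3)
    by (metis (no_types, lifting) simplicial_tree_def theI')
  then show ?thesis using W_path[OF _ assms(2)] by (simp add: vdist_def Let_def)
qed

text \<open>Replaces the cases of \<open>pdist\<close> by a formula linear in the lengths. The
  candidates in the minimum are upper bounds by the triangle inequality, and \<open>P_decomp\<close>
  supplies one with equality.\<close>

lemma pdist_eq_W:
  assumes "verts T = V" and "edges T = E" and pos: "\<forall>e\<in>E. 0 < len T e"
    and p: "p \<in> P" and q: "q \<in> P"
  shows "pdist T p q = W (len T) p q"
proof -
  have points: "p \<in> points T" "q \<in> points T" using p q assms(1,2) by (auto simp: points_def P_def)
  show ?thesis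
  proof (cases "\<exists>e\<in>E. supp p \<union> supp q \<subseteq> e")
    case True
    then obtain u k where k: "child u k" "supp p \<union> supp q \<subseteq> {u, k}" by (metis edgeE)
    note c = childD[OF k(1)]
    obtain s where s: "0 \<le> s" "s \<le> 1" "p = seg u k s" using P_edge[OF p k(1)] k(2) by blast
    obtain s' where s': "0 \<le> s'" "s' \<le> 1" "q = seg u k s'" using P_edge[OF q k(1)] k(2) by blast
    have "pdist T p q = len T (supp p \<union> supp q) * (\<Sum>v\<in>supp p \<union> supp q. \<bar>p v - q v\<bar>) / 2"
      using True points assms(2) by (simp add: pdist_def)
    also have "\<dots> = len T {u, k} * \<bar>s - s'\<bar>"
    \<comment> \<open>For equal points the union of the supports may be a single vertex, where
      \<open>len\<close> is arbitrary; the sum is then 0.\<close>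
    proof (cases "s = s'")
      case False
      have "p u = 1 - s" "q u = 1 - s'" "p k = s" "q k = s'" using s s' c(4) by (auto simp: seg_def)
      then have "supp p \<union> supp q = {u, k}" using False k(2) by (auto simp: supp_def)
      then show ?thesis using \<open>p u = _\<close> \<open>q u = _\<close> \<open>p k = _\<close> \<open>q k = _\<close> c(4) by (simp add: abs_minus_commute)
    qed (use s s' in simp)
    finally show ?thesis using W_seg[OF k(1)] s s' by simp
  next
    case False
    let ?S = "{(1 - p u) * len T (supp p) + vdist T u w + (1 - q w) * len T (supp q) | u w.
                  u \<in> supp p \<and> w \<in> supp q}"
    have e: "(1 - p u) * len T (supp p) + vdist T u w + (1 - q w) * len T (supp q)
        = W (len T) p (vpt u) + W (len T) (vpt u) (vpt w) + W (len T) (vpt w) q"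
      if "u \<in> supp p" "w \<in> supp q" for u w
    proof -
      have "u \<in> V" "w \<in> V" using that P_supp_subset p q by blast+
      then show ?thesis
        using W_vertex[OF p that(1)] W_vertex[OF q that(2)] vdist_eq_W[OF assms(2)] W_sym by metis
    qed
    have tri: "W (len T) x y \<le> W (len T) x z + W (len T) z y" if "x \<in> P" "y \<in> P" "z \<in> P" for x y z
      by (rule W_triangle) (use that pos less_imp_le in blast)+
    have "Min ?S = W (len T) p q"
    proof (rule Min_eqI)
      have "?S = (\<lambda>(u, w). (1 - p u) * len T (supp p) + vdist T u w + (1 - q w) * len T (supp q))
          ` (supp p \<times> supp q)" by auto
      then show "finite ?S" using finite_supp p q by simp
    next
      fix y assume "y \<in> ?S"
      then obtain u w where u: "u \<in> supp p" "w \<in> supp q"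
        and y: "y = W (len T) p (vpt u) + W (len T) (vpt u) (vpt w) + W (len T) (vpt w) q"
        using e by blast
      have "vpt u \<in> P" "vpt w \<in> P" using u P_supp_subset p q vpt_P by blast+
      then show "W (len T) p q \<le> y"
        using tri[of p q "vpt u"] tri[of "vpt u" q "vpt w"] p q y by simp
    next
      obtain u w where u: "u \<in> supp p" "w \<in> supp q" "btw p (vpt u) q" "btw (vpt u) (vpt w) q"
        using P_decomp[OF p q False] by blast
      have "vpt u \<in> P" "vpt w \<in> P" using u P_supp_subset p q vpt_P by blast+
      then have "W (len T) p q = W (len T) p (vpt u) + W (len T) (vpt u) (vpt w) + W (len T) (vpt w) q"
        using btw_W[OF p _ q u(3)] btw_W[OF _ _ q u(4)] by simp
      then show "W (len T) p q \<in> ?S" using e[OF u(1,2)] u(1,2) by (smt (verit) mem_Collect_eq)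
    qed
    moreover have "\<not> (\<exists>e\<in>edges T. supp p \<union> supp q \<subseteq> e)" using False assms(2) by simp
    ultimately show ?thesis using points by (simp only: pdist_def simp_thms if_False if_True)
  qed
qed

section \<open>Intermediate values along geodesics, and barycentres\<close>

lemma btw_trans:
  assumes "btw x p y" and "btw x z p"
  shows "btw x z y" and "btw z p y"
proof -
  have "\<bar>mass x v - mass y v\<bar> = \<bar>mass x v - mass z v\<bar> + \<bar>mass z v - mass y v\<bar> \<and>
    \<bar>mass z v - mass y v\<bar> = \<bar>mass z v - mass p v\<bar> + \<bar>mass p v - mass y v\<bar>" for v
    using assms[unfolded btw_def, rule_format, of v] by linarith
  then show "btw x z y" and "btw z p y" by (simp_all add: btw_def)
qed

text \<open>An intermediate value property along the geodesic from \<open>x\<close> to \<open>y\<close>.\<close>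

definition fill :: "('v set \<Rightarrow> real) \<Rightarrow> ('v set \<Rightarrow> real) \<Rightarrow> ('v \<Rightarrow> real) \<Rightarrow> ('v \<Rightarrow> real) \<Rightarrow> bool" where
  "fill a b x y \<longleftrightarrow> (\<forall>\<rho>. - W b x y \<le> \<rho> \<and> \<rho> \<le> W a x y \<longrightarrow>
     (\<exists>z\<in>P. btw x z y \<and> W a x z - W b z y = \<rho>))"

lemma fill_refl: "x \<in> P \<Longrightarrow> fill a b x x"
  by (auto simp: fill_def W_refl intro!: bexI[of _ x] btw_left)

text \<open>As \<open>z\<close> runs from \<open>x\<close> to \<open>y\<close>, the quantity in
  \<open>fill\<close> rises from \<open>- W b x y\<close> to \<open>W a x y\<close>. On a single
  edge it is affine in the position.\<close>

lemma fill_seg: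
  assumes ab: "\<forall>e\<in>E. 0 < a e" "\<forall>e\<in>E. 0 < b e"
    and k: "child u k" and s: "0 \<le> s" "s \<le> 1" "0 \<le> s'" "s' \<le> 1"
  shows "fill a b (seg u k s) (seg u k s')"
proof (cases "s = s'")
  case True
  then show ?thesis using fill_refl seg_P[OF k s(1,2)] by simp
next
  case False
  show ?thesis
    unfolding fill_def
  proof (intro allI impI, elim conjE)
    fix \<rho> assume \<rho>: "- W b (seg u k s) (seg u k s') \<le> \<rho>" "\<rho> \<le> W a (seg u k s) (seg u k s')"
    let ?a = "a {u, k}" and ?b = "b {u, k}" and ?l = "\<bar>s - s'\<bar>"
    have pos: "0 < ?a" "0 < ?b" using ab childD(1)[OF k] by auto
    \<comment> \<open>The solution of
      \<open>\<theta> * ?a * ?l - (1 - \<theta>) * ?b * ?l = \<rho>\<close>.\<close>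
    define \<theta> where "\<theta> = (\<rho> + ?b * ?l) / ((?a + ?b) * ?l)"
    have l: "0 < (?a + ?b) * ?l" using False pos by simp
    have \<rho>': "- (?b * ?l) \<le> \<rho>" "\<rho> \<le> ?a * ?l" using \<rho> W_seg[OF k s] by simp_all
    then have \<theta>: "0 \<le> \<theta>" "\<theta> \<le> 1" using l by (auto simp: \<theta>_def divide_le_eq algebra_simps)
    define z where "z = (1 - \<theta>) * s + \<theta> * s'"
    have "0 \<le> z" unfolding z_def using s \<theta> by simp
    moreover have "z \<le> 1" unfolding z_def using s \<theta> convex_bound_le[of s 1 s' "1 - \<theta>" \<theta>] by simp
    moreover have d: "\<bar>s - z\<bar> = \<theta> * ?l" "\<bar>z - s'\<bar> = (1 - \<theta>) * ?l"
    proof -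
      have "s - z = \<theta> * (s - s')" "z - s' = (1 - \<theta>) * (s - s')" by (auto simp: z_def algebra_simps)
      then show "\<bar>s - z\<bar> = \<theta> * ?l" "\<bar>z - s'\<bar> = (1 - \<theta>) * ?l" using \<theta> by (simp_all add: abs_mult)
    qed
    moreover have "?a * (\<theta> * ?l) - ?b * ((1 - \<theta>) * ?l) = \<rho>"
    proof -
      have "\<theta> * ((?a + ?b) * ?l) = \<rho> + ?b * ?l"
        by (metis \<theta>_def l less_irrefl nonzero_eq_divide_eq)
      then show ?thesis by (simp add: algebra_simps)
    qed
    moreover have "btw (seg u k s) (seg u k z) (seg u k s')"
      using d by (auto simp: btw_def mass_seg[OF k] algebra_simps)
    ultimately show "\<exists>z\<in>P. btw (seg u k s) z (seg u k s') \<and>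
        W a (seg u k s) z - W b z (seg u k s') = \<rho>"
      using seg_P[OF k] W_seg[OF k] s by (intro bexI[of _ "seg u k z"]) simp_all
  qed
qed

text \<open>The value at \<open>p\<close> decides which of the two pieces contains the point sought.
  The other piece contributes a constant, by which the value aimed at is shifted.\<close>

lemma fill_trans:
  assumes P: "x \<in> P" "p \<in> P" "y \<in> P" and b: "btw x p y"
    and f: "fill a b x p" "fill a b p y"
  shows "fill a b x y"
  unfolding fill_def
proof (intro allI impI, elim conjE)
  fix \<rho> assume \<rho>: "- W b x y \<le> \<rho>" "\<rho> \<le> W a x y"
  show "\<exists>z\<in>P. btw x z y \<and> W a x z - W b z y = \<rho>"
  proof (cases "\<rho> \<le> W a x p - W b p y")
    case True
    have "- W b x p \<le> \<rho> + W b p y" using \<rho>(1) btw_W[OF P b, of b] by simp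
    then obtain z where z: "z \<in> P" "btw x z p" "W a x z - W b z p = \<rho> + W b p y"
      using f(1) True unfolding fill_def by (metis add.commute le_diff_eq)
    have "btw x z y" "btw z p y" using btw_trans[OF b z(2)] by auto
    then show ?thesis using z btw_W[OF z(1) P(2,3), of b] by auto
  next
    case False
    have "\<rho> - W a x p \<le> W a p y" using \<rho>(2) btw_W[OF P b, of a] by simp
    moreover have "- W b p y \<le> \<rho> - W a x p" using False by simp
    ultimately obtain z where z: "z \<in> P" "btw p z y" "W a p z - W b z y = \<rho> - W a x p"
      using f(2) unfolding fill_def by blast
    have "btw y z x" "btw z p x" using btw_trans[OF btw_sym[OF b] btw_sym[OF z(2)]] by auto
    then have "btw x z y" "btw x p z" by (auto intro: btw_sym)
    then show ?thesis using z btw_W[OF P(1,2) z(1), of a] by auto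
  qed
qed

lemma fill_path:
  assumes ab: "\<forall>e\<in>E. 0 < a e" "\<forall>e\<in>E. 0 < b e"
    and "simple_path E u xs w" and "u \<in> V"
  shows "fill a b (vpt u) (vpt w)"
  using assms(3,4)
proof (induction xs arbitrary: u rule: induct_list012)
  case (2 x)
  then show ?case by (auto simp: simple_path_def intro!: fill_refl vpt_P)
next
  case (3 x y zs)
  note p = simple_path_Cons[OF 3(3)]
  have V: "x \<in> V" "y \<in> V" using edgeD[OF p(3)] by auto
  have w: "w \<in> V"
    using simple_path_verts[OF tree p(2) V(2)] p(2) by (metis last_in_set simple_path_def subsetD)
  have "fill a b (vpt x) (vpt y)"
    using edge_child[OF p(3)]
  proof
    assume k: "child x y"
    show ?thesis using fill_seg[OF ab k, of 0 1] childD(4)[OF k] by (simp add: seg_0 seg_1)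
  next
    assume k: "child y x"
    show ?thesis using fill_seg[OF ab k, of 1 0] childD(4)[OF k] by (simp add: seg_0 seg_1)
  qed
  moreover have "btw (vpt x) (vpt y) (vpt w)" using btw_path[of x y zs w] 3(3) p(1) by simp
  ultimately show ?case
    using fill_trans[OF vpt_P vpt_P vpt_P, OF V w] 3(2)[OF p(2) V(2)] p(1) by blast
qed (simp add: simple_path_def)

lemma fill:
  assumes ab: "\<forall>e\<in>E. 0 < a e" "\<forall>e\<in>E. 0 < b e"
    and x: "x \<in> P" and y: "y \<in> P"
  shows "fill a b x y"
proof (cases "\<exists>e\<in>E. supp x \<union> supp y \<subseteq> e")
  case True
  then obtain u k where k: "child u k" "supp x \<union> supp y \<subseteq> {u, k}" by (metis edgeE)
  then show ?thesis using P_edge[OF x k(1)] P_edge[OF y k(1)] fill_seg[OF ab k(1)] by (metis le_sup_iff)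
next
  case False
  obtain u w where u: "u \<in> supp x" "w \<in> supp y" "btw x (vpt u) y" "btw (vpt u) (vpt w) y"
    using P_decomp[OF x y False] by blast
  have V: "u \<in> V" "w \<in> V" using u P_supp_subset x y by blast+
  have ends: "fill a b p (vpt v) \<and> fill a b (vpt v) p" if p: "p \<in> P" and v: "v \<in> supp p" for p v
    using p
  proof (cases rule: P_cases)
    case (1 v')
    then show ?thesis using v fill_refl vpt_P by (simp add: supp_vpt)
  next
    case (2 u' k s)
    then have "v = u' \<or> v = k" using v supp_seg by blast
    then show ?thesis
      using 2 fill_seg[OF ab 2(1), of s 0] fill_seg[OF ab 2(1), of 0 s]
        fill_seg[OF ab 2(1), of s 1] fill_seg[OF ab 2(1), of 1 s] childD(4)[OF 2(1)]
      by (auto simp: seg_0 seg_1)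
  qed
  obtain xs where "simple_path E u xs w" using tree V unfolding simplicial_tree_def by blast
  then have "fill a b (vpt u) (vpt w)" using fill_path[OF ab] V by blast
  then have "fill a b (vpt u) y"
    using fill_trans[OF vpt_P[OF V(1)] vpt_P[OF V(2)] y u(4)] ends[OF y u(2)] by blast
  then show ?thesis
    using fill_trans[OF x vpt_P[OF V(1)] y u(3)] ends[OF x u(1)] by blast
qed

text \<open>Weights of an interpolation are absorbed in \<open>a\<close> and \<open>b\<close>: with
  \<open>(1 - t)\<close> times and \<open>t\<close> times the two end lengths this is the weighted
  barycentre.\<close>

definition is_bary where
  "is_bary a b x y z \<longleftrightarrow> z \<in> P \<and> btw x z y \<and> W a x z = W b z y"

text \<open>The value 0 lies in the range covered by \<open>fill\<close>.\<close>

lemma bary_exists: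
  assumes ab: "\<forall>e\<in>E. 0 < a e" "\<forall>e\<in>E. 0 < b e"
    and x: "x \<in> P" and y: "y \<in> P"
  shows "\<exists>z. is_bary a b x y z"
proof -
  have "0 \<le> W a x y" "0 \<le> W b x y" by (rule W_nonneg; use x y ab less_imp_le in blast)+
  then have "\<exists>z\<in>P. btw x z y \<and> W a x z - W b z y = 0"
    using fill[OF ab x y, unfolded fill_def, rule_format, of 0] by simp
  then show ?thesis by (auto simp: is_bary_def)
qed

text \<open>At most one of \<open>x\<close>, \<open>y\<close> lies beyond \<open>z\<close> in the direction of \<open>z'\<close>, and likewise for \<open>x'\<close>, \<open>y'\<close>
  at \<open>z'\<close>. Up to symmetry, either both \<open>x\<close> and \<open>x'\<close> or both \<open>y\<close> and \<open>x'\<close> point away from the segment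
  between \<open>z\<close> and \<open>z'\<close>.\<close>

lemma bary_lipschitz_1:
  assumes ab: "\<forall>e\<in>E. 0 < a e" "\<forall>e\<in>E. 0 < b e"
    and P: "x \<in> P" "y \<in> P" "x' \<in> P" "y' \<in> P" "z \<in> P" "z' \<in> P"
    and z: "W a x z = W b z y" and z': "W a x' z' = W b z' y'"
    and b: "btw x z z'" "btw x' z' z"
  shows "W a z z' + W b z z' \<le> W a x x' + W b y y'"
proof (cases "z = z'")
  case True
  have "0 \<le> W a x x'" "0 \<le> W b y y'" by (rule W_nonneg; use P ab less_imp_le in blast)+
  then show ?thesis using True by (simp add: W_refl)
next
  case False
  have "\<not> btw x z' z"
  proof
    assume "btw x z' z"
    then have "btw z z' z" using btw_trans(2)[OF \<open>btw x z' z\<close> b(1)] by simp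
    then show False using btw_antisym P False by blast
  qed
  \<comment> \<open>Hence the geodesic from \<open>x\<close> to \<open>x'\<close> passes through
    \<open>z\<close> and then through \<open>z'\<close>.\<close>
  then have xx: "btw x z' x'" using btw_tree[OF P(3,5,6,1) b(2)] btw_sym by blast
  have tri: "W b p q \<le> W b p t + W b t q" if "p \<in> P" "q \<in> P" "t \<in> P" for p q t
    by (rule W_triangle) (use that ab less_imp_le in blast)+
  have "W a x x' = W a x z + W a z z' + W a z' x'"
    using btw_W[OF P(1,6,3) xx, of a] btw_W[OF P(1,5,6) b(1), of a] by simp
  \<comment> \<open>The detour costs \<open>W b z y\<close> and \<open>W b y' z'\<close> in
    addition. By the barycentre equations these are \<open>W a x z\<close> and
    \<open>W a x' z'\<close>, which the preceding equation pays for.\<close>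
  moreover have "W b z z' \<le> W b z y + W b y y' + W b y' z'"
    using tri[of z z' y] tri[of y z' y'] P by simp
  ultimately show ?thesis using z z' W_sym[of a x' z'] W_sym[of b y' z'] by simp
qed

text \<open>The distances \<open>W b y z'\<close> and \<open>W a x' z\<close> split exactly at the
  barycentres. Bounding them by detours through \<open>y'\<close> and \<open>x\<close> and adding
  up, the barycentre equations cancel the remaining terms.\<close>

lemma bary_lipschitz_2:
  assumes ab: "\<forall>e\<in>E. 0 < a e" "\<forall>e\<in>E. 0 < b e"
    and P: "x \<in> P" "y \<in> P" "x' \<in> P" "y' \<in> P" "z \<in> P" "z' \<in> P"
    and z: "W a x z = W b z y" and z': "W a x' z' = W b z' y'"
    and b: "btw y z z'" "btw x' z' z"
  shows "W a z z' + W b z z' \<le> W a x x' + W b y y'"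
proof -
  have tria: "W a p q \<le> W a p t + W a t q" if "p \<in> P" "q \<in> P" "t \<in> P" for p q t
    by (rule W_triangle) (use that ab less_imp_le in blast)+
  have trib: "W b p q \<le> W b p t + W b t q" if "p \<in> P" "q \<in> P" "t \<in> P" for p q t
    by (rule W_triangle) (use that ab less_imp_le in blast)+
  have "W b y z' = W b y z + W b z z'" by (rule btw_W[OF P(2,5,6) b(1)])
  moreover have "W a x' z = W a x' z' + W a z' z" by (rule btw_W[OF P(3,6,5) b(2)])
  ultimately show ?thesis
    using tria[of x' z x] trib[of y z' y'] P z z'
      W_sym[of a x' x] W_sym[of a z' z] W_sym[of b y' z'] W_sym[of b z y] by simp
qed

lemma bary_lipschitz:
  assumes ab: "\<forall>e\<in>E. 0 < a e" "\<forall>e\<in>E. 0 < b e"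
    and P: "x \<in> P" "y \<in> P" "x' \<in> P" "y' \<in> P"
    and z: "is_bary a b x y z" and z': "is_bary a b x' y' z'"
  shows "W a z z' + W b z z' \<le> W a x x' + W b y y'"
proof -
  have Z: "z \<in> P" "z' \<in> P" and e: "W a x z = W b z y" "W a x' z' = W b z' y'"
    and b: "btw x z y" "btw x' z' y'"
    using z z' by (auto simp: is_bary_def)
  \<comment> \<open>Exchanging \<open>a\<close> with \<open>b\<close> and \<open>x\<close> with
    \<open>y\<close> preserves the barycentre equation; this reduces cases 2 and 4 below to 1 and
    3.\<close>
  have e': "W b y z = W a z x" "W b y' z' = W a z' x'" using e W_sym by metis+
  have "btw x z z' \<or> btw y z z'" using btw_tree[OF P(1,2) Z b(1)] btw_sym by blast
  moreover have "btw x' z' z \<or> btw y' z' z" using btw_tree[OF P(3,4) Z(2,1) b(2)] btw_sym by blast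
  ultimately consider "btw x z z'" "btw x' z' z" | "btw y z z'" "btw y' z' z"
    | "btw y z z'" "btw x' z' z" | "btw x z z'" "btw y' z' z" by blast
  then show ?thesis
  proof cases
    case 1
    then show ?thesis using bary_lipschitz_1[OF ab P Z e] by blast
  next
    case 2
    have "W b z z' + W a z z' \<le> W b y y' + W a x x'"
      by (rule bary_lipschitz_1[OF ab(2,1) P(2,1,4,3) Z e' 2])
    then show ?thesis by simp
  next
    case 3
    then show ?thesis using bary_lipschitz_2[OF ab P Z e] by blast
  next
    case 4
    have "W b z z' + W a z z' \<le> W b y y' + W a x x'"
      by (rule bary_lipschitz_2[OF ab(2,1) P(2,1,4,3) Z e' 4])
    then show ?thesis by simp
  qed
qed

text \<open>For one and the same pair the Lipschitz estimate bounds the distance of two barycentres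
  by 0. Uniqueness is the source of equivariance later.\<close>

lemma bary_unique:
  assumes ab: "\<forall>e\<in>E. 0 < a e" "\<forall>e\<in>E. 0 < b e"
    and P: "x \<in> P" "y \<in> P" and z: "is_bary a b x y z" "is_bary a b x y z'"
  shows "z = z'"
proof -
  have Z: "z \<in> P" "z' \<in> P" using z by (auto simp: is_bary_def)
  have "W a z z' + W b z z' \<le> 0"
    using bary_lipschitz[OF ab P P z] by (simp add: W_refl)
  moreover have "0 \<le> W b z z'" by (rule W_nonneg; use Z ab less_imp_le in blast)
  ultimately have "W a z z' \<le> 0" by simp
  then show ?thesis using W_eq_0[of a z z'] ab Z by blast
qed

end

section \<open>Group actions on metric trees\<close>

lemma points_len [simp]: "points (T\<lparr>len := c\<rparr>) = points T"
  by (simp add: points_def)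

lemma point_act_len [simp]: "point_act H (T\<lparr>len := c\<rparr>) = point_act H T"
  by (simp add: point_act_def fun_eq_iff)

lemma edge_act_len [simp]: "edge_act (T\<lparr>len := c\<rparr>) = edge_act T"
  by (simp add: edge_act_def fun_eq_iff)

lemma geodesic_len [simp]: "geodesic (T\<lparr>len := c\<rparr>) = geodesic T"
  by (simp add: geodesic_def fun_eq_iff)

lemma points_eq_P:
  assumes "rooted_tree (verts T) (edges T) r"
  shows "points T = rooted_tree.P (verts T) (edges T)"
  using rooted_tree.P_def[OF assms] by (simp add: points_def)

text \<open>A \<open>gtree\<close> carries no root. Any vertex may be chosen, since the results are
  stated with \<open>pdist\<close>, where the root does not appear.\<close>

locale tree_point =
  fixes T :: "('h, 'v) gtree" and r
  assumes rt: "rooted_tree (verts T) (edges T) r"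

sublocale tree_point \<subseteq> rooted_tree "verts T" "edges T" r
  by (rule rt)

lemma (in tree_point) pdist_len:
  assumes "\<forall>e\<in>edges T. 0 < c e" and "p \<in> points T" and "q \<in> points T"
  shows "pdist (T\<lparr>len := c\<rparr>) p q = W c p q"
  using pdist_eq_W[of "T\<lparr>len := c\<rparr>" p q] assms points_eq_P[OF rt] by simp

lemma simplicial_tree_point:
  assumes "simplicial_tree (verts T) (edges T)"
  obtains r where "tree_point T r"
proof -
  obtain r where "r \<in> verts T" using assms unfolding simplicial_tree_def by blast
  then show thesis using that assms by (meson rooted_tree.intro tree_point.intro)
qed

text \<open>The weights enter only through positivity of the combined lengths, so one of them may be
  0, as at the ends of a segment and for rescaling.\<close>

lemma pdist_linear:
  assumes "simplicial_tree (verts T) (edges T)"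
    and "\<forall>e\<in>edges T. 0 < a e" and "\<forall>e\<in>edges T. 0 < b e"
    and "\<forall>e\<in>edges T. 0 < x * a e + y * b e"
    and "p \<in> points T" and "q \<in> points T"
  shows "pdist (T\<lparr>len := \<lambda>e. x * a e + y * b e\<rparr>) p q
    = x * pdist (T\<lparr>len := a\<rparr>) p q + y * pdist (T\<lparr>len := b\<rparr>) p q"
proof -
  obtain r where "tree_point T r" using assms(1) by (rule simplicial_tree_point)
  then interpret tree_point T r .
  show ?thesis using assms by (simp add: pdist_len W_linear)
qed

lemma pdist_nonneg:
  assumes "simplicial_tree (verts T) (edges T)" and "\<forall>e\<in>edges T. 0 < len T e"
  shows "0 \<le> pdist T p q"
proof (cases "p \<in> points T \<and> q \<in> points T")
  case True
  obtain r where "tree_point T r" using assms(1) by (rule simplicial_tree_point)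
  then interpret tree_point T r .
  have "0 \<le> W (len T) p q"
    using True points_eq_P[OF rt] assms(2) by (intro W_nonneg) (auto intro: less_imp_le)
  then show ?thesis using pdist_len[of "len T" p q] assms(2) True by simp
qed (auto simp: pdist_def)

lemma pdist_mono:
  assumes "simplicial_tree (verts T) (edges T)"
    and "\<forall>e\<in>edges T. 0 < a e" and "\<forall>e\<in>edges T. a e \<le> b e"
    and "p \<in> points T" and "q \<in> points T"
  shows "pdist (T\<lparr>len := a\<rparr>) p q \<le> pdist (T\<lparr>len := b\<rparr>) p q"
proof -
  obtain r where "tree_point T r" using assms(1) by (rule simplicial_tree_point)
  then interpret tree_point T r .
  have "\<forall>e\<in>edges T. 0 < b e" using assms(2,3) by (auto intro: less_le_trans)
  then show ?thesis using assms W_mono[of a b p q] points_eq_P[OF rt] by (simp add: pdist_len)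
qed

lemma metric_gtreeD:
  assumes "metric_gtree H T"
  shows "simplicial_tree (verts T) (edges T)" and "\<forall>e\<in>edges T. 0 < len T e"
    and "group_action H (verts T) (act T)"
    and "g \<in> carrier H \<Longrightarrow> e \<in> edges T \<Longrightarrow> act T g ` e \<in> edges T"
    and "g \<in> carrier H \<Longrightarrow> e \<in> edges T \<Longrightarrow> len T (act T g ` e) = len T e"
  using assms by (simp_all add: metric_gtree_def edge_act_def)

section \<open>The action on vertices, points and geodesics\<close>

locale acted_tree = group_action H "verts T" "act T"
  for H :: "'h monoid" (structure) and T :: "('h, 'v) gtree" +
  assumes tree: "simplicial_tree (verts T) (edges T)"
    and act_edge: "g \<in> carrier H \<Longrightarrow> e \<in> edges T \<Longrightarrow> act T g ` e \<in> edges T"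
begin

lemma group: "group H"
  using group_hom group_hom.axioms(1) by blast

lemma act_vert: "g \<in> carrier H \<Longrightarrow> v \<in> verts T \<Longrightarrow> act T g v \<in> verts T"
  using surj_prop by blast

lemma act_inv_act:
  assumes "g \<in> carrier H" and "v \<in> verts T"
  shows "act T (inv g) (act T g v) = v" and "act T g (act T (inv g) v) = v"
proof -
  interpret group H by (rule group)
  show "act T (inv g) (act T g v) = v"
    using orbit_sym_aux assms by blast
  show "act T g (act T (inv g) v) = v"
    using orbit_sym_aux[of "inv g" v] assms act_vert by simp
qed

lemma supp_verts: "p \<in> points T \<Longrightarrow> supp p \<subseteq> verts T"
  using simplicial_tree_edgeD[OF tree] by (fastforce simp: points_def)

lemma point_act_act:
  assumes "g \<in> carrier H" and "v \<in> verts T"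
  shows "point_act H T g p (act T g v) = p v"
  using assms by (simp add: point_act_def act_vert act_inv_act)

lemma supp_point_act:
  assumes "g \<in> carrier H" and "p \<in> points T"
  shows "supp (point_act H T g p) = act T g ` supp p"
proof
  show "act T g ` supp p \<subseteq> supp (point_act H T g p)"
    using supp_verts[OF assms(2)] point_act_act[OF assms(1)] by (auto simp: supp_def subset_iff)
  show "supp (point_act H T g p) \<subseteq> act T g ` supp p"
  proof
    fix v assume "v \<in> supp (point_act H T g p)"
    then have v: "v \<in> verts T" "act T (inv g) v \<in> supp p"
      by (auto simp: supp_def point_act_def split: if_splits)
    then show "v \<in> act T g ` supp p" using act_inv_act(2)[OF assms(1) v(1)] by (metis imageI)
  qed
qed

lemma inj_act: "g \<in> carrier H \<Longrightarrow> S \<subseteq> verts T \<Longrightarrow> inj_on (act T g) S"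
  using inj_prop inj_on_subset by blast

lemma point_act_points:
  assumes g: "g \<in> carrier H" and p: "p \<in> points T"
  shows "point_act H T g p \<in> points T"
proof -
  have s: "supp (point_act H T g p) = act T g ` supp p" by (rule supp_point_act[OF g p])
  have "(\<Sum>v\<in>supp (point_act H T g p). point_act H T g p v)
      = (\<Sum>v\<in>supp p. point_act H T g p (act T g v))"
    unfolding s by (rule sum.reindex_cong[OF inj_act[OF g supp_verts[OF p]]]) simp_all
  also have "\<dots> = (\<Sum>v\<in>supp p. p v)"
    by (rule sum.cong) (use point_act_act[OF g] supp_verts[OF p] in auto)
  also have "\<dots> = 1" using p by (simp add: points_def)
  finally have "(\<Sum>v\<in>supp (point_act H T g p). point_act H T g p v) = 1" .
  moreover have "\<forall>v. 0 \<le> point_act H T g p v" using p by (simp add: points_def point_act_def)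
  moreover have "supp (point_act H T g p) \<in> edges T \<or> (\<exists>v\<in>verts T. supp (point_act H T g p) = {v})"
  proof (cases "supp p \<in> edges T")
    case True
    then show ?thesis unfolding s using act_edge[OF g] by blast
  next
    case False
    then obtain v where "v \<in> verts T" "supp p = {v}" using p by (auto simp: points_def)
    then show ?thesis unfolding s using act_vert[OF g] by auto
  qed
  ultimately show ?thesis by (simp add: points_def)
qed

lemma geodesic_path:
  assumes "u \<in> verts T" and "w \<in> verts T"
  shows "simple_path (edges T) u (geodesic T u w) w"
  unfolding geodesic_def using tree assms
  by (metis (no_types, lifting) simplicial_tree_def theI')

lemma geodesic_eq:
  assumes "u \<in> verts T" and "w \<in> verts T" and "simple_path (edges T) u xs w"
  shows "geodesic T u w = xs"
  using simplicial_tree_unique[OF tree] geodesic_path assms by blast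

lemma geodesic_act:
  assumes g: "g \<in> carrier H" and V: "u \<in> verts T" "w \<in> verts T"
  shows "geodesic T (act T g u) (act T g w) = map (act T g) (geodesic T u w)"
proof (rule geodesic_eq)
  have "set (geodesic T u w) \<subseteq> verts T"
    using simple_path_verts[OF tree geodesic_path] V by blast
  then show "simple_path (edges T) (act T g u) (map (act T g) (geodesic T u w)) (act T g w)"
    using simple_path_map[OF geodesic_path[OF V]] inj_act[OF g] act_edge[OF g] by blast
qed (use act_vert g V in auto)

end

lemma sum_list_path_cong:
  assumes "successively (\<lambda>x y. {x, y} \<in> E) xs" and "\<And>e. e \<in> E \<Longrightarrow> c (h ` e) = c e"
  shows "(\<Sum>(x, y)\<leftarrow>zip (map h xs) (tl (map h xs)). c {x, y}) = (\<Sum>(x, y)\<leftarrow>zip xs (tl xs). c {x, y})"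
  using assms(1)
proof (induction xs rule: induct_list012)
  case (3 x y zs)
  then show ?case using assms(2)[of "{x, y}"] by simp
qed simp_all

lemma metric_gtree_acted: "metric_gtree H T \<Longrightarrow> acted_tree H T"
  using metric_gtreeD[of H T] by (simp add: acted_tree_def acted_tree_axioms_def)

text \<open>The action need not fix the root, so it is not compatible with masses. Invariance is
  therefore read off the definition of \<open>pdist\<close>, case by case.\<close>

lemma pdist_point_act:
  assumes T: "metric_gtree H T" and g: "g \<in> carrier H"
    and p: "p \<in> points T" and q: "q \<in> points T"
  shows "pdist T (point_act H T g p) (point_act H T g q) = pdist T p q"
proof -
  interpret acted_tree H T by (rule metric_gtree_acted[OF T])
  let ?h = "act T g"
  let ?p = "point_act H T g p" and ?q = "point_act H T g q"
  have sp: "supp ?p = ?h ` supp p" and sq: "supp ?q = ?h ` supp q"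
    using supp_point_act g p q by auto
  have V: "supp p \<subseteq> verts T" "supp q \<subseteq> verts T" using supp_verts p q by auto
  have val: "?p (?h v) = p v" "?q (?h v) = q v" if "v \<in> verts T" for v
    using point_act_act[OF g that] by auto
  have len: "len T (?h ` e) = len T e" if "e \<in> edges T" for e
    using metric_gtreeD(5)[OF T g that] .
  have points: "?p \<in> points T" "?q \<in> points T" using point_act_points g p q by auto
  have edge: "(\<exists>e\<in>edges T. ?h ` S \<subseteq> e) \<longleftrightarrow> (\<exists>e\<in>edges T. S \<subseteq> e)" if S: "S \<subseteq> verts T" for S
  proof
    assume "\<exists>e\<in>edges T. S \<subseteq> e"
    then show "\<exists>e\<in>edges T. ?h ` S \<subseteq> e" using act_edge[OF g] by (meson image_mono)
  next
    assume "\<exists>e\<in>edges T. ?h ` S \<subseteq> e"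
    then obtain e where e: "e \<in> edges T" "?h ` S \<subseteq> e" by blast
    have "act T (inv\<^bsub>H\<^esub> g) ` ?h ` S = S"
      using act_inv_act(1)[OF g] S by (force simp: image_image)
    then have "S \<subseteq> act T (inv\<^bsub>H\<^esub> g) ` e" using e(2) by (metis image_mono)
    moreover have "act T (inv\<^bsub>H\<^esub> g) ` e \<in> edges T"
      using act_edge[OF _ e(1)] g group group.inv_closed by metis
    ultimately show "\<exists>e\<in>edges T. S \<subseteq> e" by blast
  qed
  have un: "supp ?p \<union> supp ?q = ?h ` (supp p \<union> supp q)" using sp sq by auto
  show ?thesis
  proof (cases "\<exists>e\<in>edges T. supp p \<union> supp q \<subseteq> e")
    case True
    let ?S = "supp p \<union> supp q"
    have "\<exists>e\<in>edges T. supp ?p \<union> supp ?q \<subseteq> e" using True edge[of ?S] V un by simp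
    then have 1: "pdist T ?p ?q = len T (?h ` ?S) * (\<Sum>v\<in>?h ` ?S. \<bar>?p v - ?q v\<bar>) / 2"
      using points un by (simp only: pdist_def simp_thms if_False if_True)
    have 2: "pdist T p q = len T ?S * (\<Sum>v\<in>?S. \<bar>p v - q v\<bar>) / 2"
      using p q True by (simp only: pdist_def simp_thms if_False if_True)
    have "(\<Sum>v\<in>?h ` ?S. \<bar>?p v - ?q v\<bar>) = (\<Sum>v\<in>?S. \<bar>?p (?h v) - ?q (?h v)\<bar>)"
      by (rule sum.reindex_cong[OF inj_act[OF g]]) (use V in auto)
    also have "\<dots> = (\<Sum>v\<in>?S. \<bar>p v - q v\<bar>)"
      by (rule sum.cong) (use val V in auto)
    finally have 3: "(\<Sum>v\<in>?h ` ?S. \<bar>?p v - ?q v\<bar>) = (\<Sum>v\<in>?S. \<bar>p v - q v\<bar>)" .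
    show ?thesis
    proof (cases "?S \<in> edges T")
      case True
      then show ?thesis using 1 2 3 len by simp
    next
      case False
      \<comment> \<open>Invariance of \<open>len\<close> is known on edges only. Here the union is a
        proper part of an edge, so both points are one vertex and the sums vanish.\<close>
      have ne: "supp p \<noteq> {}" "supp q \<noteq> {}"
        using p q simplicial_tree_edgeD[OF tree] by (fastforce simp: points_def)+
      obtain a b where "?S \<subseteq> {a, b}" "{a, b} \<in> edges T"
        using True simplicial_tree_edgeD[OF tree] by metis
      then have "?S \<noteq> {a, b}" using False by metis
      then obtain v where v: "supp p = {v}" "supp q = {v}"
        using ne \<open>?S \<subseteq> {a, b}\<close> by blast
      then have "p v = 1" "q v = 1" using p q by (auto simp: points_def)
      then have "(\<Sum>v\<in>?S. \<bar>p v - q v\<bar>) = 0" using v by simp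
      then show ?thesis using 1 2 3 by simp
    qed
  next
    case False
    have nF: "\<not> (\<exists>e\<in>edges T. supp ?p \<union> supp ?q \<subseteq> e)" 
      using False edge[of "supp p \<union> supp q"] V un by simp
    have vd: "vdist T (?h u) (?h w) = vdist T u w" if "u \<in> verts T" "w \<in> verts T" for u w
      using geodesic_path[OF that] len
      by (simp add: vdist_def geodesic_act[OF g that] Let_def simple_path_def
          sum_list_path_cong[of "edges T"])
    \<comment> \<open>At a vertex \<open>len\<close> is arbitrary, but its factor is 0.\<close>
    have end_term: "(1 - x u) * len T (?h ` supp x) = (1 - x u) * len T (supp x)"
      if "x \<in> points T" "u \<in> supp x" for x u
    proof (cases "supp x \<in> edges T")
      case False
      then have "supp x = {u}" using that by (auto simp: points_def)
      then have "x u = 1" using that(1) by (simp add: points_def)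
      then show ?thesis by simp
    qed (simp add: len)
    have "{(1 - ?p u) * len T (supp ?p) + vdist T u w + (1 - ?q w) * len T (supp ?q) | u w.
            u \<in> supp ?p \<and> w \<in> supp ?q}
        = (\<lambda>(u, w). (1 - ?p (?h u)) * len T (supp ?p) + vdist T (?h u) (?h w)
            + (1 - ?q (?h w)) * len T (supp ?q)) ` (supp p \<times> supp q)"
      unfolding sp sq by auto
    also have "\<dots> = (\<lambda>(u, w). (1 - p u) * len T (supp p) + vdist T u w
            + (1 - q w) * len T (supp q)) ` (supp p \<times> supp q)"
    proof (rule image_cong[OF refl], clarify)
      fix u w assume u: "u \<in> supp p" and w: "w \<in> supp q"
      then have "u \<in> verts T" "w \<in> verts T" using V by auto
      then show "(1 - ?p (?h u)) * len T (supp ?p) + vdist T (?h u) (?h w)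
            + (1 - ?q (?h w)) * len T (supp ?q)
          = (1 - p u) * len T (supp p) + vdist T u w + (1 - q w) * len T (supp q)"
        by (simp only: sp sq val vd end_term[OF p u] end_term[OF q w])
    qed
    also have "\<dots> = {(1 - p u) * len T (supp p) + vdist T u w + (1 - q w) * len T (supp q) | u w.
            u \<in> supp p \<and> w \<in> supp q}" by auto
    finally show ?thesis
      using points p q nF False by (simp only: pdist_def simp_thms if_False if_True)
  qed
qed

text \<open>The group preserves both metrics, so the translate of a barycentre is a barycentre of
  the translated pair; uniqueness turns this into equivariance.\<close>

lemma barycentre_map:
  assumes Ta: "metric_gtree H (T\<lparr>len := a\<rparr>)" and Tb: "metric_gtree H (T\<lparr>len := b\<rparr>)"
  shows "\<exists>m. (\<forall>x\<in>points T. \<forall>y\<in>points T. m x y \<in> points T) \<and>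
    (\<forall>g\<in>carrier H. \<forall>x\<in>points T. \<forall>y\<in>points T.
       m (point_act H T g x) (point_act H T g y) = point_act H T g (m x y)) \<and>
    (\<forall>x\<in>points T. \<forall>y\<in>points T. \<forall>x'\<in>points T. \<forall>y'\<in>points T.
       pdist (T\<lparr>len := \<lambda>e. a e + b e\<rparr>) (m x y) (m x' y')
       \<le> pdist (T\<lparr>len := a\<rparr>) x x' + pdist (T\<lparr>len := b\<rparr>) y y')"
proof -
  have simp: "simplicial_tree (verts T) (edges T)" and a: "\<forall>e\<in>edges T. 0 < a e"
    and b: "\<forall>e\<in>edges T. 0 < b e"
    using metric_gtreeD[OF Ta] metric_gtreeD[OF Tb] by simp_all
  have ab: "\<forall>e\<in>edges T. 0 < a e + b e" using a b by (simp add: add_pos_pos)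
  obtain r where "tree_point T r" using simp by (rule simplicial_tree_point)
  then interpret tree_point T r .
  interpret A: acted_tree H "T\<lparr>len := a\<rparr>" by (rule metric_gtree_acted[OF Ta])
  note PP = points_eq_P[OF rt]
  define m where "m x y = (SOME z. is_bary a b x y z)" for x y
  have m: "is_bary a b x y (m x y)" if "x \<in> points T" "y \<in> points T" for x y
    using bary_exists[OF a b, of x y] that PP unfolding m_def by (metis someI_ex)
  have mP: "m x y \<in> points T" if "x \<in> points T" "y \<in> points T" for x y
    using m[OF that] PP by (simp add: is_bary_def)
  show ?thesis
  proof (intro exI[of _ m] conjI ballI)
    show "m x y \<in> points T" if "x \<in> points T" "y \<in> points T" for x y
      by (rule mP[OF that])
  next
    fix x y x' y' assume *: "x \<in> points T" "y \<in> points T" "x' \<in> points T" "y' \<in> points T"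
    have "W a (m x y) (m x' y') + W b (m x y) (m x' y') \<le> W a x x' + W b y y'"
      using bary_lipschitz[OF a b _ _ _ _ m m] * PP by simp
    then show "pdist (T\<lparr>len := \<lambda>e. a e + b e\<rparr>) (m x y) (m x' y')
       \<le> pdist (T\<lparr>len := a\<rparr>) x x' + pdist (T\<lparr>len := b\<rparr>) y y'"
      using * mP W_linear[of 1 a 1 b] by (simp add: pdist_len a b ab)
  next
    fix g x y assume g: "g \<in> carrier H" and xy: "x \<in> points T" "y \<in> points T"
    let ?z = "m x y"
    have z: "?z \<in> points T" by (rule mP[OF xy])
    have act: "point_act H T g p \<in> points T" if "p \<in> points T" for p
      using A.point_act_points[OF g] that by simp
    have Wa: "W a (point_act H T g p) (point_act H T g q) = W a p q"
      if "p \<in> points T" "q \<in> points T" for p q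
      using pdist_point_act[OF Ta g, of p q] that act by (simp add: pdist_len a)
    have Wb: "W b (point_act H T g p) (point_act H T g q) = W b p q"
      if "p \<in> points T" "q \<in> points T" for p q
      using pdist_point_act[OF Tb g, of p q] that act by (simp add: pdist_len b)
    have "btw x ?z y" "W a x ?z = W b ?z y" using m[OF xy] by (auto simp: is_bary_def)
    \<comment> \<open>Betweenness refers to the root through the masses. Equality in the triangle
      inequality is an equivalent form that the action visibly preserves.\<close>
    then have "W a x y = W a x ?z + W a ?z y" using btw_W PP xy z by blast
    then have "btw (point_act H T g x) (point_act H T g ?z) (point_act H T g y)"
      using a act xy z PP Wa by (intro W_btw[of a]) auto
    then have "is_bary a b (point_act H T g x) (point_act H T g y) (point_act H T g ?z)"
      using \<open>W a x ?z = W b ?z y\<close> Wa Wb xy z act PP by (simp add: is_bary_def)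
    then show "m (point_act H T g x) (point_act H T g y) = point_act H T g ?z"
      using bary_unique[OF a b _ _ m] act xy PP by metis
  qed
qed

section \<open>Finiteness of the set of edge orbits\<close>

lemma gpath_source: "graph_of_groups G \<Longrightarrow> gpath G u p v \<Longrightarrow> u \<in> gverts G"
  by (induction G u p v rule: gpath.induct) (auto simp: graph_of_groups_def)

lemma gpath_target: "graph_of_groups G \<Longrightarrow> gpath G u p v \<Longrightarrow> v \<in> gverts G"
  by (induction G u p v rule: gpath.induct) auto

lemma gpath_append:
  assumes "graph_of_groups G"
  shows "gpath G u (p @ q) w \<longleftrightarrow> (\<exists>v. gpath G u p v \<and> gpath G v q w)"
proof (induction p arbitrary: u)
  case Nil
  then show ?case using gpath_source[OF assms] by auto
next
  case (Cons l p)
  then show ?case by (cases l) auto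
qed

lemma graph_of_groups_edge:
  assumes "graph_of_groups G" and "e \<in> gedges G"
  shows "esrc G e \<in> gverts G" and "etgt G e \<in> gverts G" and "erev G e \<in> gedges G"
    and "erev G (erev G e) = e" and "esrc G (erev G e) = etgt G e" and "etgt G (erev G e) = esrc G e"
  using assms by (auto simp: graph_of_groups_def)

lemma graph_of_groups_group: "graph_of_groups G \<Longrightarrow> v \<in> gverts G \<Longrightarrow> group (vgroup G v)"
  by (simp add: graph_of_groups_def)

lemma inv_path_Cons: "inv_path G (l # p) = inv_path G p @ [inv_letter G l]"
  by (simp add: inv_path_def)

lemma gpath_inv_path:
  assumes "graph_of_groups G" and "gpath G u p v"
  shows "gpath G v (inv_path G p) u"
  using assms(2)
proof (induction p arbitrary: u)
  case Nil
  then show ?case by (auto simp: inv_path_def)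
next
  case (Cons l p)
  show ?case
  proof (cases l)
    case (VLetter x g)
    then have "gpath G v (inv_path G p) u" "u \<in> gverts G" "g \<in> carrier (vgroup G u)" "x = u"
      using Cons by auto
    then show ?thesis
      using VLetter graph_of_groups_group[OF assms(1)]
      by (auto simp: inv_path_Cons gpath_append[OF assms(1)] intro!: group.inv_closed)
  next
    case (ELetter e)
    then have "gpath G v (inv_path G p) (etgt G e)" "e \<in> gedges G" "esrc G e = u"
      using Cons by auto
    then show ?thesis
      using ELetter graph_of_groups_edge[OF assms(1)]
      by (auto simp: inv_path_Cons gpath_append[OF assms(1)])
  qed
qed

abbreviation gloop :: "('x, 'e, 'g) gog \<Rightarrow> ('x, 'e, 'g) letter list \<Rightarrow> bool" where
  "gloop G p \<equiv> gpath G (gbase G) p (gbase G)"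

definition loop_eq ::
  "('x, 'e, 'g) gog \<Rightarrow> ('x, 'e, 'g) letter list \<Rightarrow> ('x, 'e, 'g) letter list \<Rightarrow> bool" where
  "loop_eq G = equivclp (\<lambda>a b. gloop G a \<and> gloop G b \<and> elem_step G a b)"

lemma loop_class_alt: "loop_class G p = {q. gloop G q \<and> loop_eq G p q}"
  by (simp add: loop_class_def loop_eq_def)

lemma loop_eq_refl: "loop_eq G p p"
  by (simp add: loop_eq_def)

lemma loop_eq_sym: "loop_eq G p q \<Longrightarrow> loop_eq G q p"
  unfolding loop_eq_def by (rule equivclp_sym)

lemma loop_eq_trans: "loop_eq G p q \<Longrightarrow> loop_eq G q s \<Longrightarrow> loop_eq G p s"
  unfolding loop_eq_def by (rule equivclp_trans)

lemma loop_class_cong: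
  assumes "loop_eq G p q"
  shows "loop_class G p = loop_class G q"
proof -
  have "loop_eq G p s \<longleftrightarrow> loop_eq G q s" for s
    using assms loop_eq_sym loop_eq_trans by metis
  then show ?thesis by (simp add: loop_class_alt)
qed

lemma elem_step_context: "elem_step G a b \<Longrightarrow> elem_step G (x @ a @ y) (x @ b @ y)"
proof (induction rule: elem_step.cases)
  case (mult_step p v g h q)
  then show ?case using elem_step.mult_step[of G "x @ p" v g h "q @ y"] by simp
next
  case (one_step p v q)
  then show ?case using elem_step.one_step[of G "x @ p" v "q @ y"] by simp
next
  case (backtrack_step p e q)
  then show ?case using elem_step.backtrack_step[of G "x @ p" e "q @ y"] by simp
qed

lemma loop_eq_step:
  assumes "gloop G (x @ a @ y)" and "gloop G (x @ b @ y)" and "elem_step G a b"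
  shows "loop_eq G (x @ a @ y) (x @ b @ y)"
  using assms elem_step_context unfolding loop_eq_def by (intro r_into_equivclp) blast

text \<open>The context is assumed to turn loops into loops, so that all intermediate words of a
  chain of steps remain loops.\<close>

lemma loop_eq_context:
  assumes "loop_eq G a b" and "\<And>p. gloop G p \<Longrightarrow> gloop G (x @ p @ y)"
  shows "loop_eq G (x @ a @ y) (x @ b @ y)"
  using assms(1) unfolding loop_eq_def
proof (induction rule: equivclp_induct)
  case (step b c)
  then have "loop_eq G (x @ b @ y) (x @ c @ y)"
    using assms(2) loop_eq_step loop_eq_sym by blast
  then show ?case using step(3) unfolding loop_eq_def by (blast intro: equivclp_trans)
qed simp

text \<open>The product is a union over all pairs of representatives. Each pair contributes the same
  class, and \<open>a\<close>, \<open>b\<close> are such a pair.\<close>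

lemma pi1_mult:
  assumes "graph_of_groups G" and "gloop G a" and "gloop G b"
  shows "loop_class G a \<otimes>\<^bsub>pi1 G\<^esub> loop_class G b = loop_class G (a @ b)"
proof -
  have "loop_class G (a' @ b') = loop_class G (a @ b)"
    if "a' \<in> loop_class G a" "b' \<in> loop_class G b" for a' b'
  proof -
    have "loop_eq G ([] @ a @ b) ([] @ a' @ b)"
      using that assms(3) by (intro loop_eq_context) (auto simp: loop_class_alt gpath_append[OF assms(1)])
    moreover have "loop_eq G (a' @ b @ []) (a' @ b' @ [])"
      using that assms(1) by (intro loop_eq_context) (auto simp: loop_class_alt gpath_append[OF assms(1)])
    ultimately have "loop_eq G (a @ b) (a' @ b')" using loop_eq_trans by fastforce
    then show ?thesis using loop_class_cong by metis
  qed
  moreover have "a \<in> loop_class G a" "b \<in> loop_class G b"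
    using assms by (auto simp: loop_class_alt loop_eq_refl)
  ultimately have "(\<Union>a'\<in>loop_class G a. \<Union>b'\<in>loop_class G b. loop_class G (a' @ b'))
      = loop_class G (a @ b)" by blast
  then show ?thesis by (simp add: pi1_def)
qed

lemma pi1_carrier: "g \<in> carrier (pi1 G) \<longleftrightarrow> (\<exists>p. gloop G p \<and> g = loop_class G p)"
  by (auto simp: pi1_def)

text \<open>The inverse of the first letter of \<open>q\<close> comes last in
  \<open>inv_path G q\<close>. The two meet in the middle and cancel, which leaves a shorter word of
  the same shape.\<close>

lemma loop_eq_cancel:
  assumes G: "graph_of_groups G" and "gpath G u q v" and "gpath G (gbase G) x v"
    and "gpath G v y (gbase G)"
  shows "loop_eq G (x @ inv_path G q @ q @ y) (x @ y)"
  using assms(2)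
proof (induction q arbitrary: u)
  case Nil
  then show ?case by (simp add: inv_path_def loop_eq_refl)
next
  case (Cons l q)
  note app = gpath_append[OF G]
  show ?case
  proof (cases l)
    case (VLetter z g)
    then have q: "gpath G u q v" "u \<in> gverts G" "g \<in> carrier (vgroup G u)" "z = u"
      using Cons by auto
    interpret V: group "vgroup G u" by (rule graph_of_groups_group[OF G q(2)])
    let ?x = "x @ inv_path G q" and ?y = "q @ y"
    have xy: "gpath G (gbase G) ?x u" "gpath G u ?y (gbase G)"
      using app assms(3,4) q(1) gpath_inv_path[OF G q(1)] by blast+
    have l: "gloop G (?x @ [VLetter u h] @ ?y)" if "h \<in> carrier (vgroup G u)" for h
      using app xy q(2) that by auto
    have "loop_eq G (?x @ [VLetter u (inv\<^bsub>vgroup G u\<^esub> g), VLetter u g] @ ?y)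
        (?x @ [VLetter u (inv\<^bsub>vgroup G u\<^esub> g \<otimes>\<^bsub>vgroup G u\<^esub> g)] @ ?y)"
      using app xy q(2,3) elem_step.mult_step[of G "[]" u "inv\<^bsub>vgroup G u\<^esub> g" g "[]"] l
      by (intro loop_eq_step) auto
    moreover have "gloop G (?x @ ?y)" using app xy by blast
    then have "loop_eq G (?x @ [VLetter u \<one>\<^bsub>vgroup G u\<^esub>] @ ?y) (?x @ [] @ ?y)"
      using l[OF V.one_closed] elem_step.one_step[of G "[]" u "[]"] by (intro loop_eq_step) simp_all
    ultimately have "loop_eq G (?x @ [VLetter u (inv\<^bsub>vgroup G u\<^esub> g), VLetter u g] @ ?y) (?x @ ?y)"
      using loop_eq_trans q(3) by fastforce
    then show ?thesis
      using loop_eq_trans Cons.IH[OF q(1)] VLetter q(4) by (fastforce simp: inv_path_Cons)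
  next
    case (ELetter e)
    then have q: "gpath G (etgt G e) q v" "e \<in> gedges G" "u = esrc G e"
      using Cons by auto
    note e = graph_of_groups_edge[OF G q(2)]
    let ?x = "x @ inv_path G q" and ?y = "q @ y"
    have xy: "gpath G (gbase G) ?x (etgt G e)" "gpath G (etgt G e) ?y (gbase G)"
      using app assms(3,4) q(1) gpath_inv_path[OF G q(1)] by blast+
    have "loop_eq G (?x @ [ELetter (erev G e), ELetter e] @ ?y) (?x @ [] @ ?y)"
    proof (rule loop_eq_step)
      have "gpath G (etgt G e) ([ELetter (erev G e), ELetter e] @ ?y) (gbase G)"
        using xy(2) e q(2) by simp
      then show "gloop G (?x @ [ELetter (erev G e), ELetter e] @ ?y)" using app xy(1) by blast
      have "gloop G (?x @ ?y)" using app xy by blast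
      then show "gloop G (?x @ [] @ ?y)" by simp
      show "elem_step G [ELetter (erev G e), ELetter e] []"
        using elem_step.backtrack_step[of G "[]" "erev G e" "[]"] e by simp
    qed
    then show ?thesis
      using loop_eq_trans Cons.IH[OF q(1)] ELetter by (fastforce simp: inv_path_Cons)
  qed
qed

text \<open>Inserting \<open>inv_path G (pt u) @ pt u\<close> at each vertex \<open>u\<close> that a
  loop visits breaks it into the listed elements. Products suffice, as the list contains reversed
  edges and whole vertex groups. The loop \<open>pt (gbase G)\<close> may be nontrivial, which
  accounts for the two base elements.\<close>

lemma pi1_generated:
  assumes G: "graph_of_groups G"
    and pt: "\<And>v. v \<in> gverts G \<Longrightarrow> gpath G (gbase G) (pt v) v"
    and mult: "\<And>g h. g \<in> carrier (pi1 G) \<Longrightarrow> h \<in> carrier (pi1 G) \<Longrightarrow> S g \<Longrightarrow> S h \<Longrightarrow>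
      S (g \<otimes>\<^bsub>pi1 G\<^esub> h)"
    and vert: "\<And>v g. v \<in> nontrivial_verts G \<Longrightarrow> g \<in> carrier (vgroup G v) \<Longrightarrow>
      S (loop_class G (pt v @ [VLetter v g] @ inv_path G (pt v)))"
    and edge: "\<And>e. e \<in> gedges G \<Longrightarrow>
      S (loop_class G (pt (esrc G e) @ [ELetter e] @ inv_path G (pt (etgt G e))))"
    and base: "S (loop_class G (pt (gbase G)))" "S (loop_class G (inv_path G (pt (gbase G))))"
    and g: "g \<in> carrier (pi1 G)"
  shows "S g"
proof -
  note app = gpath_append[OF G]
  have mult': "S (loop_class G (a @ b))"
    if "gloop G a" "gloop G b" "S (loop_class G a)" "S (loop_class G b)" for a b
    using mult[of "loop_class G a" "loop_class G b"] pi1_mult[OF G that(1,2)] that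
    by (auto simp: pi1_carrier)
  have inv: "gpath G v (inv_path G (pt v)) (gbase G)" if "v \<in> gverts G" for v
    using gpath_inv_path[OF G pt[OF that]] .
  \<comment> \<open>Partial paths are closed up along the chosen path to their end, so that the
    induction can proceed letter by letter.\<close>
  have claim: "S (loop_class G (p @ inv_path G (pt v)))" if "gpath G (gbase G) p v" for p v
    using that
  proof (induction p arbitrary: v rule: rev_induct)
    case Nil
    then show ?case using base by simp
  next
    case (snoc l p)
    obtain u where u: "gpath G (gbase G) p u" "gpath G u [l] v" using snoc.prems app by blast
    have V: "u \<in> gverts G" "v \<in> gverts G" using gpath_target[OF G] u by auto
    have IH: "S (loop_class G (p @ inv_path G (pt u)))" by (rule snoc.IH[OF u(1)])
    have l1: "gloop G (p @ inv_path G (pt u))" using app u(1) inv[OF V(1)] by blast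
    have y: "gpath G u ([l] @ inv_path G (pt v)) (gbase G)" using app u(2) inv[OF V(2)] by blast
    then have l2: "gloop G (pt u @ [l] @ inv_path G (pt v))" using app pt[OF V(1)] by blast
    have "loop_eq G (p @ inv_path G (pt u) @ pt u @ ([l] @ inv_path G (pt v)))
        (p @ ([l] @ inv_path G (pt v)))"
      by (rule loop_eq_cancel[OF G pt[OF V(1)] u(1) y])
    then have eq: "loop_class G ((p @ inv_path G (pt u)) @ (pt u @ [l] @ inv_path G (pt v)))
        = loop_class G ((p @ [l]) @ inv_path G (pt v))"
      using loop_class_cong by fastforce
    show ?case
    proof (cases l)
      case (VLetter x g)
      then have x: "x = u" "v = u" "g \<in> carrier (vgroup G u)" using u(2) by auto
      show ?thesis
      proof (cases "u \<in> nontrivial_verts G")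
        case True
        then have "S (loop_class G (pt u @ [l] @ inv_path G (pt v)))" using vert VLetter x by simp
        then show ?thesis using mult'[OF l1 l2 IH] eq by simp
      next
        case False
        then have one: "g = \<one>\<^bsub>vgroup G u\<^esub>" using x V(1) by (auto simp: nontrivial_verts_def)
        have "gloop G (p @ [l] @ inv_path G (pt v))" using app u(1) y by blast
        then have "loop_eq G (p @ [l] @ inv_path G (pt v)) (p @ [] @ inv_path G (pt v))"
          using elem_step.one_step[of G "[]" u "[]"] one VLetter x l1 by (intro loop_eq_step) auto
        then show ?thesis using loop_class_cong IH x by fastforce
      qed
    next
      case (ELetter e)
      then have "S (loop_class G (pt u @ [l] @ inv_path G (pt v)))" using u(2) edge[of e] by auto
      then show ?thesis using mult'[OF l1 l2 IH] eq by simp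
    qed
  qed
  obtain p where p: "gloop G p" "g = loop_class G p" using g pi1_carrier by metis
  have B: "gbase G \<in> gverts G" by (rule gpath_source[OF G p(1)])
  have "loop_eq G (p @ inv_path G (pt (gbase G)) @ pt (gbase G) @ []) (p @ [])"
    using B by (intro loop_eq_cancel[OF G pt[OF B] p(1)]) simp
  then have "g = loop_class G ((p @ inv_path G (pt (gbase G))) @ pt (gbase G))"
    using loop_class_cong p(2) by fastforce
  then show ?thesis using mult'[OF _ _ claim[OF p(1)] base(1)] app p(1) inv[OF B] pt[OF B] by metis
qed

section \<open>Cofiniteness of the action on edges\<close>

definition adj :: "'v set set \<Rightarrow> ('v \<times> 'v) set" where
  "adj E = {(x, y). {x, y} \<in> E}"

lemma adj_rtrancl_sym: "(x, y) \<in> (adj E)\<^sup>* \<Longrightarrow> (y, x) \<in> (adj E)\<^sup>*"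
  using sym_rtrancl[of "adj E"] by (metis (mono_tags, lifting) adj_def case_prodD case_prodI insert_commute mem_Collect_eq symD symI)

text \<open>If the next vertex is already on the path, the path is cut off there; otherwise it is
  extended.\<close>

lemma adj_simple_path:
  assumes "(x, y) \<in> (adj E)\<^sup>*"
  shows "\<exists>xs. simple_path E x xs y"
  using assms
proof (induction rule: rtrancl_induct)
  case base
  then show ?case by (intro exI[of _ "[x]"] simple_path_refl)
next
  case (step y z)
  then obtain xs where xs: "simple_path E x xs y" by blast
  have e: "{y, z} \<in> E" using step(2) by (simp add: adj_def)
  show ?case
  proof (cases "z \<in> set xs")
    case True
    then obtain ys zs where "xs = ys @ z # zs" by (auto dest: split_list)
    then show ?thesis using simple_path_prefix xs by metis
  next
    case False
    then show ?thesis using simple_path_snoc[OF xs e] by blast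
  qed
qed

text \<open>Restricting to edges inside \<open>set xs\<close> keeps the collection finite.\<close>

lemma simple_path_adj:
  assumes "simple_path E x xs y"
  shows "(x, y) \<in> (adj {e \<in> E. e \<subseteq> set xs})\<^sup>*"
proof -
  have "successively (\<lambda>x y. {x, y} \<in> E) xs \<Longrightarrow> xs \<noteq> [] \<Longrightarrow> set xs \<subseteq> A \<Longrightarrow>
      (hd xs, last xs) \<in> (adj {e \<in> E. e \<subseteq> A})\<^sup>*" for A
  proof (induction xs rule: induct_list012)
    case (3 a b zs)
    then have "(b, last (b # zs)) \<in> (adj {e \<in> E. e \<subseteq> A})\<^sup>*" by simp
    moreover have "(a, b) \<in> adj {e \<in> E. e \<subseteq> A}" using 3 by (simp add: adj_def)
    ultimately show ?case by (simp add: converse_rtrancl_into_rtrancl)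
  qed auto
  then show ?thesis using assms unfolding simple_path_def by blast
qed

lemma adj_mono: "E \<subseteq> E' \<Longrightarrow> (x, y) \<in> (adj E)\<^sup>* \<Longrightarrow> (x, y) \<in> (adj E')\<^sup>*"
  by (rule subsetD[OF rtrancl_mono]) (auto simp: adj_def)

context acted_tree
begin

lemma edge_verts: "e \<in> edges T \<Longrightarrow> e \<subseteq> verts T"
  using simplicial_tree_edgeD[OF tree] by fastforce

lemma act_mult_image:
  assumes "g \<in> carrier H" and "h \<in> carrier H" and "S \<subseteq> verts T"
  shows "act T g ` act T h ` S = act T (g \<otimes> h) ` S"
  using assms composition_rule by (force simp: image_image intro!: image_cong)

lemma edge_orbit_act:
  assumes g: "g \<in> carrier H" and e: "e \<in> edges T"
  shows "edge_orbit H T (act T g ` e) = edge_orbit H T e"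
proof -
  interpret group H by (rule group)
  have 1: "act T h ` act T g ` e = act T (h \<otimes> g) ` e" if "h \<in> carrier H" for h
    using act_mult_image[OF that g edge_verts[OF e]] .
  show ?thesis
  proof
    show "edge_orbit H T (act T g ` e) \<subseteq> edge_orbit H T e"
      using 1 m_closed[OF _ g] by (fastforce simp: edge_orbit_def orbit_def edge_act_def)
    show "edge_orbit H T e \<subseteq> edge_orbit H T (act T g ` e)"
    proof
      fix x assume "x \<in> edge_orbit H T e"
      then obtain h where h: "h \<in> carrier H" "x = act T h ` e"
        by (auto simp: edge_orbit_def orbit_def edge_act_def)
      have "x = act T (h \<otimes> inv g) ` act T g ` e"
        using 1[of "h \<otimes> inv g"] h g by (simp add: m_assoc)
      then show "x \<in> edge_orbit H T (act T g ` e)"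
        using h g by (auto simp: edge_orbit_def orbit_def edge_act_def)
    qed
  qed
qed

definition translates :: "'v set set \<Rightarrow> 'v set set" where
  "translates F = {act T g ` e | g e. g \<in> carrier H \<and> e \<in> F}"

lemma translates_edges: "F \<subseteq> edges T \<Longrightarrow> translates F \<subseteq> edges T"
  using act_edge by (auto simp: translates_def)

lemma translates_act:
  assumes "F \<subseteq> edges T" and "(x, y) \<in> (adj (translates F))\<^sup>*" and g: "g \<in> carrier H"
  shows "(act T g x, act T g y) \<in> (adj (translates F))\<^sup>*"
  using assms(2)
proof (induction rule: rtrancl_induct)
  case (step y z)
  then obtain h e where h: "h \<in> carrier H" "e \<in> F" "{y, z} = act T h ` e"
    by (auto simp: adj_def translates_def)
  interpret group H by (rule group)
  have "{act T g y, act T g z} = act T g ` act T h ` e" unfolding h(3)[symmetric] by simp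
  also have "\<dots> = act T (g \<otimes> h) ` e"
    using h(2) assms(1) by (intro act_mult_image[OF g h(1)] edge_verts) blast
  finally have "(act T g y, act T g z) \<in> adj (translates F)"
    using h g by (auto simp: adj_def translates_def)
  then show ?case using step(3) by simp
qed simp

lemma subset_translates:
  assumes "F \<subseteq> edges T"
  shows "F \<subseteq> translates F"
proof
  fix e assume e: "e \<in> F"
  interpret group H by (rule group)
  have "e \<subseteq> verts T" using edge_verts e assms by blast
  then have "act T \<one> ` e = id ` e"
    by (intro image_cong[OF refl]) (auto simp: id_eq_one[symmetric])
  then have "e = act T \<one> ` e" by simp
  then show "e \<in> translates F" unfolding translates_def using e by blast
qed

text \<open>The vertices joined to \<open>x0\<close> inside the translates of \<open>F\<close> form
  an invariant convex set, which is everything by minimality. The ends of any edge are then joined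
  inside the translates, and in a tree this forces the edge itself to be a translate.\<close>

lemma finite_edge_orbits_criterion:
  assumes min: "minimal_gtree H T" and F: "finite F" "F \<subseteq> edges T" and x0: "x0 \<in> verts T"
    and J: "\<And>g. g \<in> carrier H \<Longrightarrow> (x0, act T g x0) \<in> (adj (translates F))\<^sup>*"
  shows "finite (edge_orbit H T ` edges T)"
proof -
  let ?R = "(adj (translates F))\<^sup>*"
  define U where "U = {v \<in> verts T. (x0, v) \<in> ?R}"
  have path: "simple_path (translates F) u (geodesic T u v) v"
    if uv: "u \<in> verts T" "v \<in> verts T" "(u, v) \<in> ?R" for u v
  proof -
    obtain xs where xs: "simple_path (translates F) u xs v" using adj_simple_path[OF uv(3)] by blast
    have "geodesic T u v = xs"
      by (rule geodesic_eq[OF uv(1,2) simple_path_mono[OF xs translates_edges[OF F(2)]]])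
    then show ?thesis using xs by simp
  qed
  have "U = verts T"
  proof -
    have "U \<subseteq> verts T" "U \<noteq> {}" using x0 by (auto simp: U_def)
    moreover have "set (geodesic T u v) \<subseteq> U" if u: "u \<in> U" and v: "v \<in> U" for u v
    proof
      fix w assume w: "w \<in> set (geodesic T u v)"
      have V: "u \<in> verts T" "v \<in> verts T" using u v by (auto simp: U_def)
      have "(u, x0) \<in> ?R" "(x0, v) \<in> ?R" using u v adj_rtrancl_sym by (auto simp: U_def)
      then have "(u, v) \<in> ?R" by (rule rtrancl_trans)
      then have p: "simple_path (translates F) u (geodesic T u v) v" by (rule path[OF V])
      obtain ys zs where "geodesic T u v = ys @ w # zs" using w by (auto dest: split_list)
      then have "simple_path (translates F) u (ys @ [w]) w" using simple_path_prefix p by metis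
      then have "(u, w) \<in> ?R" by (intro adj_mono[OF _ simple_path_adj]) auto
      moreover have "w \<in> verts T"
        using simple_path_verts[OF tree geodesic_path[OF V] V(1)] w by blast
      ultimately show "w \<in> U" using u rtrancl_trans[of x0 u _ w] by (simp add: U_def)
    qed
    moreover have "act T g u \<in> U" if g: "g \<in> carrier H" and u: "u \<in> U" for g u
    proof -
      have "u \<in> verts T" "(x0, u) \<in> ?R" using u by (auto simp: U_def)
      then have "act T g u \<in> verts T" "(act T g x0, act T g u) \<in> ?R"
        using act_vert[OF g] translates_act[OF F(2) _ g] by auto
      then show ?thesis using rtrancl_trans[OF J[OF g]] by (simp add: U_def)
    qed
    ultimately show ?thesis using min[unfolded minimal_gtree_def, rule_format, of U] by blast
  qed
  have "edges T \<subseteq> translates F"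
  proof
    fix e assume e: "e \<in> edges T"
    then obtain u v where uv: "u \<in> verts T" "v \<in> verts T" "u \<noteq> v" "e = {u, v}"
      using simplicial_tree_edgeD[OF tree] by metis
    then have "(x0, u) \<in> ?R" "(x0, v) \<in> ?R" using \<open>U = verts T\<close> by (auto simp: U_def)
    then have "(u, v) \<in> ?R" by (rule rtrancl_trans[OF adj_rtrancl_sym])
    then have "simple_path (translates F) u (geodesic T u v) v" by (rule path[OF uv(1,2)])
    moreover have "geodesic T u v = [u, v]"
      using uv e by (intro geodesic_eq simple_path_edge) auto
    ultimately show "e \<in> translates F" using uv(4) by (simp add: simple_path_def)
  qed
  then have "edge_orbit H T ` edges T \<subseteq> edge_orbit H T ` F"
    using edge_orbit_act F(2) by (fastforce simp: translates_def)
  then show ?thesis using F(1) finite_surj finite_subset by blast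
qed

lemma finite_connecting_edges:
  assumes "finite Q" and "Q \<subseteq> verts T \<times> verts T"
  obtains F where "finite F" and "F \<subseteq> edges T" and "Q \<subseteq> (adj F)\<^sup>*"
proof
  let ?F = "\<Union>(x, y)\<in>Q. {e \<in> edges T. e \<subseteq> set (geodesic T x y)}"
  show "finite ?F" using assms(1) by auto
  show "?F \<subseteq> edges T" by auto
  show "Q \<subseteq> (adj ?F)\<^sup>*"
  proof clarify
    fix x y assume xy: "(x, y) \<in> Q"
    then have "x \<in> verts T" "y \<in> verts T" using assms(2) by auto
    then have "(x, y) \<in> (adj {e \<in> edges T. e \<subseteq> set (geodesic T x y)})\<^sup>*"
      by (rule simple_path_adj[OF geodesic_path])
    then show "(x, y) \<in> (adj ?F)\<^sup>*" by (rule adj_mono[rotated]) (use xy in auto)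
  qed
qed

end

text \<open>Vertex groups are arbitrary, so \<open>pi1 G\<close> need not be finitely generated.
  Each nontrivial one, however, fixes a vertex \<open>y v\<close>: one path from \<open>x0\<close>
  to \<open>y v\<close> and its translates connect \<open>x0\<close> to its images under the whole
  vertex group. Finitely many further elements come from the edges and the base.\<close>

lemma finite_edge_orbits:
  assumes G: "graph_of_groups G" and T: "outer_tree G T"
  shows "finite (edge_orbit (pi1 G) T ` edges T)"
proof -
  have metric: "metric_gtree (pi1 G) T" and minimal: "minimal_gtree (pi1 G) T"
    using T by (auto simp: outer_tree_def)
  interpret acted_tree "pi1 G" T by (rule metric_gtree_acted[OF metric])
  interpret H: group "pi1 G" by (rule group)
  \<comment> \<open>The path is chosen together with the fixed vertex: a stabiliser is one
    particular conjugate of the vertex group, and \<open>p\<close> is a path that yields it.\<close>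
  have "\<exists>p y. gpath G (gbase G) p v \<and> y \<in> verts T \<and> (v \<in> nontrivial_verts G \<longrightarrow>
      (\<forall>g\<in>carrier (vgroup G v). act T (loop_class G (p @ [VLetter v g] @ inv_path G p)) y = y))"
    if v: "v \<in> gverts G" for v
  proof (cases "v \<in> nontrivial_verts G")
    case True
    then obtain x where x: "x \<in> verts T"
      "{y \<in> verts T. stabilizer (pi1 G) (act T) y \<in> vertex_subgroups G v} = orbit (pi1 G) (act T) x"
      using T by (auto simp: outer_tree_def)
    have "x \<in> orbit (pi1 G) (act T) x"
      using orbit_refl x(1) by blast
    then have "stabilizer (pi1 G) (act T) x \<in> vertex_subgroups G v" using x(2) by blast
    then obtain p where p: "gpath G (gbase G) p v" "stabilizer (pi1 G) (act T) x
        = {loop_class G (p @ [VLetter v g] @ inv_path G p) | g. g \<in> carrier (vgroup G v)}"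
      unfolding vertex_subgroups_def by blast
    have "act T (loop_class G (p @ [VLetter v g] @ inv_path G p)) x = x"
      if "g \<in> carrier (vgroup G v)" for g
    proof -
      have "loop_class G (p @ [VLetter v g] @ inv_path G p) \<in> stabilizer (pi1 G) (act T) x"
        using p(2) that by blast
      then show ?thesis by (simp add: stabilizer_def)
    qed
    then show ?thesis using p(1) x(1) by blast
  next
    case False
    obtain y where "y \<in> verts T" using tree unfolding simplicial_tree_def by blast
    moreover obtain p where "gpath G (gbase G) p v" using G v unfolding graph_of_groups_def by blast
    ultimately show ?thesis using False by blast
  qed
  then obtain pt y where pt: "\<And>v. v \<in> gverts G \<Longrightarrow> gpath G (gbase G) (pt v) v"
    and y: "\<And>v. v \<in> gverts G \<Longrightarrow> y v \<in> verts T"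
    and fix_y: "\<And>v g. v \<in> gverts G \<Longrightarrow> v \<in> nontrivial_verts G \<Longrightarrow> g \<in> carrier (vgroup G v) \<Longrightarrow>
      act T (loop_class G (pt v @ [VLetter v g] @ inv_path G (pt v))) (y v) = y v"
    by metis
  obtain x0 where x0: "x0 \<in> verts T" using tree unfolding simplicial_tree_def by blast
  have base: "gbase G \<in> gverts G" using G by (simp add: graph_of_groups_def)
  note app = gpath_append[OF G]
  have inv: "gpath G v (inv_path G (pt v)) (gbase G)" if "v \<in> gverts G" for v
    using gpath_inv_path[OF G pt[OF that]] .
  define edge_el where
    "edge_el e = loop_class G (pt (esrc G e) @ [ELetter e] @ inv_path G (pt (etgt G e)))" for e
  define S0 where "S0 = {loop_class G (pt (gbase G)), loop_class G (inv_path G (pt (gbase G)))}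
    \<union> edge_el ` gedges G"
  have S0: "finite S0" using G by (simp add: S0_def graph_of_groups_def)
  have edge_loop: "gloop G (pt (esrc G e) @ [ELetter e] @ inv_path G (pt (etgt G e)))"
    if "e \<in> gedges G" for e
    using graph_of_groups_edge[OF G that] that app pt inv by fastforce
  have "edge_el e \<in> carrier (pi1 G)" if "e \<in> gedges G" for e
    unfolding edge_el_def pi1_carrier using edge_loop[OF that] by blast
  then have S0_carrier: "S0 \<subseteq> carrier (pi1 G)"
    using pt[OF base] inv[OF base] by (auto simp: S0_def pi1_carrier)
  have vert_el: "loop_class G (pt v @ [VLetter v g] @ inv_path G (pt v)) \<in> carrier (pi1 G)"
    if "v \<in> gverts G" "g \<in> carrier (vgroup G v)" for v g
    using app pt[OF that(1)] inv[OF that(1)] that by (fastforce simp: pi1_carrier)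
  define Q where "Q = (\<lambda>v. (x0, y v)) ` gverts G \<union> (\<lambda>s. (x0, act T s x0)) ` S0"
  have "finite Q" using S0 G by (simp add: Q_def graph_of_groups_def)
  moreover have "Q \<subseteq> verts T \<times> verts T" using x0 y S0_carrier act_vert by (auto simp: Q_def)
  ultimately obtain F where F: "finite F" "F \<subseteq> edges T" "Q \<subseteq> (adj F)\<^sup>*"
    by (rule finite_connecting_edges)
  let ?R = "(adj (translates F))\<^sup>*"
  have Q: "(a, b) \<in> ?R" if "(a, b) \<in> Q" for a b
    using adj_mono[OF subset_translates[OF F(2)]] F(3) that by blast
  have "(x0, act T g x0) \<in> ?R" if "g \<in> carrier (pi1 G)" for g
  proof (rule pi1_generated[OF G pt, of "\<lambda>g. (x0, act T g x0) \<in> ?R"])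
    fix g h assume gh: "g \<in> carrier (pi1 G)" "h \<in> carrier (pi1 G)"
      "(x0, act T g x0) \<in> ?R" "(x0, act T h x0) \<in> ?R"
    have "(act T g x0, act T g (act T h x0)) \<in> ?R" by (rule translates_act[OF F(2) gh(4,1)])
    then show "(x0, act T (g \<otimes>\<^bsub>pi1 G\<^esub> h) x0) \<in> ?R"
      using gh(3) composition_rule[OF x0 gh(1,2)] by (simp add: rtrancl_trans)
  next
    fix v g assume v: "v \<in> nontrivial_verts G" "g \<in> carrier (vgroup G v)"
    let ?s = "loop_class G (pt v @ [VLetter v g] @ inv_path G (pt v))"
    have V: "v \<in> gverts G" using v by (simp add: nontrivial_verts_def)
    have "(x0, y v) \<in> ?R" using V by (intro Q) (simp add: Q_def)
    \<comment> \<open>The element \<open>?s\<close> fixes \<open>y v\<close>, so it carries the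
      connection of \<open>x0\<close> with \<open>y v\<close> to one of \<open>act T ?s x0\<close>
      with \<open>y v\<close>.\<close>
    moreover have "(act T ?s x0, y v) \<in> ?R"
      using translates_act[OF F(2) calculation vert_el[OF V v(2)]] fix_y[OF V v] by simp
    ultimately show "(x0, act T ?s x0) \<in> ?R" using adj_rtrancl_sym rtrancl_trans by metis
  next
    fix e assume "e \<in> gedges G"
    then show "(x0, act T (loop_class G (pt (esrc G e) @ [ELetter e] @ inv_path G (pt (etgt G e)))) x0)
        \<in> ?R"
      by (intro Q) (auto simp: Q_def S0_def edge_el_def)
  next
    show "(x0, act T (loop_class G (pt (gbase G))) x0) \<in> ?R"
      and "(x0, act T (loop_class G (inv_path G (pt (gbase G)))) x0) \<in> ?R"
      by (intro Q; simp add: Q_def S0_def)+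
  qed (use that in simp_all)
  then show ?thesis by (rule finite_edge_orbits_criterion[OF minimal F(1,2) x0])
qed

section \<open>Stretching factors and displacement\<close>

lemma pdist_act [simp]: "pdist (T\<lparr>act := \<alpha>\<rparr>) = pdist T"
proof (intro ext)
  fix p q
  have T: "verts (T\<lparr>act := \<alpha>\<rparr>) = verts T" "edges (T\<lparr>act := \<alpha>\<rparr>) = edges T" "len (T\<lparr>act := \<alpha>\<rparr>) = len T"
    by simp_all
  show "pdist (T\<lparr>act := \<alpha>\<rparr>) p q = pdist T p q"
    unfolding pdist_def vdist_def geodesic_def points_def T by (rule refl)
qed

lemma points_act [simp]: "points (T\<lparr>act := \<alpha>\<rparr>) = points T"
  by (simp add: points_def)

lemma point_act_twist:
  assumes "group H" and "group H'" and "\<psi> \<in> hom H H'" and "g \<in> carrier H"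
  shows "point_act H (T\<lparr>act := \<lambda>g. act T (\<psi> g)\<rparr>) g = point_act H' T (\<psi> g)"
proof -
  interpret group_hom H H' \<psi>
    using assms by (simp add: group_hom_def group_hom_axioms_def)
  show ?thesis using assms(4) by (simp add: point_act_def fun_eq_iff)
qed

lemma lip_bounds_mono:
  assumes "\<And>p q. 0 \<le> pdist S p q" and "C \<in> lip_bounds S T f" and "C \<le> C'"
  shows "C' \<in> lip_bounds S T f"
proof -
  have "pdist T (f p) (f q) \<le> C' * pdist S p q" if "p \<in> points S" "q \<in> points S" for p q
    using assms that mult_right_mono[OF assms(3) assms(1)[of p q]] unfolding lip_bounds_def by force
  then show ?thesis using assms(2,3) by (simp add: lip_bounds_def)
qed

lemma bdd_below_lip_bounds: "bdd_below (lip_bounds S T f)"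
  by (rule bdd_belowI[of _ 0]) (simp add: lip_bounds_def)

text \<open>A pair at positive distance bounds all constants from below by a quotient; a pair at
  distance 0 imposes the same condition on every constant.\<close>

lemma Inf_lip_bounds:
  assumes nonneg: "\<And>p q. 0 \<le> pdist S p q" and ne: "lip_bounds S T f \<noteq> {}"
  shows "Inf (lip_bounds S T f) \<in> lip_bounds S T f"
proof -
  let ?I = "Inf (lip_bounds S T f)"
  have "0 \<le> ?I" by (rule cInf_greatest[OF ne]) (simp add: lip_bounds_def)
  moreover have "pdist T (f p) (f q) \<le> ?I * pdist S p q" if pq: "p \<in> points S" "q \<in> points S" for p q
  proof (cases "pdist S p q = 0")
    case True
    then show ?thesis using ne pq by (fastforce simp: lip_bounds_def)
  next
    case False
    then have pos: "0 < pdist S p q" using nonneg[of p q] by simp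
    have "pdist T (f p) (f q) / pdist S p q \<le> ?I"
      by (rule cInf_greatest[OF ne]) (use pos pq in \<open>simp add: lip_bounds_def divide_le_eq\<close>)
    then show ?thesis using pos by (simp add: divide_le_eq)
  qed
  ultimately show ?thesis by (simp add: lip_bounds_def)
qed

text \<open>One constant for all components replaces the maximum of infima in \<open>Lip\<close>.
  Interpolation works with such constants and needs no optimal maps.\<close>

definition stretch_bounds ::
  "('x, 'e, 'g) gog list \<Rightarrow> ('x, 'e, 'g, 'v) tree_tuple \<Rightarrow> ('x, 'e, 'g, 'v) tree_tuple \<Rightarrow> real set"
  where
  "stretch_bounds \<Gamma> S T = {C. \<exists>f. \<forall>i<length \<Gamma>.
     equivariant (pi1 (\<Gamma> ! i)) (S i) (T i) (f i) \<and> C \<in> lip_bounds (S i) (T i) (f i)}"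

lemma stretch_bounds_nonneg: "\<Gamma> \<noteq> [] \<Longrightarrow> C \<in> stretch_bounds \<Gamma> S T \<Longrightarrow> 0 \<le> C"
  by (auto simp: stretch_bounds_def lip_bounds_def)

text \<open>\<open>Lip\<close> of an admissible tuple is a common constant for it, and every common
  constant dominates the \<open>Lip\<close> of its tuple.\<close>

lemma stretch_eq_Inf:
  assumes ne: "\<Gamma> \<noteq> []" and nonneg: "\<And>i p q. i < length \<Gamma> \<Longrightarrow> 0 \<le> pdist (S i) p q"
  shows "stretch \<Gamma> S T = Inf (stretch_bounds \<Gamma> S T)"
proof -
  let ?ok = "\<lambda>f. \<forall>i<length \<Gamma>. equivariant (pi1 (\<Gamma> ! i)) (S i) (T i) (f i) \<and>
    lip_bounds (S i) (T i) (f i) \<noteq> {}"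
  let ?L = "{Lip \<Gamma> S T f | f. ?ok f}"
  have N: "finite {..<length \<Gamma>}" "{..<length \<Gamma>} \<noteq> {}" using ne by auto
  have sub: "?L \<subseteq> stretch_bounds \<Gamma> S T"
  proof clarify
    fix f assume f: "?ok f"
    have "Lip \<Gamma> S T f \<in> lip_bounds (S i) (T i) (f i)" if i: "i < length \<Gamma>" for i
    proof (rule lip_bounds_mono[OF nonneg[OF i] Inf_lip_bounds[OF nonneg[OF i]]])
      show "lip_bounds (S i) (T i) (f i) \<noteq> {}" using f i by blast
      show "Inf (lip_bounds (S i) (T i) (f i)) \<le> Lip \<Gamma> S T f"
        unfolding Lip_def using i N by (intro Max_ge) auto
    qed
    then show "Lip \<Gamma> S T f \<in> stretch_bounds \<Gamma> S T" using f by (auto simp: stretch_bounds_def)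
  qed
  have dom: "\<exists>l\<in>?L. l \<le> C" if C: "C \<in> stretch_bounds \<Gamma> S T" for C
  proof -
    obtain f where f: "\<forall>i<length \<Gamma>. equivariant (pi1 (\<Gamma> ! i)) (S i) (T i) (f i) \<and>
        C \<in> lip_bounds (S i) (T i) (f i)"
      using C unfolding stretch_bounds_def by blast
    then have "Lip \<Gamma> S T f \<le> C"
      unfolding Lip_def using N
      by (intro Max.boundedI) (auto intro!: cInf_lower bdd_below_lip_bounds)
    moreover have "?ok f" using f by blast
    ultimately show ?thesis by blast
  qed
  have bdd: "bdd_below (stretch_bounds \<Gamma> S T)"
    using stretch_bounds_nonneg[OF ne] by (rule bdd_belowI)
  show ?thesis
  \<comment> \<open>Without admissible tuples both sides are the same value
    \<open>Inf {}\<close>.\<close>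
  proof (cases "stretch_bounds \<Gamma> S T = {}")
    case True
    then have "?L = {}" using sub by blast
    then show ?thesis using True by (simp only: stretch_def)
  next
    case False
    then have "?L \<noteq> {}" using dom by blast
    then have "Inf (stretch_bounds \<Gamma> S T) \<le> Inf ?L" by (rule cInf_superset_mono[OF _ bdd sub])
    moreover have "Inf ?L \<le> Inf (stretch_bounds \<Gamma> S T)"
      by (rule cInf_mono[OF False bdd_below_mono[OF bdd sub] dom])
    ultimately show ?thesis unfolding stretch_def by (rule order_antisym[rotated])
  qed
qed

section \<open>Independence of the representatives of a class\<close>

lemma equiv_isometric_refl: "equiv_isometric H T T"
  unfolding equiv_isometric_def equivariant_def by (intro exI[of _ id]) auto

lemma equiv_isometric_sym:
  assumes T: "metric_gtree H S" and iso: "equiv_isometric H S T"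
  shows "equiv_isometric H T S"
proof -
  interpret acted_tree H S by (rule metric_gtree_acted[OF T])
  obtain f where f: "equivariant H S T f" "bij_betw f (points S) (points T)"
    and d: "\<And>p q. p \<in> points S \<Longrightarrow> q \<in> points S \<Longrightarrow> pdist T (f p) (f q) = pdist S p q"
    using iso unfolding equiv_isometric_def by blast
  let ?h = "inv_into (points S) f"
  have h: "?h p \<in> points S" "f (?h p) = p" if "p \<in> points T" for p
    using f(2) that by (auto simp: bij_betw_def inv_into_into f_inv_into_f)
  have "?h (point_act H T g p) = point_act H S g (?h p)" if "g \<in> carrier H" "p \<in> points T" for g p
  proof -
    have "f (point_act H S g (?h p)) = point_act H T g p"
      using f(1) h[OF that(2)] that by (simp add: equivariant_def)
    then show ?thesis
      using f(2) point_act_points[OF that(1) h(1)[OF that(2)]]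
      by (metis bij_betw_def inv_into_f_f)
  qed
  then have "equivariant H T S ?h" using h by (simp add: equivariant_def)
  moreover have "bij_betw ?h (points T) (points S)" using f(2) by (rule bij_betw_inv_into)
  moreover have "pdist S (?h p) (?h q) = pdist T p q" if "p \<in> points T" "q \<in> points T" for p q
    using d[OF h(1)[OF that(1)] h(1)[OF that(2)]] h that by simp
  ultimately show ?thesis unfolding equiv_isometric_def by blast
qed

lemma aut_act_nth:
  "i < length \<Gamma> \<Longrightarrow> aut_act \<Gamma> (\<sigma>, \<psi>) T i = (T (\<sigma> i))\<lparr>act := \<lambda>g. act (T (\<sigma> i)) (\<psi> i g)\<rparr>"
  by (simp add: aut_act_def)

text \<open>Maps are conjugated by isometries. As the target of \<open>f i\<close> is component
  \<open>\<sigma> i\<close>, the isometry after it is \<open>k (\<sigma> i)\<close>.\<close>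

lemma stretch_bounds_isometric:
  assumes grp: "\<And>i. i < length \<Gamma> \<Longrightarrow> group (pi1 (\<Gamma> ! i))"
    and \<sigma>: "\<And>i. i < length \<Gamma> \<Longrightarrow> \<sigma> i < length \<Gamma>"
    and \<psi>: "\<And>i. i < length \<Gamma> \<Longrightarrow> \<psi> i \<in> hom (pi1 (\<Gamma> ! i)) (pi1 (\<Gamma> ! \<sigma> i))"
    and ST: "\<And>i. i < length \<Gamma> \<Longrightarrow> equiv_isometric (pi1 (\<Gamma> ! i)) (S i) (T i)"
    and TS: "\<And>i. i < length \<Gamma> \<Longrightarrow> equiv_isometric (pi1 (\<Gamma> ! i)) (T i) (S i)"
  shows "stretch_bounds \<Gamma> S (aut_act \<Gamma> (\<sigma>, \<psi>) S) \<subseteq> stretch_bounds \<Gamma> T (aut_act \<Gamma> (\<sigma>, \<psi>) T)"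
proof
  fix C assume "C \<in> stretch_bounds \<Gamma> S (aut_act \<Gamma> (\<sigma>, \<psi>) S)"
  then obtain f where f: "\<And>i. i < length \<Gamma> \<Longrightarrow>
      equivariant (pi1 (\<Gamma> ! i)) (S i) (aut_act \<Gamma> (\<sigma>, \<psi>) S i) (f i) \<and>
      C \<in> lip_bounds (S i) (aut_act \<Gamma> (\<sigma>, \<psi>) S i) (f i)"
    unfolding stretch_bounds_def by blast
  have "\<exists>h. \<forall>i<length \<Gamma>. equivariant (pi1 (\<Gamma> ! i)) (T i) (S i) (h i) \<and>
      (\<forall>p\<in>points (T i). \<forall>q\<in>points (T i). pdist (S i) (h i p) (h i q) = pdist (T i) p q)"
    using TS unfolding equiv_isometric_def by metis
  then obtain h where h: "\<And>i. i < length \<Gamma> \<Longrightarrow> equivariant (pi1 (\<Gamma> ! i)) (T i) (S i) (h i)"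
    and hd: "\<And>i p q. i < length \<Gamma> \<Longrightarrow> p \<in> points (T i) \<Longrightarrow> q \<in> points (T i) \<Longrightarrow>
      pdist (S i) (h i p) (h i q) = pdist (T i) p q"
    by blast
  have "\<exists>k. \<forall>i<length \<Gamma>. equivariant (pi1 (\<Gamma> ! i)) (S i) (T i) (k i) \<and>
      (\<forall>p\<in>points (S i). \<forall>q\<in>points (S i). pdist (T i) (k i p) (k i q) = pdist (S i) p q)"
    using ST unfolding equiv_isometric_def by metis
  then obtain k where k: "\<And>i. i < length \<Gamma> \<Longrightarrow> equivariant (pi1 (\<Gamma> ! i)) (S i) (T i) (k i)"
    and kd: "\<And>i p q. i < length \<Gamma> \<Longrightarrow> p \<in> points (S i) \<Longrightarrow> q \<in> points (S i) \<Longrightarrow>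
      pdist (T i) (k i p) (k i q) = pdist (S i) p q"
    by blast
  let ?f = "\<lambda>i p. k (\<sigma> i) (f i (h i p))"
  have "equivariant (pi1 (\<Gamma> ! i)) (T i) (aut_act \<Gamma> (\<sigma>, \<psi>) T i) (?f i) \<and>
      C \<in> lip_bounds (T i) (aut_act \<Gamma> (\<sigma>, \<psi>) T i) (?f i)" if i: "i < length \<Gamma>" for i
  proof -
    have hp: "h i p \<in> points (S i)" if "p \<in> points (T i)" for p
      using h[OF i] that by (auto simp: equivariant_def)
    have fp: "f i p \<in> points (S (\<sigma> i))" if "p \<in> points (S i)" for p
      using f[OF i] that by (auto simp: equivariant_def aut_act_nth[OF i])
    have kp: "k (\<sigma> i) p \<in> points (T (\<sigma> i))" if "p \<in> points (S (\<sigma> i))" for p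
      using k[OF \<sigma>[OF i]] that by (auto simp: equivariant_def)
    have tw: "point_act (pi1 (\<Gamma> ! i)) (aut_act \<Gamma> (\<sigma>, \<psi>) U i) g
        = point_act (pi1 (\<Gamma> ! \<sigma> i)) (U (\<sigma> i)) (\<psi> i g)" if "g \<in> carrier (pi1 (\<Gamma> ! i))" for U g
      using point_act_twist[OF grp[OF i] grp[OF \<sigma>[OF i]] \<psi>[OF i] that] by (simp add: aut_act_nth[OF i])
    have \<psi>g: "\<psi> i g \<in> carrier (pi1 (\<Gamma> ! \<sigma> i))" if "g \<in> carrier (pi1 (\<Gamma> ! i))" for g
      using \<psi>[OF i] that by (auto simp: hom_def)
    have "?f i (point_act (pi1 (\<Gamma> ! i)) (T i) g p)
        = point_act (pi1 (\<Gamma> ! i)) (aut_act \<Gamma> (\<sigma>, \<psi>) T i) g (?f i p)"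
      if g: "g \<in> carrier (pi1 (\<Gamma> ! i))" and p: "p \<in> points (T i)" for g p
    proof -
      have "h i (point_act (pi1 (\<Gamma> ! i)) (T i) g p) = point_act (pi1 (\<Gamma> ! i)) (S i) g (h i p)"
        using h[OF i] g p by (simp add: equivariant_def)
      moreover have "f i (point_act (pi1 (\<Gamma> ! i)) (S i) g (h i p))
          = point_act (pi1 (\<Gamma> ! \<sigma> i)) (S (\<sigma> i)) (\<psi> i g) (f i (h i p))"
        using f[OF i] g hp[OF p] by (simp add: equivariant_def tw)
      moreover have "k (\<sigma> i) (point_act (pi1 (\<Gamma> ! \<sigma> i)) (S (\<sigma> i)) (\<psi> i g) (f i (h i p)))
          = point_act (pi1 (\<Gamma> ! \<sigma> i)) (T (\<sigma> i)) (\<psi> i g) (k (\<sigma> i) (f i (h i p)))"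
        using k[OF \<sigma>[OF i]] \<psi>g[OF g] fp[OF hp[OF p]] by (simp add: equivariant_def)
      ultimately show ?thesis by (simp only: tw[OF g])
    qed
    then have "equivariant (pi1 (\<Gamma> ! i)) (T i) (aut_act \<Gamma> (\<sigma>, \<psi>) T i) (?f i)"
      using hp fp kp by (simp add: equivariant_def aut_act_nth[OF i])
    moreover have "pdist (T (\<sigma> i)) (?f i p) (?f i q) \<le> C * pdist (T i) p q"
      if "p \<in> points (T i)" "q \<in> points (T i)" for p q
    proof -
      have "pdist (S (\<sigma> i)) (f i (h i p)) (f i (h i q)) \<le> C * pdist (S i) (h i p) (h i q)"
        using f[OF i] hp that by (simp add: lip_bounds_def aut_act_nth[OF i])
      then show ?thesis using kd[OF \<sigma>[OF i] fp[OF hp] fp[OF hp]] hd[OF i] that by simp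
    qed
    moreover have "0 \<le> C" using f[OF i] by (simp add: lip_bounds_def)
    ultimately show ?thesis by (simp add: lip_bounds_def aut_act_nth[OF i])
  qed
  then show "C \<in> stretch_bounds \<Gamma> T (aut_act \<Gamma> (\<sigma>, \<psi>) T)"
    unfolding stretch_bounds_def mem_Collect_eq by (intro exI[of _ ?f]) blast
qed

lemma outer_treeD:
  assumes "outer_tree G T"
  shows "metric_gtree (pi1 G) T" and "group (pi1 G)"
    and "0 \<le> pdist T p q"
proof -
  show m: "metric_gtree (pi1 G) T" using assms by (simp add: outer_tree_def)
  then show "group (pi1 G)" by (rule acted_tree.group[OF metric_gtree_acted])
  show "0 \<le> pdist T p q" by (rule pdist_nonneg[OF metric_gtreeD(1,2)[OF m]])
qed

text \<open>\<open>the_elem\<close> requires a singleton: all representatives are equivariantly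
  isometric to \<open>T\<close> and hence have the same constants.\<close>

lemma displacement_outer_class:
  assumes ne: "\<Gamma> \<noteq> []" and T: "\<And>i. i < length \<Gamma> \<Longrightarrow> outer_tree (\<Gamma> ! i) (T i)"
    and \<sigma>: "\<And>i. i < length \<Gamma> \<Longrightarrow> \<sigma> i < length \<Gamma>"
    and \<psi>: "\<And>i. i < length \<Gamma> \<Longrightarrow> \<psi> i \<in> hom (pi1 (\<Gamma> ! i)) (pi1 (\<Gamma> ! \<sigma> i))"
  shows "displacement \<Gamma> (\<sigma>, \<psi>) (outer_class \<Gamma> T)
    = Inf (stretch_bounds \<Gamma> T (aut_act \<Gamma> (\<sigma>, \<psi>) T))"
proof -
  have grp: "group (pi1 (\<Gamma> ! i))" if "i < length \<Gamma>" for i using outer_treeD(2)[OF T[OF that]] .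
  have st: "stretch \<Gamma> S (aut_act \<Gamma> (\<sigma>, \<psi>) S) = Inf (stretch_bounds \<Gamma> T (aut_act \<Gamma> (\<sigma>, \<psi>) T))"
    if S: "\<forall>i<length \<Gamma>. S i \<in> outer_class \<Gamma> T i" for S
  proof -
    have S': "outer_tree (\<Gamma> ! i) (S i)" and TS: "equiv_isometric (pi1 (\<Gamma> ! i)) (T i) (S i)"
      if "i < length \<Gamma>" for i
      using S that by (auto simp: outer_class_def tree_class_def)
    have ST: "equiv_isometric (pi1 (\<Gamma> ! i)) (S i) (T i)" if "i < length \<Gamma>" for i
      using equiv_isometric_sym[OF outer_treeD(1)[OF T[OF that]] TS[OF that]] .
    have "stretch_bounds \<Gamma> S (aut_act \<Gamma> (\<sigma>, \<psi>) S) = stretch_bounds \<Gamma> T (aut_act \<Gamma> (\<sigma>, \<psi>) T)"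
      using stretch_bounds_isometric[of \<Gamma> \<sigma> \<psi> S T, OF grp \<sigma> \<psi> ST TS]
        stretch_bounds_isometric[of \<Gamma> \<sigma> \<psi> T S, OF grp \<sigma> \<psi> TS ST] by blast
    then show ?thesis using stretch_eq_Inf[OF ne outer_treeD(3)[OF S']] by simp
  qed
  have T': "\<forall>i<length \<Gamma>. T i \<in> outer_class \<Gamma> T i"
    using T by (simp add: outer_class_def tree_class_def equiv_isometric_refl)
  have "{stretch \<Gamma> S (aut_act \<Gamma> (\<sigma>, \<psi>) S) | S. \<forall>i<length \<Gamma>. S i \<in> outer_class \<Gamma> T i}
      = {Inf (stretch_bounds \<Gamma> T (aut_act \<Gamma> (\<sigma>, \<psi>) T))}" (is "?A = {?I}")
  proof (intro equalityI subsetI)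
    fix x assume "x \<in> ?A"
    then show "x \<in> {?I}" using st by (auto simp only: mem_Collect_eq singleton_iff)
  next
    fix x assume "x \<in> {?I}"
    then have "x = stretch \<Gamma> T (aut_act \<Gamma> (\<sigma>, \<psi>) T)" using st[OF T'] by simp
    then show "x \<in> ?A" using T' by blast
  qed
  then show ?thesis by (simp add: displacement_def)
qed

lemma outer_tree_with_lengths:
  assumes T: "outer_tree G T" and c: "\<And>e. e \<in> edges T \<Longrightarrow> 0 < c (edge_orbit (pi1 G) T e)"
  shows "outer_tree G (T\<lparr>len := \<lambda>e. c (edge_orbit (pi1 G) T e)\<rparr>)"
proof -
  note m = outer_treeD(1)[OF T]
  interpret acted_tree "pi1 G" T by (rule metric_gtree_acted[OF m])
  have "metric_gtree (pi1 G) (T\<lparr>len := \<lambda>e. c (edge_orbit (pi1 G) T e)\<rparr>)"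
    using m c edge_orbit_act by (simp add: metric_gtree_def edge_act_def)
  then show ?thesis using T by (simp add: outer_tree_def minimal_gtree_def)
qed

text \<open>An element of the class is an automorphism multiplied by an inner one. Its components
  are those of the automorphism, followed by conjugation in the target.\<close>

lemma Out_hom:
  assumes \<Phi>: "\<Phi> \<in> carrier (Out \<Gamma>)" and "(\<sigma>, \<psi>) \<in> \<Phi>"
    and grp: "\<And>i. i < length \<Gamma> \<Longrightarrow> group (pi1 (\<Gamma> ! i))" and i: "i < length \<Gamma>"
  shows "\<sigma> i < length \<Gamma>" and "\<psi> i \<in> hom (pi1 (\<Gamma> ! i)) (pi1 (\<Gamma> ! \<sigma> i))"
proof -
  obtain \<alpha> where \<alpha>: "\<alpha> \<in> carrier (Aut \<Gamma>)" "\<Phi> = Inn \<Gamma> #>\<^bsub>Aut \<Gamma>\<^esub> \<alpha>"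
    using \<Phi> by (auto simp: Out_def FactGroup_def RCOSETS_def)
  obtain \<tau> \<xi> where \<tau>: "\<alpha> = (\<tau>, \<xi>)" by fastforce
  obtain \<nu> where \<nu>: "\<nu> \<in> Inn \<Gamma>" "(\<sigma>, \<psi>) = \<nu> \<otimes>\<^bsub>Aut \<Gamma>\<^esub> (\<tau>, \<xi>)"
    using assms(2) \<alpha>(2) \<tau> by (auto simp: r_coset_def)
  obtain h where h: "\<And>i. i < length \<Gamma> \<Longrightarrow> h i \<in> carrier (pi1 (\<Gamma> ! i))"
    and \<nu>h: "\<nu> = (id, \<lambda>i\<in>{..<length \<Gamma>}. \<lambda>g\<in>carrier (pi1 (\<Gamma> ! i)).
             h i \<otimes>\<^bsub>pi1 (\<Gamma> ! i)\<^esub> g \<otimes>\<^bsub>pi1 (\<Gamma> ! i)\<^esub> inv\<^bsub>pi1 (\<Gamma> ! i)\<^esub> (h i))"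
    using \<nu>(1) unfolding Inn_def by blast
  have "\<tau> permutes {..<length \<Gamma>}" and \<xi>: "\<xi> i \<in> hom (pi1 (\<Gamma> ! i)) (pi1 (\<Gamma> ! \<tau> i))"
    using \<alpha>(1) \<tau> i by (auto simp: Aut_def iso_def)
  then have \<tau>i: "\<tau> i < length \<Gamma>" using i permutes_in_image by fastforce
  have \<sigma>: "\<sigma> = \<tau>" and \<psi>: "\<psi> i = compose (carrier (pi1 (\<Gamma> ! i))) (snd \<nu> (\<tau> i)) (\<xi> i)"
    using \<nu>(2) \<nu>h i by (auto simp: Aut_def)
  show "\<sigma> i < length \<Gamma>" using \<sigma> \<tau>i by simp
  let ?H = "pi1 (\<Gamma> ! i)" and ?K = "pi1 (\<Gamma> ! \<tau> i)"
  interpret K: group ?K by (rule grp[OF \<tau>i])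
  interpret H: group ?H by (rule grp[OF i])
  note hi = h[OF \<tau>i]
  have \<xi>g: "\<xi> i g \<in> carrier ?K" if "g \<in> carrier ?H" for g
    using \<xi> that by (auto simp: hom_def)
  have eq: "\<psi> i g = h (\<tau> i) \<otimes>\<^bsub>?K\<^esub> \<xi> i g \<otimes>\<^bsub>?K\<^esub> inv\<^bsub>?K\<^esub> (h (\<tau> i))" if "g \<in> carrier ?H" for g
    using \<psi> \<nu>h \<tau>i that \<xi>g[OF that] by (simp add: compose_def)
  have conj: "a \<otimes>\<^bsub>?K\<^esub> (x \<otimes>\<^bsub>?K\<^esub> y) \<otimes>\<^bsub>?K\<^esub> inv\<^bsub>?K\<^esub> a
      = (a \<otimes>\<^bsub>?K\<^esub> x \<otimes>\<^bsub>?K\<^esub> inv\<^bsub>?K\<^esub> a) \<otimes>\<^bsub>?K\<^esub> (a \<otimes>\<^bsub>?K\<^esub> y \<otimes>\<^bsub>?K\<^esub> inv\<^bsub>?K\<^esub> a)"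
    if "a \<in> carrier ?K" "x \<in> carrier ?K" "y \<in> carrier ?K" for a x y
  proof -
    have "inv\<^bsub>?K\<^esub> a \<otimes>\<^bsub>?K\<^esub> (a \<otimes>\<^bsub>?K\<^esub> z) = z" if "z \<in> carrier ?K" for z
      using that \<open>a \<in> carrier ?K\<close> by (simp add: K.m_assoc[symmetric])
    then show ?thesis using that by (simp add: K.m_assoc)
  qed
  have "\<psi> i (g \<otimes>\<^bsub>?H\<^esub> g') = \<psi> i g \<otimes>\<^bsub>?K\<^esub> \<psi> i g'"
    if "g \<in> carrier ?H" "g' \<in> carrier ?H" for g g'
  proof -
    have "\<xi> i (g \<otimes>\<^bsub>?H\<^esub> g') = \<xi> i g \<otimes>\<^bsub>?K\<^esub> \<xi> i g'"
      using \<xi> that by (simp add: hom_def)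
    then show ?thesis using conj[OF hi \<xi>g[OF that(1)] \<xi>g[OF that(2)]] eq that by simp
  qed
  then show "\<psi> i \<in> hom (pi1 (\<Gamma> ! i)) (pi1 (\<Gamma> ! \<sigma> i))"
    using \<sigma> eq hi \<xi>g by (simp add: hom_def)
qed

section \<open>Interpolation along a segment\<close>

text \<open>Here \<open>Q t\<close> stands for the set of Lipschitz constants realised at the point \<open>t\<close> of a segment,
  and \<open>A\<close>, \<open>B\<close> for the distances of two points in the two end metrics.\<close>

locale lipschitz_family =
  fixes Q :: "real \<Rightarrow> real set" and \<rho> :: real
  assumes \<rho>: "0 < \<rho>" "\<rho> \<le> 1"
    and nonneg: "C \<in> Q t \<Longrightarrow> 0 \<le> C"
    and combine: "\<lbrakk>0 \<le> s; s \<le> 1; 0 \<le> r; r \<le> 1; 0 < \<tau>; \<tau> < 1; K \<in> Q s; K' \<in> Q r; 0 \<le> C;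
      \<And>A B. \<lbrakk>0 \<le> A; 0 \<le> B; \<rho> * A \<le> B; \<rho> * B \<le> A\<rbrakk> \<Longrightarrow>
        (1 - \<tau>) * (K * ((1 - s) * A + s * B)) + \<tau> * (K' * ((1 - r) * A + r * B))
        \<le> C * ((1 - \<tau>) * ((1 - s) * A + s * B) + \<tau> * ((1 - r) * A + r * B))\<rbrakk>
      \<Longrightarrow> C \<in> Q ((1 - \<tau>) * s + \<tau> * r)"
    and rescale: "\<lbrakk>0 \<le> s; s \<le> 1; 0 \<le> r; r \<le> 1; K \<in> Q s; 0 \<le> \<alpha>; 0 \<le> \<beta>;
      \<And>A B. \<lbrakk>0 \<le> A; 0 \<le> B; \<rho> * A \<le> B; \<rho> * B \<le> A\<rbrakk> \<Longrightarrow>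
        (1 - r) * A + r * B \<le> \<alpha> * ((1 - s) * A + s * B) \<and>
        (1 - s) * A + s * B \<le> \<beta> * ((1 - r) * A + r * B)\<rbrakk>
      \<Longrightarrow> \<alpha> * \<beta> * K \<in> Q r"
begin

text \<open>The end metrics bound each other up to \<open>\<rho>\<close>. As
  \<open>\<rho> \<le> 1\<close>, the value \<open>A\<close> satisfies the same bounds relative to
  itself, and so do mixtures.\<close>

lemma mix_bounds:
  assumes "0 \<le> s" and "s \<le> 1" and "0 \<le> A" and "\<rho> * A \<le> B" and "\<rho> * B \<le> A"
  shows "\<rho> * A \<le> (1 - s) * A + s * B" and "\<rho> * ((1 - s) * A + s * B) \<le> A"
proof -
  have "\<rho> * A \<le> A" using \<rho> assms(3) by (simp add: mult_left_le_one_le)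
  then have "(1 - s) * (\<rho> * A) + s * (\<rho> * A) \<le> (1 - s) * A + s * B"
    using assms by (intro add_mono mult_left_mono) auto
  then show "\<rho> * A \<le> (1 - s) * A + s * B" by (simp add: algebra_simps)
  have "(1 - s) * (\<rho> * A) + s * (\<rho> * B) \<le> (1 - s) * A + s * A"
    using \<open>\<rho> * A \<le> A\<close> assms by (intro add_mono mult_left_mono) auto
  then show "\<rho> * ((1 - s) * A + s * B) \<le> A" by (simp add: algebra_simps)
qed

text \<open>The comparison passes through \<open>A\<close> and costs a factor \<open>\<rho>\<close>
  each way, hence the square.\<close>

lemma mix_compare:
  assumes "0 \<le> s" and "s \<le> 1" and "0 \<le> r" and "r \<le> 1"
    and "0 \<le> A" and "\<rho> * A \<le> B" and "\<rho> * B \<le> A"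
  shows "\<rho>\<^sup>2 * ((1 - s) * A + s * B) \<le> (1 - r) * A + r * B"
proof -
  have "\<rho> * (\<rho> * ((1 - s) * A + s * B)) \<le> \<rho> * A"
    using mix_bounds(2)[OF assms(1,2,5-7)] \<rho> by (simp add: mult_left_mono)
  also have "\<dots> \<le> (1 - r) * A + r * B" by (rule mix_bounds(1)[OF assms(3-7)])
  finally show ?thesis by (simp add: power2_eq_square mult.assoc)
qed

text \<open>On the empty set \<open>Inf\<close> is a junk value; but if \<open>Q\<close> is empty anywhere on the segment then it is
  empty everywhere, and the infimum is constant.\<close>

lemma Q_empty:
  assumes s: "0 \<le> s" "s \<le> 1" and r: "0 \<le> r" "r \<le> 1" and "Q r = {}"
  shows "Q s = {}"
proof (rule ccontr)
  assume "Q s \<noteq> {}"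
  then obtain K where K: "K \<in> Q s" by blast
  let ?\<alpha> = "1 / \<rho>\<^sup>2"
  have "?\<alpha> * ?\<alpha> * K \<in> Q r"
  proof (rule rescale[OF s r K])
    fix A B :: real
    assume AB: "0 \<le> A" "0 \<le> B" "\<rho> * A \<le> B" "\<rho> * B \<le> A"
    show "(1 - r) * A + r * B \<le> ?\<alpha> * ((1 - s) * A + s * B) \<and>
        (1 - s) * A + s * B \<le> ?\<alpha> * ((1 - r) * A + r * B)"
      using mix_compare[OF s r AB(1,3,4)] mix_compare[OF r s AB(1,3,4)] \<rho>
      by (simp add: pos_le_divide_eq mult.commute)
  qed (use \<rho> in auto)
  then show False using assms by simp
qed

lemma Inf_nonneg: "Q t \<noteq> {} \<Longrightarrow> 0 \<le> Inf (Q t)"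
  using nonneg by (intro cInf_greatest) auto

lemma Inf_lower: "C \<in> Q t \<Longrightarrow> Inf (Q t) \<le> C"
  using nonneg by (intro cInf_lower bdd_belowI) auto

lemma between:
  assumes "s < t" and "t < r"
  obtains \<tau> :: real where "0 < \<tau>" and "\<tau> < 1" and "t = (1 - \<tau>) * s + \<tau> * r"
proof -
  define \<tau> where "\<tau> = (t - s) / (r - s)"
  have "0 < \<tau>" "\<tau> < 1" using assms by (auto simp: \<tau>_def divide_less_eq)
  moreover have "\<tau> * (r - s) = t - s" using assms by (simp add: \<tau>_def)
  then have "t = (1 - \<tau>) * s + \<tau> * r" by (simp add: algebra_simps)
  ultimately show thesis by (rule that)
qed

text \<open>The infima need not be attained, so the bound is shown for every \<open>C\<close> above
  both; such a \<open>C\<close> exceeds realised constants at both ends.\<close>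

lemma Inf_le_max:
  assumes "0 \<le> s" and "s \<le> t" and "t \<le> r" and "r \<le> 1"
  shows "Inf (Q t) \<le> max (Inf (Q s)) (Inf (Q r))"
proof (cases "Q t = {} \<or> t = s \<or> t = r")
  case True
  then have "Inf (Q t) = Inf (Q s) \<or> Inf (Q t) = Inf (Q r)"
    using Q_empty[of s t] assms by auto
  then show ?thesis by auto
next
  case False
  then have ne: "Q s \<noteq> {}" "Q r \<noteq> {}" using Q_empty[of t s] Q_empty[of t r] assms by auto
  have "s < t" "t < r" using False assms by auto
  then obtain \<tau> where \<tau>: "0 < \<tau>" "\<tau> < 1" "t = (1 - \<tau>) * s + \<tau> * r" by (rule between)
  show ?thesis
  proof (rule dense_ge)
    fix C assume C: "max (Inf (Q s)) (Inf (Q r)) < C"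
    then obtain K K' where K: "K \<in> Q s" "K < C" "K' \<in> Q r" "K' < C"
      using cInf_lessD[OF ne(1), of C] cInf_lessD[OF ne(2), of C] by auto
    have "C \<in> Q t"
      unfolding \<tau>(3)
    proof (rule combine[OF _ _ _ _ \<tau>(1,2) K(1,3)])
      fix A B :: real
      assume AB: "0 \<le> A" "0 \<le> B" "\<rho> * A \<le> B" "\<rho> * B \<le> A"
      have "0 \<le> (1 - s) * A + s * B" "0 \<le> (1 - r) * A + r * B" using AB assms by simp_all
      then have "(1 - \<tau>) * (K * ((1 - s) * A + s * B)) + \<tau> * (K' * ((1 - r) * A + r * B))
          \<le> (1 - \<tau>) * (C * ((1 - s) * A + s * B)) + \<tau> * (C * ((1 - r) * A + r * B))"
        using K \<tau> by (intro add_mono mult_left_mono mult_right_mono) auto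
      then show "(1 - \<tau>) * (K * ((1 - s) * A + s * B)) + \<tau> * (K' * ((1 - r) * A + r * B))
          \<le> C * ((1 - \<tau>) * ((1 - s) * A + s * B) + \<tau> * ((1 - r) * A + r * B))"
        by (simp add: algebra_simps)
    qed (use assms K nonneg[OF K(1)] in auto)
    then show "Inf (Q t) \<le> C" by (rule Inf_lower)
  qed
qed

text \<open>The better constant \<open>K'\<close> always enters with a definite share, whereas
  \<open>K\<close> can be taken as close to the infimum at \<open>s\<close> as desired.\<close>

lemma Inf_less:
  assumes "0 \<le> s" and "s < t" and "t < r" and "r \<le> 1" and less: "Inf (Q r) < Inf (Q s)"
  shows "Inf (Q t) < Inf (Q s)"
proof -
  have ne: "Q s \<noteq> {}" "Q r \<noteq> {}"
    using Q_empty[of s r] Q_empty[of r s] assms less by auto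
  let ?L = "Inf (Q s)"
  obtain \<tau> where \<tau>: "0 < \<tau>" "\<tau> < 1" "t = (1 - \<tau>) * s + \<tau> * r" using assms(2,3) by (rule between)
  obtain K' where K': "K' \<in> Q r" "K' < ?L" using cInf_lessD[OF ne(2) less] by blast
  \<comment> \<open>By \<open>mix_compare\<close> the distance at \<open>r\<close> is at least
    \<open>\<rho>\<^sup>2\<close> times that at \<open>s\<close>, so \<open>\<kappa>\<close> is a
    guaranteed weight of \<open>K'\<close> against the weight \<open>\<mu>\<close> of
    \<open>K\<close>.\<close>
  define \<mu> \<kappa> where "\<mu> = 1 - \<tau>" and "\<kappa> = \<tau> * \<rho>\<^sup>2"
  have pos: "0 < \<mu>" "0 < \<kappa>" using \<tau> \<rho> by (auto simp: \<mu>_def \<kappa>_def)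
  \<comment> \<open>The mean \<open>C\<close> chosen below is smaller than \<open>?L\<close> exactly
    when \<open>K\<close> is smaller than this bound.\<close>
  have "?L < ?L + \<kappa> * (?L - K') / \<mu>" using pos K' by simp
  then obtain K where K: "K \<in> Q s" "K < ?L + \<kappa> * (?L - K') / \<mu>" using cInf_lessD[OF ne(1)] by blast
  have LK: "?L \<le> K" by (rule Inf_lower[OF K(1)])
  \<comment> \<open>With this mean the excess \<open>\<mu> * (K - C)\<close> and the gain
    \<open>\<kappa> * (C - K')\<close> balance.\<close>
  define C where "C = (\<mu> * K + \<kappa> * K') / (\<mu> + \<kappa>)"
  have C: "C * (\<mu> + \<kappa>) = \<mu> * K + \<kappa> * K'" using pos by (simp add: C_def)
  have "K - ?L < \<kappa> * (?L - K') / \<mu>" using K(2) by linarith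
  then have "\<mu> * (K - ?L) < \<kappa> * (?L - K')"
    unfolding pos_less_divide_eq[OF pos(1)] by (simp add: mult.commute)
  then have "C * (\<mu> + \<kappa>) < ?L * (\<mu> + \<kappa>)" unfolding C by (simp add: algebra_simps)
  then have CL: "C < ?L" using pos by simp
  have "K' * (\<mu> + \<kappa>) \<le> C * (\<mu> + \<kappa>)"
    unfolding C using K'(2) LK pos by (simp add: algebra_simps)
  then have KC: "K' \<le> C" using pos by simp
  have "C \<in> Q t"
    unfolding \<tau>(3)
  proof (rule combine[OF _ _ _ _ \<tau>(1,2) K(1) K'(1)])
    fix A B :: real
    assume AB: "0 \<le> A" "0 \<le> B" "\<rho> * A \<le> B" "\<rho> * B \<le> A"
    let ?s = "(1 - s) * A + s * B" and ?r = "(1 - r) * A + r * B"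
    have "\<mu> * (K - C) = \<kappa> * (C - K')" using C by (simp add: algebra_simps)
    then have "\<mu> * (K - C) * ?s = \<tau> * (C - K') * (\<rho>\<^sup>2 * ?s)" by (simp add: \<kappa>_def)
    also have "\<dots> \<le> \<tau> * (C - K') * ?r"
      using mix_compare[of s r A B] AB assms \<tau> KC by (intro mult_left_mono) auto
    finally show "(1 - \<tau>) * (K * ?s) + \<tau> * (K' * ?r) \<le> C * ((1 - \<tau>) * ?s + \<tau> * ?r)"
      unfolding \<mu>_def by (simp add: algebra_simps)
  qed (use assms KC nonneg[OF K'(1)] in auto)
  then show ?thesis using Inf_lower CL by fastforce
qed

text \<open>Measuring the maps for \<open>s\<close> in the metric at 0 multiplies constants by at
  most \<open>(1 + s / \<rho>) / (1 - s)\<close>, which tends to 1 with \<open>s\<close>.\<close>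

lemma Inf_lower_semicontinuous:
  assumes less: "l < Inf (Q 0)" and l: "0 \<le> l"
  obtains \<epsilon> :: real where "0 < \<epsilon>" and "\<epsilon> < 1"
    and "\<And>s. 0 \<le> s \<Longrightarrow> s \<le> \<epsilon> \<Longrightarrow> Q s \<noteq> {} \<Longrightarrow> l < Inf (Q s)"
proof -
  let ?L = "Inf (Q 0)"
  \<comment> \<open>A value at most \<open>l\<close> at \<open>s\<close> would give
    \<open>?L * (1 - s) \<le> l * (1 + s / \<rho>)\<close>, that is
    \<open>?L - l \<le> s * c\<close>. The 2 in \<open>?\<epsilon>\<close> makes the contradiction
    strict, and the bound \<open>1 / 2\<close> keeps \<open>1 - s\<close> positive.\<close>
  define c where "c = ?L + l / \<rho>"
  let ?\<epsilon> = "min (1 / 2) ((?L - l) / (2 * c))"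
  have c: "0 < c" using less l \<rho> by (simp add: c_def add_pos_nonneg)
  show thesis
  proof (rule that[of ?\<epsilon>])
    show "0 < ?\<epsilon>" using less c by simp
    show "?\<epsilon> < 1" by (simp add: min_less_iff_disj)
    fix s assume s: "0 \<le> s" "s \<le> ?\<epsilon>" "Q s \<noteq> {}"
    have s1: "s < 1" using s(2) by simp
    have "s \<le> (?L - l) / (2 * c)" using s(2) by simp
    then have "s * (2 * c) \<le> ?L - l" using c by (subst (asm) pos_le_divide_eq) simp_all
    then have sc: "s * c < ?L - l" using less by linarith
    show "l < Inf (Q s)"
    proof (rule ccontr)
      assume "\<not> l < Inf (Q s)"
      have le: "?L * (1 - s) \<le> (1 + s / \<rho>) * K" if K: "K \<in> Q s" for K
      proof -
        have "1 / (1 - s) * (1 + s / \<rho>) * K \<in> Q 0"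
        proof (rule rescale[OF s(1) _ _ _ K])
          fix A B :: real
          assume AB: "0 \<le> A" "0 \<le> B" "\<rho> * A \<le> B" "\<rho> * B \<le> A"
          have "s * (\<rho> * B) \<le> s * A" using AB(4) s(1) by (rule mult_left_mono)
          then have "s * B \<le> s / \<rho> * A" using \<rho> by (simp add: le_divide_eq mult_ac)
          moreover have "(1 - s) * A \<le> A" using s(1) AB(1) by (simp add: algebra_simps)
          ultimately have "(1 - s) * A + s * B \<le> (1 + s / \<rho>) * A" by (simp add: distrib_right)
          moreover have "A * (1 - s) \<le> (1 - s) * A + s * B" using s(1) AB by simp
          then have "A \<le> ((1 - s) * A + s * B) / (1 - s)" using s1 by (subst pos_le_divide_eq) simp_all
          ultimately show "(1 - 0) * A + 0 * B \<le> 1 / (1 - s) * ((1 - s) * A + s * B) \<and>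
              (1 - s) * A + s * B \<le> (1 + s / \<rho>) * ((1 - 0) * A + 0 * B)"
            by simp
        qed (use s s1 \<rho> in auto)
        then have "?L \<le> (1 + s / \<rho>) * K / (1 - s)" using Inf_lower by fastforce
        then show ?thesis using s1 by (simp add: le_divide_eq)
      qed
      have p: "0 < 1 + s / \<rho>" using s(1) \<rho> by (simp add: add_pos_nonneg)
      have "?L * (1 - s) / (1 + s / \<rho>) \<le> Inf (Q s)"
        using le p by (intro cInf_greatest[OF s(3)]) (simp add: divide_le_eq mult.commute)
      also have "\<dots> \<le> l" using \<open>\<not> l < Inf (Q s)\<close> by simp
      finally have "?L * (1 - s) \<le> l * (1 + s / \<rho>)" using p by (simp add: divide_le_eq)
      then have "?L - l \<le> s * c" by (simp add: c_def algebra_simps)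
      then show False using sc by simp
    qed
  qed
qed

text \<open>Near 0 all values still exceed the one at 1, so \<open>Inf_less\<close> with
  \<open>r = 1\<close> applies to every pair \<open>s < t\<close>.\<close>

lemma Inf_strict_antimono:
  assumes less: "Inf (Q 1) < Inf (Q 0)"
  shows "\<exists>\<epsilon>. 0 < \<epsilon> \<and> \<epsilon> \<le> 1 \<and> strict_antimono_on {0..\<epsilon>} (\<lambda>t. Inf (Q t))"
proof -
  have ne: "Q s \<noteq> {}" if "0 \<le> s" "s \<le> 1" for s
    using Q_empty[of 0 s] Q_empty[of 1 s] that less by auto
  obtain \<epsilon> where \<epsilon>: "0 < \<epsilon>" "\<epsilon> < 1"
    and low: "\<And>s. 0 \<le> s \<Longrightarrow> s \<le> \<epsilon> \<Longrightarrow> Q s \<noteq> {} \<Longrightarrow> Inf (Q 1) < Inf (Q s)"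
    using Inf_lower_semicontinuous[OF less Inf_nonneg[OF ne]] by auto
  have "Inf (Q t) < Inf (Q s)" if "0 \<le> s" "s < t" "t \<le> \<epsilon>" for s t
    using that \<epsilon> by (intro Inf_less[of s t 1] low ne) auto
  then have "strict_antimono_on {0..\<epsilon>} (\<lambda>t. Inf (Q t))" by (simp add: monotone_on_def)
  then show ?thesis using \<epsilon> by (intro exI[of _ \<epsilon>]) simp
qed

end

section \<open>Lipschitz constants over an open simplex\<close>

locale simplex_aut =
  fixes \<Gamma> :: "('x, 'e, 'g) gog list" and T :: "('x, 'e, 'g, 'v) tree_tuple"
    and \<sigma> :: "nat \<Rightarrow> nat" and \<psi>
  assumes nonempty: "\<Gamma> \<noteq> []"
    and gog: "\<And>i. i < length \<Gamma> \<Longrightarrow> graph_of_groups (\<Gamma> ! i)"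
    and outer: "\<And>i. i < length \<Gamma> \<Longrightarrow> outer_tree (\<Gamma> ! i) (T i)"
    and \<sigma>: "\<And>i. i < length \<Gamma> \<Longrightarrow> \<sigma> i < length \<Gamma>"
    and \<psi>: "\<And>i. i < length \<Gamma> \<Longrightarrow> \<psi> i \<in> hom (pi1 (\<Gamma> ! i)) (pi1 (\<Gamma> ! \<sigma> i))"
begin

definition elen where "elen c i = (\<lambda>e. c i (edge_orbit (pi1 (\<Gamma> ! i)) (T i) e))"

definition D where "D c i = pdist ((T i)\<lparr>len := elen c i\<rparr>)"

definition Q where
  "Q c = stretch_bounds \<Gamma> (with_lengths \<Gamma> T c) (aut_act \<Gamma> (\<sigma>, \<psi>) (with_lengths \<Gamma> T c))"

text \<open>Equivariance twisted by \<open>\<psi>\<close> and stated without lengths: the same maps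
  are admissible at every point of the simplex.\<close>

definition eqv where
  "eqv i f \<longleftrightarrow> f \<in> points (T i) \<rightarrow> points (T (\<sigma> i)) \<and>
     (\<forall>g\<in>carrier (pi1 (\<Gamma> ! i)). \<forall>p\<in>points (T i).
        f (point_act (pi1 (\<Gamma> ! i)) (T i) g p) = point_act (pi1 (\<Gamma> ! \<sigma> i)) (T (\<sigma> i)) (\<psi> i g) (f p))"

lemma with_lengths_nth: "i < length \<Gamma> \<Longrightarrow> with_lengths \<Gamma> T c i = (T i)\<lparr>len := elen c i\<rparr>"
  by (simp add: with_lengths_def elen_def)

lemma group: "i < length \<Gamma> \<Longrightarrow> group (pi1 (\<Gamma> ! i))"
  using outer_treeD(2)[OF outer] .

lemma tree: "i < length \<Gamma> \<Longrightarrow> simplicial_tree (verts (T i)) (edges (T i))"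
  using metric_gtreeD(1)[OF outer_treeD(1)[OF outer]] .

lemma elen_pos: "c \<in> length_cone \<Gamma> T \<Longrightarrow> i < length \<Gamma> \<Longrightarrow> \<forall>e\<in>edges (T i). 0 < elen c i e"
  by (simp add: length_cone_def elen_def)

lemma outer_tree_elen:
  assumes "c \<in> length_cone \<Gamma> T" and "i < length \<Gamma>"
  shows "outer_tree (\<Gamma> ! i) ((T i)\<lparr>len := elen c i\<rparr>)"
  using outer_tree_with_lengths[OF outer[OF assms(2)], of "c i"] elen_pos[OF assms]
  by (simp add: elen_def)

lemma metric_elen:
  assumes "c \<in> length_cone \<Gamma> T" and "i < length \<Gamma>"
  shows "metric_gtree (pi1 (\<Gamma> ! i)) ((T i)\<lparr>len := elen c i\<rparr>)"
  using outer_treeD(1)[OF outer_tree_elen[OF assms]] .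

lemma displacement_eq:
  assumes "c \<in> length_cone \<Gamma> T"
  shows "displacement \<Gamma> (\<sigma>, \<psi>) (outer_class \<Gamma> (with_lengths \<Gamma> T c)) = Inf (Q c)"
  unfolding Q_def using outer_tree_elen[OF assms]
  by (intro displacement_outer_class nonempty \<sigma> \<psi>) (simp_all add: with_lengths_nth)

lemma Q_iff:
  "C \<in> Q c \<longleftrightarrow> (\<exists>f. \<forall>i<length \<Gamma>. eqv i (f i) \<and> 0 \<le> C \<and>
     (\<forall>p\<in>points (T i). \<forall>q\<in>points (T i). D c (\<sigma> i) (f i p) (f i q) \<le> C * D c i p q))"
proof -
  have "equivariant (pi1 (\<Gamma> ! i)) (with_lengths \<Gamma> T c i)
        (aut_act \<Gamma> (\<sigma>, \<psi>) (with_lengths \<Gamma> T c) i) f \<longleftrightarrow> eqv i f"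
    and "C \<in> lip_bounds (with_lengths \<Gamma> T c i) (aut_act \<Gamma> (\<sigma>, \<psi>) (with_lengths \<Gamma> T c) i) f \<longleftrightarrow>
      0 \<le> C \<and> (\<forall>p\<in>points (T i). \<forall>q\<in>points (T i). D c (\<sigma> i) (f p) (f q) \<le> C * D c i p q)"
    if i: "i < length \<Gamma>" for i f
  proof -
    have w: "aut_act \<Gamma> (\<sigma>, \<psi>) (with_lengths \<Gamma> T c) i
        = (with_lengths \<Gamma> T c (\<sigma> i))\<lparr>act := \<lambda>g. act (with_lengths \<Gamma> T c (\<sigma> i)) (\<psi> i g)\<rparr>"
      by (rule aut_act_nth[OF i])
    have "point_act (pi1 (\<Gamma> ! i)) (aut_act \<Gamma> (\<sigma>, \<psi>) (with_lengths \<Gamma> T c) i) g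
        = point_act (pi1 (\<Gamma> ! \<sigma> i)) (T (\<sigma> i)) (\<psi> i g)" if "g \<in> carrier (pi1 (\<Gamma> ! i))" for g
      unfolding w point_act_twist[OF group[OF i] group[OF \<sigma>[OF i]] \<psi>[OF i] that]
      by (simp add: with_lengths_nth \<sigma> i)
    then show "equivariant (pi1 (\<Gamma> ! i)) (with_lengths \<Gamma> T c i)
        (aut_act \<Gamma> (\<sigma>, \<psi>) (with_lengths \<Gamma> T c) i) f \<longleftrightarrow> eqv i f"
      unfolding equivariant_def eqv_def w by (simp add: with_lengths_nth \<sigma> i)
    show "C \<in> lip_bounds (with_lengths \<Gamma> T c i) (aut_act \<Gamma> (\<sigma>, \<psi>) (with_lengths \<Gamma> T c) i) f \<longleftrightarrow>
      0 \<le> C \<and> (\<forall>p\<in>points (T i). \<forall>q\<in>points (T i). D c (\<sigma> i) (f p) (f q) \<le> C * D c i p q)"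
      unfolding lip_bounds_def w by (simp add: with_lengths_nth \<sigma> i D_def)
  qed
  then show ?thesis unfolding Q_def stretch_bounds_def by simp
qed

lemma Q_nonneg: "C \<in> Q c \<Longrightarrow> 0 \<le> C"
  unfolding Q_def by (rule stretch_bounds_nonneg[OF nonempty])

lemma D_nonneg:
  assumes "c \<in> length_cone \<Gamma> T" and "i < length \<Gamma>"
  shows "0 \<le> D c i p q"
  unfolding D_def by (rule outer_treeD(3)[OF outer_tree_elen[OF assms]])

lemma D_linear:
  assumes "a \<in> length_cone \<Gamma> T" and "b \<in> length_cone \<Gamma> T" and i: "i < length \<Gamma>"
    and "0 \<le> x" and "0 \<le> y" and "0 < x + y" and "p \<in> points (T i)" and "q \<in> points (T i)"
  shows "D (\<lambda>i ob. x * a i ob + y * b i ob) i p q = x * D a i p q + y * D b i p q"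
proof -
  note ab = elen_pos[OF assms(1) i] elen_pos[OF assms(2) i]
  have "\<forall>e\<in>edges (T i). 0 < x * elen a i e + y * elen b i e"
  proof
    fix e assume "e \<in> edges (T i)"
    then have e: "0 < elen a i e" "0 < elen b i e" using ab by auto
    show "0 < x * elen a i e + y * elen b i e"
    proof (cases "x = 0")
      case False
      then show ?thesis using e assms(4,5) by (intro add_pos_nonneg mult_pos_pos) auto
    qed (use e assms(6) in simp)
  qed
  then show ?thesis
    using pdist_linear[OF tree[OF i] ab _ assms(7,8)] by (simp add: D_def elen_def)
qed

text \<open>The maps are kept; \<open>\<alpha>\<close> accounts for the change of metric in the
  target and \<open>\<beta>\<close> for that in the source.\<close>

lemma Q_rescale:
  assumes K: "K \<in> Q c" and "0 \<le> \<alpha>" and "0 \<le> \<beta>"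
    and \<alpha>: "\<And>i p q. i < length \<Gamma> \<Longrightarrow> p \<in> points (T i) \<Longrightarrow> q \<in> points (T i) \<Longrightarrow>
      D d i p q \<le> \<alpha> * D c i p q"
    and \<beta>: "\<And>i p q. i < length \<Gamma> \<Longrightarrow> p \<in> points (T i) \<Longrightarrow> q \<in> points (T i) \<Longrightarrow>
      D c i p q \<le> \<beta> * D d i p q"
  shows "\<alpha> * \<beta> * K \<in> Q d"
proof -
  obtain f where f: "\<And>i. i < length \<Gamma> \<Longrightarrow> eqv i (f i)"
    and lip: "\<And>i p q. i < length \<Gamma> \<Longrightarrow> p \<in> points (T i) \<Longrightarrow> q \<in> points (T i) \<Longrightarrow>
      D c (\<sigma> i) (f i p) (f i q) \<le> K * D c i p q"
    using K unfolding Q_iff by blast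
  have "0 \<le> K" using Q_nonneg K .
  have "D d (\<sigma> i) (f i p) (f i q) \<le> \<alpha> * \<beta> * K * D d i p q"
    if i: "i < length \<Gamma>" and pq: "p \<in> points (T i)" "q \<in> points (T i)" for i p q
  proof -
    have "f i p \<in> points (T (\<sigma> i))" "f i q \<in> points (T (\<sigma> i))"
      using f[OF i] pq by (auto simp: eqv_def)
    then have "D d (\<sigma> i) (f i p) (f i q) \<le> \<alpha> * D c (\<sigma> i) (f i p) (f i q)"
      using \<alpha> \<sigma>[OF i] by blast
    also have "\<dots> \<le> \<alpha> * (K * (\<beta> * D d i p q))"
      using lip[OF i pq] \<beta>[OF i pq] \<open>0 \<le> K\<close> assms(2)
      by (meson mult_left_mono order_trans)
    finally show ?thesis by (simp add: mult_ac)
  qed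
  then show ?thesis using f \<open>0 \<le> K\<close> assms(2,3) unfolding Q_iff by (intro exI[of _ f]) simp
qed

lemma length_cone_combine:
  assumes "a \<in> length_cone \<Gamma> T" and "b \<in> length_cone \<Gamma> T"
    and "0 \<le> x" and "0 \<le> y" and "0 < x + y"
  shows "(\<lambda>i ob. x * a i ob + y * b i ob) \<in> length_cone \<Gamma> T"
proof -
  have "0 < x * u + y * v" if "0 < u" "0 < v" for u v :: real
    by (cases "x = 0") (use that assms(3-5) in \<open>auto intro: add_pos_nonneg\<close>)
  then show ?thesis using assms(1,2) by (simp add: length_cone_def)
qed

lemma length_cone_scale:
  assumes "a \<in> length_cone \<Gamma> T" and "0 < x"
  shows "(\<lambda>i ob. x * a i ob) \<in> length_cone \<Gamma> T"
  using assms by (simp add: length_cone_def)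

text \<open>Barycentres are taken in the target tree \<open>T (\<sigma> i)\<close>, for the lengths
  \<open>x\<close> times \<open>a\<close> and \<open>y\<close> times \<open>b\<close>. The
  inequality for \<open>C\<close> remains a hypothesis, because quasi-convexity and the strict drop
  weigh \<open>K\<close> and \<open>K'\<close> differently.\<close>

lemma Q_combine:
  assumes a: "a \<in> length_cone \<Gamma> T" and b: "b \<in> length_cone \<Gamma> T" and xy: "0 < x" "0 < y"
    and K: "K \<in> Q a" and K': "K' \<in> Q b" and "0 \<le> C"
    and C: "\<And>i p q. i < length \<Gamma> \<Longrightarrow> p \<in> points (T i) \<Longrightarrow> q \<in> points (T i) \<Longrightarrow>
      x * (K * D a i p q) + y * (K' * D b i p q) \<le> C * (x * D a i p q + y * D b i p q)"
  shows "C \<in> Q (\<lambda>i ob. x * a i ob + y * b i ob)"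
proof -
  let ?c = "\<lambda>i ob. x * a i ob + y * b i ob"
  let ?a = "\<lambda>i ob. x * a i ob" and ?b = "\<lambda>i ob. y * b i ob"
  have xy0: "0 \<le> x" "0 \<le> y" "0 < x + y" using xy by auto
  have scale: "D ?a i p q = x * D a i p q" "D ?b i p q = y * D b i p q"
    if "i < length \<Gamma>" "p \<in> points (T i)" "q \<in> points (T i)" for i p q
    using D_linear[OF a a that(1), of x 0 p q] D_linear[OF b b that(1), of y 0 p q] xy that by simp_all
  obtain f where f: "\<And>i. i < length \<Gamma> \<Longrightarrow> eqv i (f i)"
    and fl: "\<And>i p q. i < length \<Gamma> \<Longrightarrow> p \<in> points (T i) \<Longrightarrow> q \<in> points (T i) \<Longrightarrow>
      D a (\<sigma> i) (f i p) (f i q) \<le> K * D a i p q"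
    using K unfolding Q_iff by blast
  obtain f' where f': "\<And>i. i < length \<Gamma> \<Longrightarrow> eqv i (f' i)"
    and fl': "\<And>i p q. i < length \<Gamma> \<Longrightarrow> p \<in> points (T i) \<Longrightarrow> q \<in> points (T i) \<Longrightarrow>
      D b (\<sigma> i) (f' i p) (f' i q) \<le> K' * D b i p q"
    using K' unfolding Q_iff by blast
  define good where "good i h \<longleftrightarrow> eqv i h \<and>
    (\<forall>p\<in>points (T i). \<forall>q\<in>points (T i). D ?c (\<sigma> i) (h p) (h q) \<le> C * D ?c i p q)" for i h
  have "\<exists>h. good i h" if i: "i < length \<Gamma>" for i
  proof -
    let ?H = "pi1 (\<Gamma> ! \<sigma> i)" and ?S = "T (\<sigma> i)"
    note \<sigma>i = \<sigma>[OF i]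
    obtain m where mP: "\<forall>x\<in>points ?S. \<forall>y\<in>points ?S. m x y \<in> points ?S"
      and m_act: "\<forall>g\<in>carrier ?H. \<forall>x\<in>points ?S. \<forall>y\<in>points ?S.
        m (point_act ?H ?S g x) (point_act ?H ?S g y) = point_act ?H ?S g (m x y)"
      and m_lip: "\<forall>x\<in>points ?S. \<forall>y\<in>points ?S. \<forall>x'\<in>points ?S. \<forall>y'\<in>points ?S.
        pdist (?S\<lparr>len := \<lambda>e. elen ?a (\<sigma> i) e + elen ?b (\<sigma> i) e\<rparr>) (m x y) (m x' y')
        \<le> pdist (?S\<lparr>len := elen ?a (\<sigma> i)\<rparr>) x x' + pdist (?S\<lparr>len := elen ?b (\<sigma> i)\<rparr>) y y'"
      using barycentre_map[OF metric_elen[OF length_cone_scale[OF a xy(1)] \<sigma>i]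
          metric_elen[OF length_cone_scale[OF b xy(2)] \<sigma>i]]
      by (elim exE conjE) (rule that)
    have fp: "f i p \<in> points ?S" "f' i p \<in> points ?S" if "p \<in> points (T i)" for p
      using f[OF i] f'[OF i] that by (auto simp: eqv_def)
    have \<psi>g: "\<psi> i g \<in> carrier ?H" if "g \<in> carrier (pi1 (\<Gamma> ! i))" for g
      using \<psi>[OF i] that by (auto simp: hom_def)
    let ?h = "\<lambda>p. m (f i p) (f' i p)"
    have "eqv i ?h"
      using f[OF i] f'[OF i] fp mP m_act \<psi>g by (simp add: eqv_def)
    moreover have "D ?c (\<sigma> i) (?h p) (?h q) \<le> C * D ?c i p q"
      if pq: "p \<in> points (T i)" "q \<in> points (T i)" for p q
    proof -
      have "D ?c (\<sigma> i) (?h p) (?h q) \<le> D ?a (\<sigma> i) (f i p) (f i q) + D ?b (\<sigma> i) (f' i p) (f' i q)"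
        using m_lip fp pq by (simp add: D_def elen_def)
      also have "\<dots> = x * D a (\<sigma> i) (f i p) (f i q) + y * D b (\<sigma> i) (f' i p) (f' i q)"
        using scale[OF \<sigma>i] fp pq by simp
      also have "\<dots> \<le> x * (K * D a i p q) + y * (K' * D b i p q)"
        using fl[OF i pq] fl'[OF i pq] xy by (intro add_mono mult_left_mono) auto
      also have "\<dots> \<le> C * (x * D a i p q + y * D b i p q)" by (rule C[OF i pq])
      also have "\<dots> = C * D ?c i p q" using D_linear[OF a b i xy0 pq] by simp
      finally show ?thesis .
    qed
    ultimately have "good i ?h" unfolding good_def by blast
    then show ?thesis by blast
  qed
  then obtain h where "\<forall>i<length \<Gamma>. good i (h i)" by metis
  then show ?thesis unfolding Q_iff good_def using \<open>0 \<le> C\<close> by (intro exI[of _ h]) simp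
qed

text \<open>Cofiniteness of the action enters here: only finitely many edge lengths are compared.\<close>

lemma length_ratio:
  assumes a: "a \<in> length_cone \<Gamma> T" and b: "b \<in> length_cone \<Gamma> T"
  obtains \<rho> :: real where "0 < \<rho>" and "\<rho> \<le> 1"
    and "\<And>i e. i < length \<Gamma> \<Longrightarrow> e \<in> edges (T i) \<Longrightarrow> \<rho> * elen a i e \<le> elen b i e"
    and "\<And>i e. i < length \<Gamma> \<Longrightarrow> e \<in> edges (T i) \<Longrightarrow> \<rho> * elen b i e \<le> elen a i e"
proof -
  \<comment> \<open>The 1 yields \<open>\<rho> \<le> 1\<close> and keeps the set nonempty when no
    tree has an edge.\<close>
  define X where "X = insert 1 (\<Union>i<length \<Gamma>. \<Union>ob\<in>edge_orbit (pi1 (\<Gamma> ! i)) (T i) ` edges (T i).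
    {a i ob / b i ob, b i ob / a i ob})"
  have fin: "finite X"
    unfolding X_def by (intro finite.insertI finite_UN_I finite_edge_orbits gog outer) auto
  have pos: "0 < Min X"
  proof -
    have "\<forall>x\<in>X. 0 < x" using a b by (auto simp: X_def length_cone_def)
    moreover have "Min X \<in> X" using fin by (intro Min_in) (auto simp: X_def)
    ultimately show ?thesis by blast
  qed
  have le: "Min X \<le> x" if "x \<in> X" for x using fin that by simp
  show thesis
  proof (rule that[OF pos])
    show "Min X \<le> 1" by (rule le) (simp add: X_def)
    fix i e assume i: "i < length \<Gamma>" and e: "e \<in> edges (T i)"
    have p: "0 < elen a i e" "0 < elen b i e" using elen_pos a b i e by auto
    have "elen a i e / elen b i e \<in> X" "elen b i e / elen a i e \<in> X"
      using i e by (auto simp: X_def elen_def)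
    then have "Min X \<le> elen a i e / elen b i e" "Min X \<le> elen b i e / elen a i e" using le by auto
    then show "Min X * elen a i e \<le> elen b i e" "Min X * elen b i e \<le> elen a i e"
      using p by (simp_all add: le_divide_eq)
  qed
qed

text \<open>The numbers \<open>A\<close> and \<open>B\<close> of the locale become
  \<open>D a i p q\<close> and \<open>D b i p q\<close>. Distances at \<open>t\<close> are their
  mixtures by linearity, and bounds on edge lengths pass to distances with the same factor.\<close>

lemma segment_family:
  assumes a: "a \<in> length_cone \<Gamma> T" and b: "b \<in> length_cone \<Gamma> T"
  obtains \<rho> where "lipschitz_family (\<lambda>t. if 0 \<le> t \<and> t \<le> 1
    then Q (\<lambda>i ob. (1 - t) * a i ob + t * b i ob) else {}) \<rho>"
proof -
  let ?c = "\<lambda>t i ob. (1 - t) * a i ob + t * b i ob"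
  obtain \<rho> where \<rho>: "0 < \<rho>" "\<rho> \<le> 1"
    and ab: "\<And>i e. i < length \<Gamma> \<Longrightarrow> e \<in> edges (T i) \<Longrightarrow> \<rho> * elen a i e \<le> elen b i e"
    and ba: "\<And>i e. i < length \<Gamma> \<Longrightarrow> e \<in> edges (T i) \<Longrightarrow> \<rho> * elen b i e \<le> elen a i e"
    using length_ratio[OF a b] by metis
  have D_le: "\<rho> * D c i p q \<le> D d i p q"
    if cd: "c \<in> length_cone \<Gamma> T" and i: "i < length \<Gamma>"
      and le: "\<And>e. e \<in> edges (T i) \<Longrightarrow> \<rho> * elen c i e \<le> elen d i e"
      and pq: "p \<in> points (T i)" "q \<in> points (T i)" for c d i p q
  proof -
    have "pdist ((T i)\<lparr>len := \<lambda>e. \<rho> * elen c i e\<rparr>) p q \<le> pdist ((T i)\<lparr>len := elen d i\<rparr>) p q"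
      using tree[OF i] elen_pos[OF cd i] le pq \<rho>(1) by (intro pdist_mono) auto
    moreover have "\<rho> * D c i p q = pdist ((T i)\<lparr>len := \<lambda>e. \<rho> * elen c i e\<rparr>) p q"
      using D_linear[OF cd cd i, of \<rho> 0 p q] \<rho>(1) pq by (simp add: D_def elen_def)
    ultimately show ?thesis by (simp add: D_def)
  qed
  have cone: "?c t \<in> length_cone \<Gamma> T" if "0 \<le> t" "t \<le> 1" for t
    using length_cone_combine[OF a b, of "1 - t" t] that by simp
  have D_mix: "D (?c t) i p q = (1 - t) * D a i p q + t * D b i p q"
    if "0 \<le> t" "t \<le> 1" "i < length \<Gamma>" "p \<in> points (T i)" "q \<in> points (T i)" for t i p q
    using D_linear[OF a b that(3), of "1 - t" t p q] that by simp
  show thesis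
  proof (rule that[of \<rho>], unfold_locales)
    show "0 < \<rho>" "\<rho> \<le> 1" by (fact \<rho>)+
    show "0 \<le> C" if "C \<in> (if 0 \<le> t \<and> t \<le> 1 then Q (?c t) else {})" for C t
      using that Q_nonneg by (auto split: if_splits)
  next
    fix s r \<tau> K K' C :: real
    assume s: "0 \<le> s" "s \<le> 1" and r: "0 \<le> r" "r \<le> 1" and \<tau>: "0 < \<tau>" "\<tau> < 1"
      and K: "K \<in> (if 0 \<le> s \<and> s \<le> 1 then Q (?c s) else {})"
      and K': "K' \<in> (if 0 \<le> r \<and> r \<le> 1 then Q (?c r) else {})" and C: "0 \<le> C"
      and *: "\<And>A B. \<lbrakk>0 \<le> A; 0 \<le> B; \<rho> * A \<le> B; \<rho> * B \<le> A\<rbrakk> \<Longrightarrow>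
        (1 - \<tau>) * (K * ((1 - s) * A + s * B)) + \<tau> * (K' * ((1 - r) * A + r * B))
        \<le> C * ((1 - \<tau>) * ((1 - s) * A + s * B) + \<tau> * ((1 - r) * A + r * B))"
    let ?u = "(1 - \<tau>) * s + \<tau> * r"
    have u: "0 \<le> ?u" "?u \<le> 1" using s r \<tau> convex_bound_le[of s 1 r "1 - \<tau>" \<tau>] by auto
    have "C \<in> Q (\<lambda>i ob. (1 - \<tau>) * ?c s i ob + \<tau> * ?c r i ob)"
    proof (rule Q_combine[OF cone[OF s] cone[OF r]])
      show "K \<in> Q (?c s)" "K' \<in> Q (?c r)" using K K' s r by auto
      fix i p q assume i: "i < length \<Gamma>" and pq: "p \<in> points (T i)" "q \<in> points (T i)"
      show "(1 - \<tau>) * (K * D (?c s) i p q) + \<tau> * (K' * D (?c r) i p q)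
          \<le> C * ((1 - \<tau>) * D (?c s) i p q + \<tau> * D (?c r) i p q)"
        unfolding D_mix[OF s i pq] D_mix[OF r i pq]
        using D_nonneg a b i D_le[OF a i ab[OF i] pq] D_le[OF b i ba[OF i] pq] by (intro *) auto
    qed (use \<tau> C in auto)
    \<comment> \<open>The subsegment from \<open>s\<close> to \<open>r\<close> is parametrised
      affinely by \<open>\<tau>\<close>.\<close>
    moreover have "(\<lambda>i ob. (1 - \<tau>) * ?c s i ob + \<tau> * ?c r i ob) = ?c ?u"
      by (intro ext) (simp add: algebra_simps)
    ultimately show "C \<in> (if 0 \<le> ?u \<and> ?u \<le> 1 then Q (?c ?u) else {})" using u by simp
  next
    fix s r K \<alpha> \<beta> :: real
    assume s: "0 \<le> s" "s \<le> 1" and r: "0 \<le> r" "r \<le> 1"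
      and K: "K \<in> (if 0 \<le> s \<and> s \<le> 1 then Q (?c s) else {})" and \<alpha>\<beta>: "0 \<le> \<alpha>" "0 \<le> \<beta>"
      and *: "\<And>A B. \<lbrakk>0 \<le> A; 0 \<le> B; \<rho> * A \<le> B; \<rho> * B \<le> A\<rbrakk> \<Longrightarrow>
        (1 - r) * A + r * B \<le> \<alpha> * ((1 - s) * A + s * B) \<and>
        (1 - s) * A + s * B \<le> \<beta> * ((1 - r) * A + r * B)"
    have D: "D (?c r) i p q \<le> \<alpha> * D (?c s) i p q \<and> D (?c s) i p q \<le> \<beta> * D (?c r) i p q"
      if i: "i < length \<Gamma>" and pq: "p \<in> points (T i)" "q \<in> points (T i)" for i p q
      unfolding D_mix[OF s i pq] D_mix[OF r i pq]
      using D_nonneg a b i D_le[OF a i ab[OF i] pq] D_le[OF b i ba[OF i] pq] by (intro *) auto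
    have "K \<in> Q (?c s)" using K s by simp
    then have "\<alpha> * \<beta> * K \<in> Q (?c r)" using \<alpha>\<beta> D by (intro Q_rescale) auto
    then show "\<alpha> * \<beta> * K \<in> (if 0 \<le> r \<and> r \<le> 1 then Q (?c r) else {})" using r by simp
  qed
qed

end

section \<open>Quasi-convexity and strict monotonicity of the displacement\<close>

theorem lemma6p2:
  fixes \<Gamma> :: "('x, 'e, 'g) gog list"
    and \<Delta> :: "('x, 'e, 'g, 'v) outer_point set"
  assumes "gog_union \<Gamma>"
    and "\<Phi> \<in> carrier (Out \<Gamma>)" and "\<phi> \<in> \<Phi>"
    and "\<Delta> \<in> open_simplices \<Gamma>"
    and "A \<in> \<Delta>" and "B \<in> \<Delta>"
    and "euclidean_segment \<Gamma> \<Delta> A B \<gamma>"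
  shows "quasi_convex 0 1 (\<lambda>t. displacement \<Gamma> \<phi> (\<gamma> t)) \<and>
    (displacement \<Gamma> \<phi> A > displacement \<Gamma> \<phi> B \<longrightarrow>
       (\<exists>\<epsilon>. 0 < \<epsilon> \<and> \<epsilon> \<le> 1 \<and> strict_antimono_on {0..\<epsilon>} (\<lambda>t. displacement \<Gamma> \<phi> (\<gamma> t))))"
proof -
  obtain T a b where T: "\<And>i. i < length \<Gamma> \<Longrightarrow> outer_tree (\<Gamma> ! i) (T i)"
    and a: "a \<in> length_cone \<Gamma> T" and b: "b \<in> length_cone \<Gamma> T"
    and A: "A = outer_class \<Gamma> (with_lengths \<Gamma> T a)" and B: "B = outer_class \<Gamma> (with_lengths \<Gamma> T b)"
    and \<gamma>: "\<And>t. t \<in> {0..1} \<Longrightarrow> \<gamma> t = outer_class \<Gamma>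
      (with_lengths \<Gamma> T (\<lambda>i ob. (1 - t) * a i ob + t * b i ob))"
    using assms(7) unfolding euclidean_segment_def by blast
  obtain \<sigma> \<psi> where \<phi>: "\<phi> = (\<sigma>, \<psi>)" by fastforce
  have gog: "graph_of_groups (\<Gamma> ! i)" if "i < length \<Gamma>" for i
    using assms(1) that by (simp add: gog_union_def)
  have grp: "group (pi1 (\<Gamma> ! i))" if "i < length \<Gamma>" for i
    using outer_treeD(2)[OF T[OF that]] .
  interpret simplex_aut \<Gamma> T \<sigma> \<psi>
  proof
    show "\<Gamma> \<noteq> []" using assms(1) by (simp add: gog_union_def)
    show "\<sigma> i < length \<Gamma>" "\<psi> i \<in> hom (pi1 (\<Gamma> ! i)) (pi1 (\<Gamma> ! \<sigma> i))" if "i < length \<Gamma>" for i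
      using Out_hom[OF assms(2) _ grp that, of \<sigma> \<psi>] assms(3) \<phi> by auto
  qed (use gog T in auto)
  let ?Q = "\<lambda>t. if 0 \<le> t \<and> t \<le> 1 then Q (\<lambda>i ob. (1 - t) * a i ob + t * b i ob) else {}"
  obtain \<rho> where "lipschitz_family ?Q \<rho>" using segment_family[OF a b] .
  then interpret L: lipschitz_family ?Q \<rho> .
  \<comment> \<open>The displacement may be computed on any representatives; those built on
    \<open>T\<close> share their vertices and edges for all \<open>t\<close>.\<close>
  have eq: "displacement \<Gamma> \<phi> (\<gamma> t) = Inf (?Q t)" if "0 \<le> t" "t \<le> 1" for t
    using displacement_eq[OF length_cone_combine[OF a b, of "1 - t" t]] \<gamma>[of t] that \<phi> by simp
  have end_points: "\<gamma> 0 = A" "\<gamma> 1 = B" using \<gamma>[of 0] \<gamma>[of 1] A B by simp_all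
  have "quasi_convex 0 1 (\<lambda>t. displacement \<Gamma> \<phi> (\<gamma> t))"
    unfolding quasi_convex_def
  proof (intro allI impI, elim conjE)
    fix x y t :: real assume t: "0 \<le> x" "y \<le> 1" "x \<le> t" "t \<le> y"
    have "Inf (?Q t) \<le> max (Inf (?Q x)) (Inf (?Q y))"
      using t by (intro L.Inf_le_max)
    then show "displacement \<Gamma> \<phi> (\<gamma> t) \<le> max (displacement \<Gamma> \<phi> (\<gamma> x)) (displacement \<Gamma> \<phi> (\<gamma> y))"
      using eq[of t] eq[of x] eq[of y] t by simp
  qed
  moreover have "\<exists>\<epsilon>. 0 < \<epsilon> \<and> \<epsilon> \<le> 1 \<and> strict_antimono_on {0..\<epsilon>} (\<lambda>t. displacement \<Gamma> \<phi> (\<gamma> t))"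
    if "displacement \<Gamma> \<phi> B < displacement \<Gamma> \<phi> A"
  proof -
    have "Inf (?Q 1) < Inf (?Q 0)" using that eq[of 0] eq[of 1] end_points by simp
    then obtain \<epsilon> where \<epsilon>: "0 < \<epsilon>" "\<epsilon> \<le> 1" "strict_antimono_on {0..\<epsilon>} (\<lambda>t. Inf (?Q t))"
      using L.Inf_strict_antimono by blast
    have "displacement \<Gamma> \<phi> (\<gamma> t) < displacement \<Gamma> \<phi> (\<gamma> s)" if "0 \<le> s" "s < t" "t \<le> \<epsilon>" for s t
    proof -
      have "Inf (?Q t) < Inf (?Q s)"
        by (rule monotone_onD[OF \<epsilon>(3)]) (use that in auto)
      then show ?thesis using eq[of s] eq[of t] that \<epsilon>(2) by linarith
    qed
    then have "strict_antimono_on {0..\<epsilon>} (\<lambda>t. displacement \<Gamma> \<phi> (\<gamma> t))"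
      by (simp add: monotone_on_def)
    then show ?thesis using \<epsilon>(1,2) by blast
  qed
  ultimately show ?thesis by blast
qed

end
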